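(* Consider the $M$-layer delayed hierarchical system described in the context, with interlayer delays $\tau_2,\dots,\tau_M\ge0$. The set of roots $s\in\mathbb{C}$ of its characteristic equation \[ \det\!\Big(sI+L^{(1)}+\sum_{l=2}^{M}e^{-2s\sum_{i=2}^{l}\tau_i}L^{(l)}\Big)=0 \] equals the union of the solution sets of the equations \[ s=0;\qquad s+\lambda^{(1)}=0;\qquad s\,e^{2s\sum_{i=2}^{l}\tau_i}+\lambda^{(l)}=0,\ \ l=2,\dots,M, \] where $\lambda^{(l)}$ ranges over the nonzero eigenvalues of $L^{(l)}$. Moreover, for every initial value $x^{(1)}_0$ all physical-layer states converge to the consensus \[ \lim_{t\to\infty}x^{(1)}(t)=\frac{\mathbf{1}\mathbf{1}^TK}{\mathbf{1}^TK\mathbf{1}}\,x^{(1)}_0,\qquad K=\mathrm{diag}(a_1,\dots,a_{N^{(1)}}), \] if and only if \[ \sum_{i=2}^{l}\tau_i<\frac{\pi}{4\lambda^{(l)}_{\max}},\qquad l=2,\dots,M, \] where $\lambda^{(l)}_{\max}$ is the maximum eigenvalue of $L^{(l)}$.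
   Context: Hierarchical structure. Fix an integer $M\ge 2$ and positive integers $N^{(1)},\dots,N^{(M)}$; set $N^{(M+1)}:=1$. For each $l\in\{1,\dots,M\}$ the $N^{(l)}$ nodes of layer $l$ are partitioned into $N^{(l+1)}$ groups $G^{(l)}_1,\dots,G^{(l)}_{N^{(l+1)}}$ of sizes $k^{(l)}_p\ge1$, numbered consecutively: group $G^{(l)}_p$ consists of nodes $\sum_{m<p}k^{(l)}_m+1,\dots,\sum_{m\le p}k^{(l)}_m$ of layer $l$; for $l\le M-1$, group $G^{(l)}_p$ is subordinate to node $p$ of layer $l+1$. Each group carries a connected undirected graph with binary adjacency matrix; $L^{(l)}_p$ is its Laplacian (degree matrix minus adjacency matrix), $L^{(l)}_D=\mathrm{diag}(L^{(l)}_1,\dots,L^{(l)}_{N^{(l+1)}})$. Weights: positive constants $a_1,\dots,a_{N^{(1)}}$; $a^{(1)}_i=a_i$, $a^{(l+1)}_p=\sum_{i\in G^{(l)}_p}a^{(l)}_i$; $K^{(l)}=\mathrm{diag}(a^{(l)}_1,\dots,a^{(l)}_{N^{(l)}})^{-1}$. For $l=1,\dots,M-1$: $B^{(l)}=\mathrm{diag}(\mathbf{1}_{k^{(l)}_1},\dots,\mathbf{1}_{k^{(l)}_{N^{(l+1)}}})\in\mathbb{R}^{N^{(l)}\times N^{(l+1)}}$ ($\mathbf 1_k$ all-ones column vector), $C^{(l)}=\mathrm{diag}(C^{(l)}_1,\dots,C^{(l)}_{N^{(l+1)}})\in\mathbb{R}^{N^{(l+1)}\times N^{(l)}}$ with each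 row vector $C^{(l)}_p$ having nonnegative entries summing to $1$. $L^{(1)}=K^{(1)}L^{(1)}_D$ and $L^{(l)}=B^{(1)}\cdots B^{(l-1)}K^{(l)}L^{(l)}_DC^{(l-1)}\cdots C^{(1)}$ for $l=2,\dots,M$ (these have real nonnegative eigenvalues). Delayed system ($\tau_l$ is the communication delay between layers $l-1$ and $l$): $\dot x^{(1)}(t)=-K^{(1)}L^{(1)}_Dx^{(1)}(t)+y^{(1)}(t)$, and for $l=2,\dots,M$: $x^{(l)}(t)=C^{(l-1)}x^{(l-1)}(t-\tau_l)$, $y^{(l-1)}(t)=B^{(l-1)}\big[-K^{(l)}L^{(l)}_Dx^{(l)}(t-\tau_l)+y^{(l)}(t-\tau_l)\big]$, with $y^{(M)}\equiv0$; $x^{(1)}(0)=x^{(1)}_0$, and all signals are taken to be zero at negative time arguments. *)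

theory Defs
  imports "HOL-Analysis.Analysis" "Jordan_Normal_Form.Char_Poly"
begin

text \<open>Conventions: layers are indexed 1..M (as in the paper); nodes inside a layer and
groups inside a layer are indexed from 0.  k l p is the size of group p of layer l
(p < N (Suc l)); the groups are numbered consecutively.\<close>

definition off :: "(nat \<Rightarrow> nat \<Rightarrow> nat) \<Rightarrow> nat \<Rightarrow> nat \<Rightarrow> nat" where
  "off k l p = (\<Sum>m<p. k l m)"

definition in_grp :: "(nat \<Rightarrow> nat \<Rightarrow> nat) \<Rightarrow> nat \<Rightarrow> nat \<Rightarrow> nat \<Rightarrow> bool" where
  "in_grp k l p i \<longleftrightarrow> off k l p \<le> i \<and> i < off k l (Suc p)"

definition adj_ok :: "nat \<Rightarrow> real Matrix.mat \<Rightarrow> bool" where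
  "adj_ok n G \<longleftrightarrow> G \<in> carrier_mat n n
     \<and> (\<forall>i<n. \<forall>j<n. G $$ (i,j) = 0 \<or> G $$ (i,j) = 1)
     \<and> (\<forall>i<n. \<forall>j<n. G $$ (i,j) = G $$ (j,i))
     \<and> (\<forall>i<n. \<forall>j<n. (\<lambda>u v. u < n \<and> v < n \<and> G $$ (u,v) = 1)\<^sup>*\<^sup>* i j)"

definition lap :: "real Matrix.mat \<Rightarrow> real Matrix.mat" where
  "lap G = Matrix.mat (dim_row G) (dim_row G)
     (\<lambda>(i,j). (if i = j then (\<Sum>m<dim_row G. G $$ (i,m)) else 0) - G $$ (i,j))"

definition LD :: "(nat \<Rightarrow> nat) \<Rightarrow> (nat \<Rightarrow> nat \<Rightarrow> nat) \<Rightarrow> (nat \<Rightarrow> nat \<Rightarrow> real Matrix.mat)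
                   \<Rightarrow> nat \<Rightarrow> real Matrix.mat" where
  "LD N k A l = Matrix.mat (N l) (N l) (\<lambda>(i,j). \<Sum>p<N (Suc l).
      if in_grp k l p i \<and> in_grp k l p j
      then lap (A l p) $$ (i - off k l p, j - off k l p) else 0)"

fun wts :: "(nat \<Rightarrow> nat \<Rightarrow> nat) \<Rightarrow> (nat \<Rightarrow> real) \<Rightarrow> nat \<Rightarrow> nat \<Rightarrow> real" where
  "wts k a (Suc (Suc l)) = (\<lambda>p. \<Sum>i\<in>{off k (Suc l) p..<off k (Suc l) (Suc p)}. wts k a (Suc l) i)"
| "wts k a 0 = a"
| "wts k a (Suc 0) = a"

definition Kmat :: "(nat \<Rightarrow> nat) \<Rightarrow> (nat \<Rightarrow> nat \<Rightarrow> nat) \<Rightarrow> (nat \<Rightarrow> real) \<Rightarrow> nat \<Rightarrow> real Matrix.mat" where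
  "Kmat N k a l = Matrix.mat (N l) (N l) (\<lambda>(i,j). if i = j then inverse (wts k a l i) else 0)"

definition Bmat :: "(nat \<Rightarrow> nat) \<Rightarrow> (nat \<Rightarrow> nat \<Rightarrow> nat) \<Rightarrow> nat \<Rightarrow> real Matrix.mat" where
  "Bmat N k l = Matrix.mat (N l) (N (Suc l)) (\<lambda>(i,p). if in_grp k l p i then 1 else 0)"

definition Cmat :: "(nat \<Rightarrow> nat) \<Rightarrow> (nat \<Rightarrow> nat \<Rightarrow> nat) \<Rightarrow> (nat \<Rightarrow> nat \<Rightarrow> real) \<Rightarrow> nat \<Rightarrow> real Matrix.mat" where
  "Cmat N k c l = Matrix.mat (N (Suc l)) (N l) (\<lambda>(p,i). if in_grp k l p i then c l i else 0)"

fun Bprod :: "(nat \<Rightarrow> nat) \<Rightarrow> (nat \<Rightarrow> nat \<Rightarrow> nat) \<Rightarrow> nat \<Rightarrow> real Matrix.mat" where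
  "Bprod N k (Suc (Suc l)) = Bprod N k (Suc l) * Bmat N k (Suc l)"
| "Bprod N k 0 = 1\<^sub>m (N 1)"
| "Bprod N k (Suc 0) = 1\<^sub>m (N 1)"

fun Cprod :: "(nat \<Rightarrow> nat) \<Rightarrow> (nat \<Rightarrow> nat \<Rightarrow> nat) \<Rightarrow> (nat \<Rightarrow> nat \<Rightarrow> real) \<Rightarrow> nat \<Rightarrow> real Matrix.mat" where
  "Cprod N k c (Suc (Suc l)) = Cmat N k c (Suc l) * Cprod N k c (Suc l)"
| "Cprod N k c 0 = 1\<^sub>m (N 1)"
| "Cprod N k c (Suc 0) = 1\<^sub>m (N 1)"

definition Lmat :: "(nat \<Rightarrow> nat) \<Rightarrow> (nat \<Rightarrow> nat \<Rightarrow> nat) \<Rightarrow> (nat \<Rightarrow> nat \<Rightarrow> real Matrix.mat)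
     \<Rightarrow> (nat \<Rightarrow> real) \<Rightarrow> (nat \<Rightarrow> nat \<Rightarrow> real) \<Rightarrow> nat \<Rightarrow> real Matrix.mat" where
  "Lmat N k A a c l = (if l = 1 then Kmat N k a 1 * LD N k A 1
     else Bprod N k l * Kmat N k a l * LD N k A l * Cprod N k c l)"

definition hier_structure :: "nat \<Rightarrow> (nat \<Rightarrow> nat) \<Rightarrow> (nat \<Rightarrow> nat \<Rightarrow> nat)
     \<Rightarrow> (nat \<Rightarrow> nat \<Rightarrow> real Matrix.mat) \<Rightarrow> (nat \<Rightarrow> real) \<Rightarrow> (nat \<Rightarrow> nat \<Rightarrow> real) \<Rightarrow> bool" where
  "hier_structure M N k A a c \<longleftrightarrow>
     M \<ge> 2 \<and> N (Suc M) = 1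
   \<and> (\<forall>l\<in>{1..M}. N l > 0)
   \<and> (\<forall>l\<in>{1..M}. (\<forall>p<N (Suc l). k l p \<ge> 1) \<and> (\<Sum>p<N (Suc l). k l p) = N l)
   \<and> (\<forall>l\<in>{1..M}. \<forall>p<N (Suc l). adj_ok (k l p) (A l p))
   \<and> (\<forall>i<N 1. a i > 0)
   \<and> (\<forall>l\<in>{1..M-1}. (\<forall>i<N l. c l i \<ge> 0)
        \<and> (\<forall>p<N (Suc l). (\<Sum>i\<in>{off k l p..<off k l (Suc p)}. c l i) = 1))"

definition Dsum :: "(nat \<Rightarrow> real) \<Rightarrow> nat \<Rightarrow> real" where
  "Dsum \<tau> l = (\<Sum>i\<in>{2..l}. \<tau> i)"

definition charmat :: "nat \<Rightarrow> (nat \<Rightarrow> nat) \<Rightarrow> (nat \<Rightarrow> nat \<Rightarrow> nat) \<Rightarrow> (nat \<Rightarrow> nat \<Rightarrow> real Matrix.mat)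
     \<Rightarrow> (nat \<Rightarrow> real) \<Rightarrow> (nat \<Rightarrow> nat \<Rightarrow> real) \<Rightarrow> (nat \<Rightarrow> real) \<Rightarrow> complex \<Rightarrow> complex Matrix.mat" where
  "charmat M N k A a c \<tau> s = Matrix.mat (N 1) (N 1) (\<lambda>(i,j).
      (if i = j then s else 0) + complex_of_real (Lmat N k A a c 1 $$ (i,j))
      + (\<Sum>l\<in>{2..M}. exp (- 2 * s * complex_of_real (Dsum \<tau> l))
                       * complex_of_real (Lmat N k A a c l $$ (i,j))))"

text \<open>Solutions (x^(l), y^(l))_{l=1..M} of the delayed system with initial value x0.
  The ODE for x^(1) is understood in the integral (Caratheodory) sense on [0,oo);
  all signals vanish at negative times.\<close>
definition delayed_sol :: "nat \<Rightarrow> (nat \<Rightarrow> nat) \<Rightarrow> (nat \<Rightarrow> nat \<Rightarrow> nat) \<Rightarrow> (nat \<Rightarrow> nat \<Rightarrow> real Matrix.mat)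
     \<Rightarrow> (nat \<Rightarrow> real) \<Rightarrow> (nat \<Rightarrow> nat \<Rightarrow> real) \<Rightarrow> (nat \<Rightarrow> real) \<Rightarrow> real Matrix.vec
     \<Rightarrow> (nat \<Rightarrow> real \<Rightarrow> real Matrix.vec) \<Rightarrow> (nat \<Rightarrow> real \<Rightarrow> real Matrix.vec) \<Rightarrow> bool" where
  "delayed_sol M N k A a c \<tau> x0 x y \<longleftrightarrow>
     (\<forall>l\<in>{1..M}. \<forall>t. x l t \<in> carrier_vec (N l) \<and> y l t \<in> carrier_vec (N l))
   \<and> (\<forall>l\<in>{1..M}. \<forall>t<0. x l t = 0\<^sub>v (N l) \<and> y l t = 0\<^sub>v (N l))
   \<and> x 1 0 = x0
   \<and> (\<forall>t. y M t = 0\<^sub>v (N M))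
   \<and> (\<forall>l\<in>{2..M}. \<forall>t\<ge>0. x l t = Cmat N k c (l-1) *\<^sub>v x (l-1) (t - \<tau> l))
   \<and> (\<forall>l\<in>{2..M}. \<forall>t\<ge>0. y (l-1) t = Bmat N k (l-1) *\<^sub>v
          (y l (t - \<tau> l) - (Kmat N k a l * LD N k A l) *\<^sub>v x l (t - \<tau> l)))
   \<and> (\<forall>t\<ge>0. \<forall>i<N 1.
        ((\<lambda>s. (y 1 s - (Kmat N k a 1 * LD N k A 1) *\<^sub>v x 1 s) $ i)
           has_integral (x 1 t $ i - x0 $ i)) {0..t})"

text \<open>Maximum eigenvalue of L^(l) (its eigenvalues are real).\<close>
definition lam_max :: "real Matrix.mat \<Rightarrow> real" where
  "lam_max L = Max {\<mu>. eigenvalue L \<mu>}"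

end

theory Submission
  imports Defs "Jordan_Normal_Form.Schur_Decomposition"
begin

text \<open>
  Since \<open>C\<^sup>(\<^sup>l\<^sup>) B\<^sup>(\<^sup>l\<^sup>) = I\<close> and Laplacians kill vectors that are constant on groups,
  \<open>L\<^sup>(\<^sup>i\<^sup>) L\<^sup>(\<^sup>j\<^sup>) = 0\<close> for \<open>i < j\<close>. Hence
  \<open>(s I + \<Sum>\<^sub>j\<^sub>\<le>\<^sub>m e\<^sub>j L\<^sup>(\<^sup>j\<^sup>)) (s I + e\<^sub>m\<^sub>+\<^sub>1 L\<^sup>(\<^sup>m\<^sup>+\<^sup>1\<^sup>)) = s (s I + \<Sum>\<^sub>j\<^sub>\<le>\<^sub>m\<^sub>+\<^sub>1 e\<^sub>j L\<^sup>(\<^sup>j\<^sup>))\<close>, and the characteristic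
  determinant factors over the layers.

  Eliminating all layers but the first leaves \<open>x' = - \<Sum>\<^sub>j L\<^sup>(\<^sup>j\<^sup>) x(t - T\<^sub>j)\<close> with \<open>T\<^sub>j\<close> twice the
  accumulated delay. By triangularity \<open>L\<^sup>(\<^sup>l\<^sup>) x\<close> obeys a delay equation driven only by the lower
  layers, and as \<open>L\<^sup>(\<^sup>l\<^sup>)\<close> has real nonnegative spectrum and is semisimple at 0, it splits into
  scalar equations \<open>z' = - \<lambda> z(t - T) + f\<close>. If \<open>\<lambda> T < \<pi>/2\<close>, a quadratic Lyapunov functional turns
  square integrable \<open>f\<close> into square integrable \<open>z\<close>; so all \<open>L\<^sup>(\<^sup>l\<^sup>) x\<close> decay, and together with the
  conserved weighted mean this determines the limit of \<open>x\<close>. If \<open>\<lambda> T \<ge> \<pi>/2\<close> for some layer, a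
  solution started in the range of \<open>L\<^sup>(\<^sup>l\<^sup>)\<close> and tested against a left eigenvector solves
  \<open>z' = - \<lambda> z(t - T)\<close>, and a characteristic root in the closed right half plane yields a conserved
  quantity that excludes decay.
\<close>

unbundle no vec_syntax
no_notation inner (infix "\<bullet>" 70)

section \<open>Groups, weights and layer Laplacians\<close>

text \<open>\<open>Lm l\<close> itself need not have any symmetry, because \<open>Cmat\<close>
  averages with arbitrary nonnegative weights. Self-adjoint is only the small matrix
  \<open>Smat l\<close> on layer \<open>l\<close>, for a weighted inner product; its spectral
  properties reach \<open>Lm l\<close> through the intertwining \<open>C L = S C\<close>. On the
  stability side the obstacle is to deduce decay from infinitely many characteristic roots. The
  Lyapunov functional avoids this and is sharp. Square integrability is the right notion of
  smallness because sums, shifts and stable scalar delay equations preserve it along the cascade of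
  layers. The constant 4 arises since the scalar threshold \<open>\<pi>/2\<close> meets the
  round-trip delay, which is twice the one-way delay. On the unstable side the zero history makes
  solutions jump at time 0, so pure exponentials are not solutions; an exponential serves as a test
  function instead. A solution must also be constructed although some layers act without delay,
  which is why the start lies in the range of \<open>Lm l\<close>: the layers below \<open>l\<close>
  then stay silent.\<close>

lemma mult_mat_vec_index:
  assumes "i < dim_row P" "dim_vec v = dim_col P"
  shows "(P *\<^sub>v v) $ i = (\<Sum>j<dim_col P. P $$ (i,j) * v $ j)"
  using assms by (auto simp: scalar_prod_def atLeast0LessThan intro!: sum.cong)

lemma off_Suc: "off k l (Suc p) = off k l p + k l p"
  by (simp add: off_def)

lemma off_mono: "p \<le> q \<Longrightarrow> off k l p \<le> off k l q"
  by (induction q) (auto simp: off_Suc le_Suc_eq)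

lemma in_grp_unique:
  assumes "in_grp k l p i" "in_grp k l q i"
  shows "p = q"
proof (rule ccontr)
  assume "p \<noteq> q"
  then have "Suc p \<le> q \<or> Suc q \<le> p" by auto
  then show False
    using assms off_mono[of "Suc p" q k l] off_mono[of "Suc q" p k l]
    by (auto simp: in_grp_def)
qed

lemma in_grp_exists:
  "i < off k l q \<Longrightarrow> \<exists>p<q. in_grp k l p i"
proof (induction q)
  case 0
  then show ?case by (simp add: off_def)
next
  case (Suc q)
  then show ?case
    by (cases "i < off k l q") (auto simp: in_grp_def less_Suc_eq)
qed

text \<open>As a function of the node, group membership turns a sum over an index interval into a
  sum over the whole layer with an \<open>if\<close>, so that summations can be interchanged. It is
  meaningful for nodes below \<open>N l\<close> only.\<close>

definition grp :: "(nat \<Rightarrow> nat \<Rightarrow> nat) \<Rightarrow> nat \<Rightarrow> nat \<Rightarrow> nat" where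
  "grp k l i = (THE p. in_grp k l p i)"

locale hierarchy =
  fixes M :: nat and N :: "nat \<Rightarrow> nat" and k :: "nat \<Rightarrow> nat \<Rightarrow> nat"
    and A :: "nat \<Rightarrow> nat \<Rightarrow> real Matrix.mat" and a :: "nat \<Rightarrow> real"
    and c :: "nat \<Rightarrow> nat \<Rightarrow> real"
  assumes hier: "hier_structure M N k A a c"
begin

lemma M_ge_2: "M \<ge> 2" and N_top: "N (Suc M) = 1"
  using hier by (auto simp: hier_structure_def)

lemma N_pos: "l \<in> {1..M} \<Longrightarrow> N l > 0"
  using hier by (auto simp: hier_structure_def)

lemma off_end: "l \<in> {1..M} \<Longrightarrow> off k l (N (Suc l)) = N l"
  using hier by (auto simp: hier_structure_def off_def)

lemma in_grp_iff:
  assumes "l \<in> {1..M}" "i < N l"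
  shows "in_grp k l p i \<longleftrightarrow> grp k l i = p"
proof -
  obtain q where q: "in_grp k l q i"
    using in_grp_exists[of i k l "N (Suc l)"] assms by (auto simp: off_end)
  have "grp k l i = q"
    unfolding grp_def using q in_grp_unique by blast
  then show ?thesis using q in_grp_unique by blast
qed

lemma grp_less:
  assumes "l \<in> {1..M}" "i < N l"
  shows "grp k l i < N (Suc l)"
  using in_grp_exists[of i k l "N (Suc l)"] assms in_grp_iff[OF assms] by (auto simp: off_end)

lemma group_interval:
  assumes "l \<in> {1..M}" "p < N (Suc l)"
  shows "{off k l p..<off k l (Suc p)} = {i. i < N l \<and> grp k l i = p}"
proof -
  have "off k l (Suc p) \<le> N l"
    using off_mono[of "Suc p" "N (Suc l)" k l] assms off_end by auto
  then have "i < N l \<and> grp k l i = p" if "in_grp k l p i" for i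
    using that in_grp_iff[OF assms(1), of i p] by (auto simp: in_grp_def)
  moreover have "in_grp k l p i" if "i < N l" "grp k l i = p" for i
    using that in_grp_iff[OF assms(1), of i p] by auto
  moreover have "{off k l p..<off k l (Suc p)} = {i. in_grp k l p i}"
    by (auto simp: in_grp_def)
  ultimately show ?thesis by blast
qed

lemma grp_nonempty:
  assumes "l \<in> {1..M}" "p < N (Suc l)"
  shows "\<exists>i<N l. grp k l i = p"
proof -
  have "k l p \<ge> 1" using hier assms by (auto simp: hier_structure_def)
  then have "off k l p \<in> {off k l p..<off k l (Suc p)}" by (simp add: off_Suc)
  then show ?thesis unfolding group_interval[OF assms] by blast
qed

lemma wts_pos: "l \<in> {1..M} \<Longrightarrow> i < N l \<Longrightarrow> wts k a l i > 0"
proof (induction l arbitrary: i)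
  case 0
  then show ?case by simp
next
  case (Suc l)
  show ?case
  proof (cases l)
    case 0
    then show ?thesis using hier Suc by (auto simp: hier_structure_def)
  next
    case (Suc m)
    have l: "l \<in> {1..M}" using Suc Suc.prems by auto
    obtain j where "j < N l" "grp k l j = i"
      using grp_nonempty[OF l] Suc.prems by auto
    then have "0 < (\<Sum>i\<in>{off k l i..<off k l (Suc i)}. wts k a l i)"
      using Suc.prems l by (intro sum_pos) (auto simp: group_interval[OF l] intro!: Suc.IH)
    then show ?thesis using Suc by simp
  qed
qed

lemma wts_Suc:
  assumes "l \<in> {1..M}" "p < N (Suc l)"
  shows "wts k a (Suc l) p = (\<Sum>i<N l. if grp k l i = p then wts k a l i else 0)"
proof -
  obtain m where "l = Suc m" using assms by (cases l) auto
  then have "wts k a (Suc l) p = (\<Sum>i\<in>{off k l p..<off k l (Suc p)}. wts k a l i)" by simp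
  also have "\<dots> = (\<Sum>i<N l. if grp k l i = p then wts k a l i else 0)"
    unfolding group_interval[OF assms]
    by (rule sum.mono_neutral_cong_left) auto
  finally show ?thesis .
qed

lemma c_sum:
  assumes "l \<in> {1..M-1}" "p < N (Suc l)"
  shows "(\<Sum>i<N l. if grp k l i = p then c l i else 0) = 1"
proof -
  have l: "l \<in> {1..M}" using assms by auto
  have "1 = (\<Sum>i\<in>{off k l p..<off k l (Suc p)}. c l i)"
    using hier assms by (auto simp: hier_structure_def)
  also have "\<dots> = (\<Sum>i<N l. if grp k l i = p then c l i else 0)"
    unfolding group_interval[OF l assms(2)]
    by (rule sum.mono_neutral_cong_left) auto
  finally show ?thesis by simp
qed

text \<open>The adjacency matrix of the whole layer in global numbering; nodes of different groups
  are never adjacent, which encodes the block-diagonal structure.\<close>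

definition nbr :: "nat \<Rightarrow> nat \<Rightarrow> nat \<Rightarrow> real" where
  "nbr l i j = (if grp k l i = grp k l j
     then A l (grp k l i) $$ (i - off k l (grp k l i), j - off k l (grp k l i)) else 0)"

lemma adj_group:
  assumes "l \<in> {1..M}" "p < N (Suc l)"
  shows "adj_ok (k l p) (A l p)"
  using hier assms by (auto simp: hier_structure_def)

lemma grp_local:
  assumes "l \<in> {1..M}" "i < N l"
  shows "off k l (grp k l i) \<le> i" "i - off k l (grp k l i) < k l (grp k l i)"
  using in_grp_iff[OF assms, of "grp k l i"] by (auto simp: in_grp_def off_Suc)

lemma adj_okD:
  assumes "adj_ok n G" "i < n" "j < n"
  shows "G $$ (i,j) = 0 \<or> G $$ (i,j) = 1" "G $$ (i,j) = G $$ (j,i)"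
    "(\<lambda>u v. u < n \<and> v < n \<and> G $$ (u,v) = 1)\<^sup>*\<^sup>* i j" "dim_row G = n"
  using assms unfolding adj_ok_def by blast+

lemma nbr_adj:
  assumes "l \<in> {1..M}" "i < N l" "j < N l" "grp k l i = grp k l j"
  defines "p \<equiv> grp k l i"
  shows "adj_ok (k l p) (A l p)" "i - off k l p < k l p" "j - off k l p < k l p"
  using adj_group[OF assms(1) grp_less[OF assms(1,2)]] grp_local[OF assms(1,2)]
    grp_local[OF assms(1,3)] assms(4) by (simp_all add: p_def)

lemma nbr_01:
  assumes "l \<in> {1..M}" "i < N l" "j < N l"
  shows "nbr l i j = 0 \<or> nbr l i j = 1"
  using adj_okD(1)[OF nbr_adj[OF assms]] by (simp add: nbr_def)

lemma nbr_sym: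
  assumes "l \<in> {1..M}" "i < N l" "j < N l"
  shows "nbr l i j = nbr l j i"
  using adj_okD(2)[OF nbr_adj[OF assms]] by (auto simp: nbr_def)

text \<open>Connectedness enters only through this consequence. The path lives in the local
  numbering of the group and is carried to the layer by adding the offset.\<close>

lemma nbr_connected:
  assumes l: "l \<in> {1..M}" and i: "i < N l" and j: "j < N l" and g: "grp k l i = grp k l j"
    and f: "\<And>u v. u < N l \<Longrightarrow> v < N l \<Longrightarrow> nbr l u v = 1 \<Longrightarrow> f u = f v"
  shows "f i = f j"
proof -
  define p where "p = grp k l i"
  define o' where "o' = off k l p"
  have p: "p < N (Suc l)" unfolding p_def by (rule grp_less[OF l i])
  have loc: "o' + u < N l \<and> grp k l (o' + u) = p" if "u < k l p" for u
  proof -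
    have "o' + u \<in> {off k l p..<off k l (Suc p)}" using that by (simp add: o'_def off_Suc)
    then show ?thesis unfolding group_interval[OF l p] by blast
  qed
  have "(\<lambda>u v. u < k l p \<and> v < k l p \<and> A l p $$ (u,v) = 1)\<^sup>*\<^sup>* (i - o') (j - o')"
    using adj_okD(3)[OF nbr_adj[OF l i j g]] by (simp add: p_def o'_def)
  then have "f (o' + (i - o')) = f (o' + (j - o'))"
  proof (induction rule: rtranclp_induct)
    case base
    then show ?case by simp
  next
    case (step y z)
    have "nbr l (o' + y) (o' + z) = 1"
      using step loc[of y] loc[of z] by (auto simp: nbr_def o'_def)
    then show ?case using f[of "o' + y" "o' + z"] step loc[of y] loc[of z] by auto
  qed
  then show ?thesis using grp_local[OF l i] grp_local[OF l j] g by (auto simp: p_def o'_def)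
qed

lemma LD_index:
  assumes l: "l \<in> {1..M}" and i: "i < N l" and j: "j < N l"
  shows "LD N k A l $$ (i,j) = (if i = j then (\<Sum>m<N l. nbr l i m) else 0) - nbr l i j"
proof -
  define p where "p = grp k l i"
  have p: "p < N (Suc l)" unfolding p_def by (rule grp_less[OF l i])
  have nbr_i: "nbr l i m = (if grp k l m = p then A l p $$ (i - off k l p, m - off k l p) else 0)" for m
    unfolding nbr_def p_def by simp
  have loc: "i - off k l p < k l p" "off k l p \<le> i"
    using grp_local[OF l i] by (simp_all add: p_def)
  have dimA: "dim_row (A l p) = k l p" using adj_okD(4)[OF nbr_adj[OF l i i refl]] by (simp add: p_def)
  have "LD N k A l $$ (i,j) = (\<Sum>q<N (Suc l).
      if q = p then if grp k l j = p then lap (A l p) $$ (i - off k l p, j - off k l p) else 0 else 0)"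
    using i j by (auto simp: LD_def in_grp_iff[OF l i] in_grp_iff[OF l j] p_def intro!: sum.cong)
  also have "\<dots> = (if grp k l j = p then lap (A l p) $$ (i - off k l p, j - off k l p) else 0)"
    using p by simp
  also have "\<dots> = (if i = j then (\<Sum>m<N l. nbr l i m) else 0) - nbr l i j"
  proof (cases "grp k l j = p")
    case False
    then have "i \<noteq> j" by (auto simp: p_def)
    then show ?thesis using False by (simp add: nbr_i)
  next
    case True
    have "(\<Sum>m<N l. nbr l i m) = (\<Sum>m\<in>{off k l p..<off k l (Suc p)}. A l p $$ (i - off k l p, m - off k l p))"
      unfolding group_interval[OF l p]
      by (rule sum.mono_neutral_cong_right) (auto simp: nbr_i)
    also have "\<dots> = (\<Sum>m<k l p. A l p $$ (i - off k l p, m))"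
      by (rule sum.reindex_bij_witness[of _ "\<lambda>m. m + off k l p" "\<lambda>m. m - off k l p"])
         (auto simp: off_Suc)
    finally have "(\<Sum>m<N l. nbr l i m) = (\<Sum>m<k l p. A l p $$ (i - off k l p, m))" .
    \<comment> \<open>Truncated subtraction: equal local indices give \<open>i = j\<close> only
      because both nodes lie at or above the offset.\<close>
    moreover have "j - off k l p < k l p" "off k l p \<le> j" using grp_local[OF l j] True by simp_all
    ultimately show ?thesis
      using True loc dimA nbr_i[of j] eq_diff_iff[of "off k l p" i j]
      by (cases "i = j") (simp_all add: lap_def)
  qed
  finally show ?thesis .
qed

section \<open>The layer Laplacian and its weighted Dirichlet form\<close>

definition Smat :: "nat \<Rightarrow> real Matrix.mat" where
  "Smat l = Kmat N k a l * LD N k A l"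

lemma Kmat_carrier [simp]: "Kmat N k a l \<in> carrier_mat (N l) (N l)"
  and LD_carrier [simp]: "LD N k A l \<in> carrier_mat (N l) (N l)"
  and Bmat_carrier [simp]: "Bmat N k l \<in> carrier_mat (N l) (N (Suc l))"
  and Cmat_carrier [simp]: "Cmat N k c l \<in> carrier_mat (N (Suc l)) (N l)"
  by (auto simp: Kmat_def LD_def Bmat_def Cmat_def)

lemma Smat_carrier [simp]: "Smat l \<in> carrier_mat (N l) (N l)"
  unfolding Smat_def by (rule mult_carrier_mat[OF Kmat_carrier LD_carrier])

lemma Smat_mult_index:
  assumes l: "l \<in> {1..M}" and i: "i < N l" and x: "x \<in> carrier_vec (N l)"
  shows "(Smat l *\<^sub>v x) $ i = inverse (wts k a l i) * (\<Sum>j<N l. nbr l i j * (x $ i - x $ j))"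
proof -
  have D: "(LD N k A l *\<^sub>v x) $ j = (\<Sum>m<N l. nbr l j m * (x $ j - x $ m))" if j: "j < N l" for j
  proof -
    have "(LD N k A l *\<^sub>v x) $ j = (\<Sum>m<N l. LD N k A l $$ (j,m) * x $ m)"
      using j x by (subst mult_mat_vec_index) (auto simp: LD_def)
    also have "\<dots> = (\<Sum>m<N l. (if j = m then (\<Sum>m<N l. nbr l j m) * x $ j else 0) - nbr l j m * x $ m)"
      by (intro sum.cong) (auto simp: LD_index[OF l j] algebra_simps)
    also have "\<dots> = (\<Sum>m<N l. nbr l j m) * x $ j - (\<Sum>m<N l. nbr l j m * x $ m)"
      using j by (simp add: sum_subtractf)
    finally show ?thesis by (simp add: sum_distrib_right sum_subtractf right_diff_distrib)
  qed
  have "(Smat l *\<^sub>v x) $ i = (Kmat N k a l *\<^sub>v (LD N k A l *\<^sub>v x)) $ i"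
    unfolding Smat_def using x by (simp add: assoc_mult_mat_vec[of _ "N l" "N l" _ "N l"])
  also have "\<dots> = (\<Sum>j<N l. Kmat N k a l $$ (i,j) * (LD N k A l *\<^sub>v x) $ j)"
    using i by (subst mult_mat_vec_index) (auto simp: Kmat_def LD_def)
  also have "\<dots> = (\<Sum>j<N l. if j = i then inverse (wts k a l i) * (LD N k A l *\<^sub>v x) $ i else 0)"
    using i by (intro sum.cong) (auto simp: Kmat_def)
  also have "\<dots> = inverse (wts k a l i) * (LD N k A l *\<^sub>v x) $ i" using i by simp
  finally show ?thesis using D[OF i] by simp
qed

text \<open>Dividing by the weights destroys the symmetry of the Laplacian for the plain dot
  product; in this weighted product \<open>Smat l\<close> is self-adjoint and nonnegative.\<close>

definition wip :: "nat \<Rightarrow> real Matrix.vec \<Rightarrow> real Matrix.vec \<Rightarrow> real" where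
  "wip l y x = (\<Sum>i<N l. wts k a l i * (y $ i * x $ i))"

lemma wip_Smat:
  assumes l: "l \<in> {1..M}" and x: "x \<in> carrier_vec (N l)"
  shows "2 * wip l y (Smat l *\<^sub>v x)
    = (\<Sum>i<N l. \<Sum>j<N l. nbr l i j * ((y $ i - y $ j) * (x $ i - x $ j)))"
proof -
  have e: "wip l y (Smat l *\<^sub>v x) = (\<Sum>i<N l. \<Sum>j<N l. nbr l i j * (y $ i * (x $ i - x $ j)))"
    unfolding wip_def
  proof (intro sum.cong refl)
    fix i assume "i \<in> {..<N l}"
    then have i: "i < N l" by simp
    show "wts k a l i * (y $ i * (Smat l *\<^sub>v x) $ i) = (\<Sum>j<N l. nbr l i j * (y $ i * (x $ i - x $ j)))"
      unfolding Smat_mult_index[OF l i x] sum_distrib_left using wts_pos[OF l i]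
      by (intro sum.cong) auto
  qed
  \<comment> \<open>The same sum with the two indices exchanged; adding both forms produces the
    product of differences.\<close>
  have e2: "wip l y (Smat l *\<^sub>v x) = (\<Sum>i<N l. \<Sum>j<N l. nbr l i j * (y $ j * (x $ j - x $ i)))"
    unfolding e by (subst sum.swap) (auto intro!: sum.cong simp: nbr_sym[OF l])
  show ?thesis
    unfolding mult_2
    by (subst (2) e2, subst e) (simp add: sum.distrib[symmetric] algebra_simps)
qed

lemma wip_Smat_sym:
  assumes l: "l \<in> {1..M}" and "x \<in> carrier_vec (N l)" "y \<in> carrier_vec (N l)"
  shows "wip l y (Smat l *\<^sub>v x) = wip l x (Smat l *\<^sub>v y)"
  using wip_Smat[OF l assms(2), of y] wip_Smat[OF l assms(3), of x] by (simp add: mult.commute)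

lemma wip_Smat_nonneg:
  assumes l: "l \<in> {1..M}" and x: "x \<in> carrier_vec (N l)"
  shows "wip l x (Smat l *\<^sub>v x) \<ge> 0"
proof -
  have "(\<Sum>i<N l. \<Sum>j<N l. nbr l i j * ((x $ i - x $ j) * (x $ i - x $ j))) \<ge> 0"
    by (intro sum_nonneg mult_nonneg_nonneg zero_le_square) (use nbr_01[OF l] in force)
  then show ?thesis using wip_Smat[OF l x, of x] by simp
qed

lemma wip_self_pos:
  assumes l: "l \<in> {1..M}" and x: "x \<in> carrier_vec (N l)"
  shows "wip l x x \<ge> 0" "wip l x x = 0 \<Longrightarrow> x = 0\<^sub>v (N l)"
proof -
  have p: "wts k a l i * (x $ i * x $ i) \<ge> 0" if "i < N l" for i
    using wts_pos[OF l that] by (simp add: less_imp_le)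
  show "wip l x x \<ge> 0" unfolding wip_def by (intro sum_nonneg) (use p in auto)
  assume "wip l x x = 0"
  then have z: "wts k a l i * (x $ i * x $ i) = 0" if "i < N l" for i
    using that p sum_nonneg_eq_0_iff[of "{..<N l}" "\<lambda>i. wts k a l i * (x $ i * x $ i)"]
    by (auto simp: wip_def)
  show "x = 0\<^sub>v (N l)"
  proof
    fix i assume "i < dim_vec (0\<^sub>v (N l) :: real Matrix.vec)"
    then have i: "i < N l" by simp
    then show "x $ i = 0\<^sub>v (N l) $ i" using z[OF i] wts_pos[OF l i] by auto
  qed (use x in auto)
qed

text \<open>The quadratic form of a kernel vector is a sum of nonnegative edge terms equal to zero,
  so the vector agrees along every edge, and connectedness spreads this over the group.\<close>

lemma Smat_kernel:
  assumes l: "l \<in> {1..M}" and x: "x \<in> carrier_vec (N l)" and z: "Smat l *\<^sub>v x = 0\<^sub>v (N l)"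
    and i: "i < N l" and j: "j < N l" and g: "grp k l i = grp k l j"
  shows "x $ i = x $ j"
proof (rule nbr_connected[OF l i j g, of "\<lambda>i. x $ i"])
  fix u v assume uv: "u < N l" "v < N l" "nbr l u v = 1"
  let ?f = "\<lambda>i j. nbr l i j * ((x $ i - x $ j) * (x $ i - x $ j))"
  have p: "?f i j \<ge> 0" if "i < N l" "j < N l" for i j
    using nbr_01[OF l that] by auto
  have "(\<Sum>i<N l. \<Sum>j<N l. ?f i j) = 2 * wip l x (Smat l *\<^sub>v x)"
    using wip_Smat[OF l x, of x] by simp
  also have "\<dots> = 0" unfolding z by (simp add: wip_def)
  finally have "(\<Sum>j<N l. ?f u j) = 0"
    using p uv by (subst (asm) sum_nonneg_eq_0_iff) (auto intro!: sum_nonneg)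
  then have "?f u v = 0"
    using p uv sum_nonneg_eq_0_iff[of "{..<N l}" "?f u"] by blast
  then show "x $ u = x $ v" using uv by simp
qed

lemma Smat_kernelI:
  assumes l: "l \<in> {1..M}" and x: "x \<in> carrier_vec (N l)"
    and e: "\<And>i j. i < N l \<Longrightarrow> j < N l \<Longrightarrow> grp k l i = grp k l j \<Longrightarrow> x $ i = x $ j"
  shows "Smat l *\<^sub>v x = 0\<^sub>v (N l)"
proof
  fix i assume "i < dim_vec (0\<^sub>v (N l) :: real Matrix.vec)"
  then have i: "i < N l" by simp
  have "(\<Sum>j<N l. nbr l i j * (x $ i - x $ j)) = 0"
    by (intro sum.neutral) (use e[OF i] in \<open>auto simp: nbr_def\<close>)
  then show "(Smat l *\<^sub>v x) $ i = 0\<^sub>v (N l) $ i"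
    using i by (simp add: Smat_mult_index[OF l i x])
qed (simp add: carrier_matD(1)[OF Smat_carrier])

text \<open>By self-adjointness the squared weighted norm of \<open>S x\<close> is the pairing of
  \<open>x\<close> with \<open>S (S x)\<close>. This is the source of semisimplicity at 0.\<close>

lemma Smat_square_kernel:
  assumes l: "l \<in> {1..M}" and x: "x \<in> carrier_vec (N l)"
    and z: "Smat l *\<^sub>v (Smat l *\<^sub>v x) = 0\<^sub>v (N l)"
  shows "Smat l *\<^sub>v x = 0\<^sub>v (N l)"
proof -
  have Sx: "Smat l *\<^sub>v x \<in> carrier_vec (N l)" by (rule mult_mat_vec_carrier[OF Smat_carrier x])
  have "wip l (Smat l *\<^sub>v x) (Smat l *\<^sub>v x) = wip l x (Smat l *\<^sub>v (Smat l *\<^sub>v x))"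
    using wip_Smat_sym[OF l x Sx] .
  also have "\<dots> = 0" unfolding z by (simp add: wip_def)
  finally show ?thesis using wip_self_pos(2)[OF l Sx] by blast
qed

end

declare One_nat_def [simp del]

section \<open>The layer matrices\<close>

context hierarchy
begin

lemma Bmat_mult_index:
  assumes l: "l \<in> {1..M}" and i: "i < N l" and x: "x \<in> carrier_vec (N (Suc l))"
  shows "(Bmat N k l *\<^sub>v x) $ i = x $ grp k l i"
proof -
  have "(Bmat N k l *\<^sub>v x) $ i = (\<Sum>p<N (Suc l). Bmat N k l $$ (i,p) * x $ p)"
    using i x by (subst mult_mat_vec_index) (auto simp: Bmat_def)
  also have "\<dots> = (\<Sum>p<N (Suc l). if p = grp k l i then x $ p else 0)"
    using i in_grp_iff[OF l i] by (intro sum.cong) (auto simp: Bmat_def)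
  finally show ?thesis using grp_less[OF l i] by simp
qed

lemma Cmat_mult_index:
  assumes l: "l \<in> {1..M}" and p: "p < N (Suc l)" and x: "x \<in> carrier_vec (N l)"
  shows "(Cmat N k c l *\<^sub>v x) $ p = (\<Sum>i<N l. if grp k l i = p then c l i * x $ i else 0)"
proof -
  have "(Cmat N k c l *\<^sub>v x) $ p = (\<Sum>i<N l. Cmat N k c l $$ (p,i) * x $ i)"
    using p x by (subst mult_mat_vec_index) (auto simp: Cmat_def)
  also have "\<dots> = (\<Sum>i<N l. if grp k l i = p then c l i * x $ i else 0)"
    using p in_grp_iff[OF l] by (intro sum.cong) (auto simp: Cmat_def)
  finally show ?thesis .
qed

lemma Bmat_vec_carrier [simp]: "Bmat N k l *\<^sub>v x \<in> carrier_vec (N l)"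
  by (rule carrier_vecI) (simp add: Bmat_def)

lemma Cmat_vec_carrier [simp]: "Cmat N k c l *\<^sub>v x \<in> carrier_vec (N (Suc l))"
  by (rule carrier_vecI) (simp add: Cmat_def)

lemma Smat_vec_carrier [simp]: "Smat l *\<^sub>v x \<in> carrier_vec (N l)"
  by (rule carrier_vecI) (simp add: carrier_matD(1)[OF Smat_carrier])

lemma Cmat_Bmat:
  assumes l: "l \<in> {1..M-1}" and x: "x \<in> carrier_vec (N (Suc l))"
  shows "Cmat N k c l *\<^sub>v (Bmat N k l *\<^sub>v x) = x"
proof
  have l': "l \<in> {1..M}" using l by auto
  fix p assume "p < dim_vec x"
  then have p: "p < N (Suc l)" using x by simp
  have "(Cmat N k c l *\<^sub>v (Bmat N k l *\<^sub>v x)) $ p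
     = (\<Sum>i<N l. (if grp k l i = p then c l i else 0) * x $ p)"
    unfolding Cmat_mult_index[OF l' p Bmat_vec_carrier]
    by (intro sum.cong) (auto simp: Bmat_mult_index[OF l' _ x])
  then show "(Cmat N k c l *\<^sub>v (Bmat N k l *\<^sub>v x)) $ p = x $ p"
    using c_sum[OF l p] by (simp flip: sum_distrib_right)
qed (use x in \<open>auto simp: Cmat_def\<close>)

lemma Smat_Bmat:
  assumes l: "l \<in> {1..M}" and x: "x \<in> carrier_vec (N (Suc l))"
  shows "Smat l *\<^sub>v (Bmat N k l *\<^sub>v x) = 0\<^sub>v (N l)"
  by (rule Smat_kernelI[OF l Bmat_vec_carrier]) (simp add: Bmat_mult_index[OF l _ x])

text \<open>A kernel vector is constant on groups, so reading one node per group gives a preimage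
  under \<open>Bmat\<close>. This lets a common kernel vector be lifted from layer to layer.\<close>

lemma Smat_kernel_Bmat:
  assumes l: "l \<in> {1..M}" and x: "x \<in> carrier_vec (N l)" and z: "Smat l *\<^sub>v x = 0\<^sub>v (N l)"
  shows "\<exists>u\<in>carrier_vec (N (Suc l)). x = Bmat N k l *\<^sub>v u"
proof -
  define u where "u = Matrix.vec (N (Suc l)) (\<lambda>p. x $ (SOME i. i < N l \<and> grp k l i = p))"
  have u: "u \<in> carrier_vec (N (Suc l))" by (simp add: u_def)
  have "x = Bmat N k l *\<^sub>v u"
  proof
    fix i assume "i < dim_vec (Bmat N k l *\<^sub>v u)"
    then have i: "i < N l" by (simp add: Bmat_def)
    define j where "j = (SOME j. j < N l \<and> grp k l j = grp k l i)"
    have j: "j < N l \<and> grp k l j = grp k l i"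
      unfolding j_def by (rule someI[of _ i]) (use i in auto)
    have "(Bmat N k l *\<^sub>v u) $ i = x $ j"
      using grp_less[OF l i] unfolding Bmat_mult_index[OF l i u] by (simp add: u_def j_def)
    also have "\<dots> = x $ i" using Smat_kernel[OF l x z, of j i] i j by auto
    finally show "x $ i = (Bmat N k l *\<^sub>v u) $ i" by simp
  qed (use x in \<open>auto simp: Bmat_def\<close>)
  then show ?thesis using u by blast
qed

lemma Bprod_carrier: "l \<ge> 1 \<Longrightarrow> Bprod N k l \<in> carrier_mat (N 1) (N l)"
proof (induction l rule: nat_induct_at_least)
  case base
  then show ?case by (simp add: One_nat_def)
next
  case (Suc l)
  then obtain m where m: "l = Suc m" by (cases l) auto
  show ?case using mult_carrier_mat[OF Suc.IH Bmat_carrier] by (simp add: m)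
qed

lemma Cprod_carrier: "l \<ge> 1 \<Longrightarrow> Cprod N k c l \<in> carrier_mat (N l) (N 1)"
proof (induction l rule: nat_induct_at_least)
  case base
  then show ?case by (simp add: One_nat_def)
next
  case (Suc l)
  then obtain m where m: "l = Suc m" by (cases l) auto
  show ?case using mult_carrier_mat[OF Cmat_carrier Suc.IH] by (simp add: m)
qed

lemma Bprod_vec_carrier: "l \<ge> 1 \<Longrightarrow> Bprod N k l *\<^sub>v x \<in> carrier_vec (N 1)"
  by (rule carrier_vecI) (simp add: carrier_matD(1)[OF Bprod_carrier])

lemma Cprod_vec_carrier: "l \<ge> 1 \<Longrightarrow> Cprod N k c l *\<^sub>v x \<in> carrier_vec (N l)"
  by (rule carrier_vecI) (simp add: carrier_matD(1)[OF Cprod_carrier])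

lemma Bprod_1: "x \<in> carrier_vec (N 1) \<Longrightarrow> Bprod N k 1 *\<^sub>v x = x"
  and Cprod_1: "x \<in> carrier_vec (N 1) \<Longrightarrow> Cprod N k c 1 *\<^sub>v x = x"
  by (simp_all add: One_nat_def)

lemma Bprod_Suc:
  assumes "l \<ge> 1" "x \<in> carrier_vec (N (Suc l))"
  shows "Bprod N k (Suc l) *\<^sub>v x = Bprod N k l *\<^sub>v (Bmat N k l *\<^sub>v x)"
proof -
  obtain m where m: "l = Suc m" using assms by (cases l) auto
  show ?thesis
    using assoc_mult_mat_vec[OF Bprod_carrier[OF assms(1)] Bmat_carrier assms(2)] by (simp add: m)
qed

lemma Cprod_Suc:
  assumes "l \<ge> 1" "x \<in> carrier_vec (N 1)"
  shows "Cprod N k c (Suc l) *\<^sub>v x = Cmat N k c l *\<^sub>v (Cprod N k c l *\<^sub>v x)"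
proof -
  obtain m where m: "l = Suc m" using assms by (cases l) auto
  show ?thesis
    using assoc_mult_mat_vec[OF Cmat_carrier Cprod_carrier[OF assms(1)] assms(2)] by (simp add: m)
qed

lemma Cprod_Bprod:
  "l \<ge> 1 \<Longrightarrow> l \<le> M \<Longrightarrow> w \<in> carrier_vec (N l) \<Longrightarrow> Cprod N k c l *\<^sub>v (Bprod N k l *\<^sub>v w) = w"
proof (induction l arbitrary: w rule: nat_induct_at_least)
  case base
  then show ?case by (simp add: One_nat_def)
next
  case (Suc l)
  then show ?case
    using Cmat_Bmat[of l w]
    by (simp add: Bprod_Suc Cprod_Suc Bprod_vec_carrier)
qed

abbreviation Lm :: "nat \<Rightarrow> real Matrix.mat" where
  "Lm l \<equiv> Lmat N k A a c l"

lemma Lm_carrier: "l \<ge> 1 \<Longrightarrow> Lm l \<in> carrier_mat (N 1) (N 1)"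
proof (cases "l = 1")
  case True
  then show ?thesis using Smat_carrier[of 1] by (simp add: Lmat_def Smat_def)
next
  case False
  assume "l \<ge> 1"
  then show ?thesis using False Bprod_carrier[of l] Cprod_carrier[of l]
      Kmat_carrier[of l] LD_carrier[of l]
    by (auto simp: Lmat_def intro!: mult_carrier_mat[of _ "N 1" "N l" _ "N 1"] mult_carrier_mat[of _ "N 1" "N l" _ "N l"])
qed

lemma Lm_vec_carrier: "l \<ge> 1 \<Longrightarrow> Lm l *\<^sub>v x \<in> carrier_vec (N 1)"
  by (rule carrier_vecI) (simp add: carrier_matD(1)[OF Lm_carrier])

lemma Lm_vec:
  assumes l: "l \<ge> 1" and x: "x \<in> carrier_vec (N 1)"
  shows "Lm l *\<^sub>v x = Bprod N k l *\<^sub>v (Smat l *\<^sub>v (Cprod N k c l *\<^sub>v x))"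
proof (cases "l = 1")
  case True
  then show ?thesis using x Smat_vec_carrier[of 1 x] Bprod_1[of "Smat 1 *\<^sub>v x"] Cprod_1[OF x]
    by (simp add: Lmat_def Smat_def)
next
  case False
  note B = Bprod_carrier[OF l] and C = Cprod_carrier[OF l]
  have BK: "Bprod N k l * Kmat N k a l \<in> carrier_mat (N 1) (N l)"
    using B Kmat_carrier[of l] by auto
  have "Bprod N k l * Kmat N k a l * LD N k A l = Bprod N k l * Smat l"
    unfolding Smat_def using assoc_mult_mat[OF B Kmat_carrier LD_carrier] .
  then have "Lm l *\<^sub>v x = (Bprod N k l * Smat l * Cprod N k c l) *\<^sub>v x"
    using False by (simp add: Lmat_def)
  also have "\<dots> = (Bprod N k l * Smat l) *\<^sub>v (Cprod N k c l *\<^sub>v x)"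
    by (rule assoc_mult_mat_vec[OF mult_carrier_mat[OF B Smat_carrier] C x])
  also have "\<dots> = Bprod N k l *\<^sub>v (Smat l *\<^sub>v (Cprod N k c l *\<^sub>v x))"
    by (rule assoc_mult_mat_vec[OF B Smat_carrier Cprod_vec_carrier[OF l]])
  finally show ?thesis .
qed

lemma Bprod_factor:
  assumes "1 \<le> i" "i \<le> j" "w \<in> carrier_vec (N j)"
  shows "\<exists>u\<in>carrier_vec (N i). Bprod N k j *\<^sub>v w = Bprod N k i *\<^sub>v u"
  using assms(2,1,3)
proof (induction j arbitrary: w rule: dec_induct)
  case base
  then show ?case by blast
next
  case (step j)
  have "Bprod N k (Suc j) *\<^sub>v w = Bprod N k j *\<^sub>v (Bmat N k j *\<^sub>v w)"
    using step by (intro Bprod_Suc) auto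
  then show ?case using step.IH[OF step.prems(1) Bmat_vec_carrier] by metis
qed

lemma Lm_Lm_vec:
  assumes i: "1 \<le> i" and ij: "i < j" and j: "j \<le> M" and x: "x \<in> carrier_vec (N 1)"
  shows "Lm i *\<^sub>v (Lm j *\<^sub>v x) = 0\<^sub>v (N 1)"
proof -
  have j1: "j \<ge> 1" using i ij by auto
  \<comment> \<open>Factoring through layer \<open>Suc i\<close>, not \<open>i\<close>, leaves a
    factor \<open>Bmat N k i\<close> that \<open>Smat i\<close> annihilates once
    \<open>Cprod\<close> has cancelled \<open>Bprod\<close>.\<close>
  obtain u where u: "u \<in> carrier_vec (N (Suc i))"
    and e: "Lm j *\<^sub>v x = Bprod N k (Suc i) *\<^sub>v u"
    using Bprod_factor[of "Suc i" j "Smat j *\<^sub>v (Cprod N k c j *\<^sub>v x)"] i ij Lm_vec[OF j1 x] by auto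
  have e2: "Lm j *\<^sub>v x = Bprod N k i *\<^sub>v (Bmat N k i *\<^sub>v u)"
    unfolding e by (rule Bprod_Suc[OF i u])
  have "Lm i *\<^sub>v (Lm j *\<^sub>v x)
    = Bprod N k i *\<^sub>v (Smat i *\<^sub>v (Cprod N k c i *\<^sub>v (Bprod N k i *\<^sub>v (Bmat N k i *\<^sub>v u))))"
    unfolding e2 by (rule Lm_vec[OF i Bprod_vec_carrier[OF i]])
  also have "\<dots> = Bprod N k i *\<^sub>v (Smat i *\<^sub>v (Bmat N k i *\<^sub>v u))"
    using Cprod_Bprod[OF i _ Bmat_vec_carrier] i ij j by simp
  also have "\<dots> = Bprod N k i *\<^sub>v 0\<^sub>v (N i)"
    using Smat_Bmat[OF _ u] i ij j by simp
  also have "\<dots> = 0\<^sub>v (N 1)" using Bprod_carrier[OF i] by (auto intro!: eq_vecI)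
  finally show ?thesis .
qed

section \<open>Constant vectors and the conserved weighted mean\<close>

lemma Cprod_const:
  "l \<ge> 1 \<Longrightarrow> l \<le> M \<Longrightarrow> Cprod N k c l *\<^sub>v Matrix.vec (N 1) (\<lambda>_. 1) = Matrix.vec (N l) (\<lambda>_. 1)"
proof (induction l rule: nat_induct_at_least)
  case base
  then show ?case by (simp add: One_nat_def)
next
  case (Suc l)
  then have l: "l \<in> {1..M}" "l \<in> {1..M-1}" by auto
  have "Cmat N k c l *\<^sub>v Matrix.vec (N l) (\<lambda>_. 1) = Matrix.vec (N (Suc l)) (\<lambda>_. 1)"
  proof
    fix p assume "p < dim_vec (Matrix.vec (N (Suc l)) (\<lambda>_. 1 :: real))"
    then have p: "p < N (Suc l)" by simp
    show "(Cmat N k c l *\<^sub>v Matrix.vec (N l) (\<lambda>_. 1)) $ p = Matrix.vec (N (Suc l)) (\<lambda>_. 1) $ p"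
      using p c_sum[OF l(2) p] by (simp add: Cmat_mult_index[OF l(1) p] cong: if_cong)
  qed (simp add: Cmat_def)
  then show ?case using Suc by (simp add: Cprod_Suc)
qed

lemma Smat_const:
  "l \<in> {1..M} \<Longrightarrow> Smat l *\<^sub>v Matrix.vec (N l) (\<lambda>_. r) = 0\<^sub>v (N l)"
  by (rule Smat_kernelI) auto

lemma Lm_const:
  assumes "1 \<le> l" "l \<le> M"
  shows "Lm l *\<^sub>v Matrix.vec (N 1) (\<lambda>_. 1) = 0\<^sub>v (N 1)"
proof -
  have "Lm l *\<^sub>v Matrix.vec (N 1) (\<lambda>_. 1) = Bprod N k l *\<^sub>v 0\<^sub>v (N l)"
    using Lm_vec[OF assms(1), of "Matrix.vec (N 1) (\<lambda>_. 1)"] Cprod_const[OF assms] Smat_const[of l 1] assms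
    by simp
  also have "\<dots> = 0\<^sub>v (N 1)" using Bprod_carrier[OF assms(1)] by (auto intro!: eq_vecI)
  finally show ?thesis .
qed

text \<open>The recursion for the weights says that the row vector of weights of layer
  \<open>l\<close>, multiplied by \<open>Bmat\<close>, is that of layer
  \<open>Suc l\<close>.\<close>

lemma Bmat_wts:
  assumes l: "l \<in> {1..M}" and w: "w \<in> carrier_vec (N (Suc l))"
  shows "(\<Sum>i<N l. wts k a l i * (Bmat N k l *\<^sub>v w) $ i) = (\<Sum>p<N (Suc l). wts k a (Suc l) p * w $ p)"
proof -
  have "(\<Sum>p<N (Suc l). wts k a (Suc l) p * w $ p)
      = (\<Sum>p<N (Suc l). \<Sum>i<N l. if p = grp k l i then wts k a l i * w $ p else 0)"
    by (auto simp: wts_Suc[OF l] sum_distrib_right intro!: sum.cong)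
  also have "\<dots> = (\<Sum>i<N l. \<Sum>p<N (Suc l). if p = grp k l i then wts k a l i * w $ p else 0)"
    by (rule sum.swap)
  also have "\<dots> = (\<Sum>i<N l. wts k a l i * (Bmat N k l *\<^sub>v w) $ i)"
    using grp_less[OF l] by (auto simp: Bmat_mult_index[OF l _ w] intro!: sum.cong)
  finally show ?thesis by simp
qed

lemma Bprod_wts:
  "l \<ge> 1 \<Longrightarrow> l \<le> M \<Longrightarrow> w \<in> carrier_vec (N l) \<Longrightarrow>
    (\<Sum>i<N 1. a i * (Bprod N k l *\<^sub>v w) $ i) = (\<Sum>p<N l. wts k a l p * w $ p)"
proof (induction l arbitrary: w rule: nat_induct_at_least)
  case base
  then show ?case by (simp add: One_nat_def)
next
  case (Suc l)
  then show ?case using Bmat_wts[of l w] by (simp add: Bprod_Suc)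
qed

text \<open>Transport to layer \<open>l\<close> turns the sum into the weighted pairing of the
  constant vector with a value of \<open>Smat l\<close>, and self-adjointness moves
  \<open>Smat l\<close> onto the constant. This gives the conserved mean of the dynamics.\<close>

lemma a_Lm:
  assumes l: "1 \<le> l" "l \<le> M" and x: "x \<in> carrier_vec (N 1)"
  shows "(\<Sum>i<N 1. a i * (Lm l *\<^sub>v x) $ i) = 0"
proof -
  let ?w = "Cprod N k c l *\<^sub>v x"
  have l': "l \<in> {1..M}" using l by auto
  have w: "?w \<in> carrier_vec (N l)" by (rule Cprod_vec_carrier[OF l(1)])
  have "(\<Sum>i<N 1. a i * (Lm l *\<^sub>v x) $ i) = (\<Sum>p<N l. wts k a l p * (Smat l *\<^sub>v ?w) $ p)"
    unfolding Lm_vec[OF l(1) x] by (rule Bprod_wts[OF l]) simp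
  also have "\<dots> = wip l (Matrix.vec (N l) (\<lambda>_. 1)) (Smat l *\<^sub>v ?w)"
    by (simp add: wip_def)
  also have "\<dots> = wip l ?w (Smat l *\<^sub>v Matrix.vec (N l) (\<lambda>_. 1))"
    by (rule wip_Smat_sym[OF l' w]) simp
  also have "\<dots> = 0" unfolding Smat_const[OF l'] by (simp add: wip_def)
  finally show ?thesis .
qed

text \<open>The intertwining \<open>C L = S C\<close>, through which facts about the self-adjoint
  \<open>Smat l\<close> reach \<open>Lm l\<close>.\<close>

lemma Cprod_Lm:
  assumes l: "1 \<le> l" "l \<le> M" and x: "x \<in> carrier_vec (N 1)"
  shows "Cprod N k c l *\<^sub>v (Lm l *\<^sub>v x) = Smat l *\<^sub>v (Cprod N k c l *\<^sub>v x)"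
  unfolding Lm_vec[OF l(1) x] by (rule Cprod_Bprod[OF l]) simp

lemma Lm_eq_0_iff:
  assumes l: "1 \<le> l" "l \<le> M" and x: "x \<in> carrier_vec (N 1)"
  shows "Lm l *\<^sub>v x = 0\<^sub>v (N 1) \<longleftrightarrow> Smat l *\<^sub>v (Cprod N k c l *\<^sub>v x) = 0\<^sub>v (N l)"
proof
  assume "Lm l *\<^sub>v x = 0\<^sub>v (N 1)"
  then have "Smat l *\<^sub>v (Cprod N k c l *\<^sub>v x) = Cprod N k c l *\<^sub>v 0\<^sub>v (N 1)"
    using Cprod_Lm[OF assms] by simp
  also have "\<dots> = 0\<^sub>v (N l)" using Cprod_carrier[OF l(1)] by (auto intro!: eq_vecI)
  finally show "Smat l *\<^sub>v (Cprod N k c l *\<^sub>v x) = 0\<^sub>v (N l)" .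
next
  assume "Smat l *\<^sub>v (Cprod N k c l *\<^sub>v x) = 0\<^sub>v (N l)"
  then show "Lm l *\<^sub>v x = 0\<^sub>v (N 1)"
    using Lm_vec[OF l(1) x] Bprod_carrier[OF l(1)] by (auto intro!: eq_vecI)
qed

lemma Lm_square_kernel:
  assumes l: "1 \<le> l" "l \<le> M" and x: "x \<in> carrier_vec (N 1)"
    and z: "Lm l *\<^sub>v (Lm l *\<^sub>v x) = 0\<^sub>v (N 1)"
  shows "Lm l *\<^sub>v x = 0\<^sub>v (N 1)"
  using z Smat_square_kernel[of l "Cprod N k c l *\<^sub>v x"] l
  by (simp add: Lm_eq_0_iff[OF l x] Lm_eq_0_iff[OF l Lm_vec_carrier[OF l(1)]]
      Cprod_Lm[OF l x] Cprod_vec_carrier)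

lemma Bprod_const:
  "l \<ge> 1 \<Longrightarrow> l \<le> M \<Longrightarrow> Bprod N k l *\<^sub>v Matrix.vec (N l) (\<lambda>_. r) = Matrix.vec (N 1) (\<lambda>_. r)"
proof (induction l rule: nat_induct_at_least)
  case base
  then show ?case by (simp add: One_nat_def)
next
  case (Suc l)
  then have l: "l \<in> {1..M}" by auto
  have "Bmat N k l *\<^sub>v Matrix.vec (N (Suc l)) (\<lambda>_. r) = Matrix.vec (N l) (\<lambda>_. r)"
  proof
    fix i assume "i < dim_vec (Matrix.vec (N l) (\<lambda>_. r))"
    then have i: "i < N l" by simp
    show "(Bmat N k l *\<^sub>v Matrix.vec (N (Suc l)) (\<lambda>_. r)) $ i = Matrix.vec (N l) (\<lambda>_. r) $ i"
      using i grp_less[OF l i] by (simp add: Bmat_mult_index[OF l i])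
  qed (simp add: Bmat_def)
  then show ?case using Suc by (simp add: Bprod_Suc)
qed

lemma Lm_common_kernel:
  assumes x: "x \<in> carrier_vec (N 1)"
    and z: "\<And>l. 1 \<le> l \<Longrightarrow> l \<le> M \<Longrightarrow> Lm l *\<^sub>v x = 0\<^sub>v (N 1)"
  shows "\<exists>r. x = Matrix.vec (N 1) (\<lambda>_. r)"
proof -
  let ?w = "\<lambda>l. Cprod N k c l *\<^sub>v x"
  have S: "Smat l *\<^sub>v ?w l = 0\<^sub>v (N l)" if "1 \<le> l" "l \<le> M" for l
    using z[OF that] Lm_eq_0_iff[OF that x] by simp
  have "l \<ge> 1 \<Longrightarrow> l \<le> M \<Longrightarrow> x = Bprod N k l *\<^sub>v ?w l" for l
  proof (induction l rule: nat_induct_at_least)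
    case base
    then show ?case using x by (simp add: Bprod_1 Cprod_1)
  next
    case (Suc l)
    then have l: "l \<in> {1..M}" "l \<in> {1..M-1}" by auto
    obtain u where u: "u \<in> carrier_vec (N (Suc l))" "?w l = Bmat N k l *\<^sub>v u"
      using Smat_kernel_Bmat[OF l(1) Cprod_vec_carrier S] Suc by auto
    have "?w (Suc l) = u" using Suc x u Cmat_Bmat[OF l(2) u(1)] by (simp add: Cprod_Suc)
    then show ?case using Suc u by (simp add: Bprod_Suc)
  qed
  then have xM: "x = Bprod N k M *\<^sub>v ?w M" using M_ge_2 by auto
  have M: "M \<in> {1..M}" using M_ge_2 by auto
  have wc: "?w M \<in> carrier_vec (N M)" by (rule Cprod_vec_carrier) (use M in auto)
  \<comment> \<open>The top layer consists of a single group, so constancy on groups is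
    constancy.\<close>
  have g: "grp k M i = 0" if "i < N M" for i using grp_less[OF M that] N_top by simp
  have "?w M = Matrix.vec (N M) (\<lambda>_. ?w M $ 0)"
  proof
    fix i assume "i < dim_vec (Matrix.vec (N M) (\<lambda>_. ?w M $ 0))"
    then have i: "i < N M" by simp
    have "?w M $ i = ?w M $ 0"
      using Smat_kernel[OF M wc S i N_pos[OF M]] g[OF i] g[OF N_pos[OF M]] M by auto
    then show "?w M $ i = Matrix.vec (N M) (\<lambda>_. ?w M $ 0) $ i" using i by simp
  qed (use carrier_vecD[OF wc] in simp)
  then have "x = Matrix.vec (N 1) (\<lambda>_. ?w M $ 0)"
    using xM Bprod_const[of M "?w M $ 0"] M by auto
  then show ?thesis by blast
qed

end

section \<open>Spectra of the layer matrices\<close>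

text \<open>The operator \<open>L - r\<close>, written on vectors so that a product of such factors
  is a \<open>foldr\<close> over a list of eigenvalues with multiplicity.\<close>

definition shift_op :: "real Matrix.mat \<Rightarrow> real \<Rightarrow> real Matrix.vec \<Rightarrow> real Matrix.vec" where
  "shift_op L r w = L *\<^sub>v w - r \<cdot>\<^sub>v w"

lemma shift_op_carrier [simp]:
  "L \<in> carrier_mat n n \<Longrightarrow> w \<in> carrier_vec n \<Longrightarrow> shift_op L r w \<in> carrier_vec n"
  by (simp add: shift_op_def)

lemma foldr_shift_op_carrier:
  "L \<in> carrier_mat n n \<Longrightarrow> w \<in> carrier_vec n \<Longrightarrow> foldr (shift_op L) rs w \<in> carrier_vec n"
  by (induction rs) simp_all

lemma foldr_shift_op_commute:
  assumes L: "L \<in> carrier_mat n n" and w: "w \<in> carrier_vec n"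
  shows "L *\<^sub>v foldr (shift_op L) rs w = foldr (shift_op L) rs (L *\<^sub>v w)"
proof (induction rs)
  case Nil
  then show ?case by simp
next
  case (Cons r rs)
  let ?u = "foldr (shift_op L) rs w"
  have u: "?u \<in> carrier_vec n" by (rule foldr_shift_op_carrier[OF L w])
  have "L *\<^sub>v shift_op L r v = shift_op L r (L *\<^sub>v v)" if "v \<in> carrier_vec n" for v
    unfolding shift_op_def using L that
    by (simp add: mult_minus_distrib_mat_vec[of L n n] mult_mat_vec[of L n n])
  from this[OF u] show ?case using Cons.IH by simp
qed

text \<open>Assumption \<open>sq\<close> merges two outer factors \<open>L\<close> into one,
  repeatedly; with \<open>m = 0\<close> the vector itself vanishes.\<close>

lemma foldr_shift_op_0_kernel:
  assumes L: "L \<in> carrier_mat n n"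
    and sq: "\<And>x. x \<in> carrier_vec n \<Longrightarrow> L *\<^sub>v (L *\<^sub>v x) = 0\<^sub>v n \<Longrightarrow> L *\<^sub>v x = 0\<^sub>v n"
  shows "x \<in> carrier_vec n \<Longrightarrow> foldr (shift_op L) (replicate m 0) x = 0\<^sub>v n \<Longrightarrow> L *\<^sub>v x = 0\<^sub>v n"
proof (induction m)
  case 0
  then show ?case using L by (auto intro!: eq_vecI)
next
  case (Suc m)
  let ?u = "foldr (shift_op L) (replicate m 0) x"
  have u: "?u \<in> carrier_vec n" by (rule foldr_shift_op_carrier[OF L Suc.prems(1)])
  have s0: "shift_op L 0 v = L *\<^sub>v v" if "v \<in> carrier_vec n" for v
    using that L by (auto simp: shift_op_def intro!: eq_vecI)
  have Lu: "L *\<^sub>v ?u = 0\<^sub>v n" using Suc.prems s0[OF u] by simp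
  show ?case
  proof (cases m)
    case 0
    then show ?thesis using Lu by simp
  next
    case (Suc m')
    let ?t = "foldr (shift_op L) (replicate m' 0) x"
    have t: "?t \<in> carrier_vec n" by (rule foldr_shift_op_carrier[OF L Suc.prems(1)])
    have "?u = L *\<^sub>v ?t" using Suc s0[OF t] by simp
    then have "?u = 0\<^sub>v n" using sq[OF t] Lu by simp
    then show ?thesis using Suc.IH Suc.prems by blast
  qed
qed

text \<open>In Schur coordinates the shifted matrix is upper triangular with a zero at diagonal
  position \<open>q\<close>, so a vector supported on the first \<open>Suc q\<close> coordinates is
  mapped to one supported on the first \<open>q\<close>.\<close>

lemma triangular_shift_support:
  fixes L B P Q :: "real Matrix.mat"
  assumes wit: "similar_mat_wit L B P Q" and L: "L \<in> carrier_mat n n"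
    and tri: "upper_triangular B" and q: "q < n" and w: "w \<in> carrier_vec n"
    and supp: "\<And>i. Suc q \<le> i \<Longrightarrow> i < n \<Longrightarrow> (Q *\<^sub>v w) $ i = 0"
    and i: "q \<le> i" "i < n"
  shows "(Q *\<^sub>v shift_op L (B $$ (q,q)) w) $ i = 0"
proof -
  note D = similar_mat_witD2(1,2,4-7)[OF L wit] and LPBQ = similar_mat_witD2(3)[OF L wit]
  have u: "Q *\<^sub>v w \<in> carrier_vec n" using D(6) w by simp
  have QL: "Q *\<^sub>v (L *\<^sub>v w) = B *\<^sub>v (Q *\<^sub>v w)"
  proof -
    have "Q * L = Q * (P * (B * Q))"
      unfolding LPBQ using D by (simp add: assoc_mult_mat[of P n n B n Q n])
    also have "\<dots> = (Q * P) * (B * Q)"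
      by (rule assoc_mult_mat[symmetric, OF D(6,5) mult_carrier_mat[OF D(4,6)]])
    also have "\<dots> = B * Q" unfolding D(2) by (rule left_mult_one_mat[OF mult_carrier_mat[OF D(4,6)]])
    finally have "(Q * L) *\<^sub>v w = (B * Q) *\<^sub>v w" by simp
    then show ?thesis using D L w by simp
  qed
  have "(Q *\<^sub>v shift_op L (B $$ (q,q)) w) $ i = (B *\<^sub>v (Q *\<^sub>v w)) $ i - B $$ (q,q) * (Q *\<^sub>v w) $ i"
    unfolding shift_op_def using D L w i QL
    by (simp add: mult_minus_distrib_mat_vec[of Q n n] mult_mat_vec[of Q n n])
  also have "(B *\<^sub>v (Q *\<^sub>v w)) $ i = (\<Sum>j<n. B $$ (i,j) * (Q *\<^sub>v w) $ j)"
    using D i u by (subst mult_mat_vec_index) auto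
  also have "\<dots> = (\<Sum>j<n. if j = q then B $$ (q,q) * (Q *\<^sub>v w) $ i else 0)"
  proof (rule sum.cong[OF refl])
    fix j assume "j \<in> {..<n}"
    then have j: "j < n" by simp
    consider "j > q" | "j = q" "i = q" | "j = q" "i > q" | "j < q" using i by linarith
    then show "B $$ (i,j) * (Q *\<^sub>v w) $ j = (if j = q then B $$ (q,q) * (Q *\<^sub>v w) $ i else 0)"
    proof cases
      case 1
      then show ?thesis using supp[of j] j by auto
    next
      case 2
      then show ?thesis by simp
    next
      case 3
      then have "B $$ (i,j) = 0" using upper_triangularD[OF tri, of j i] i D by auto
      then show ?thesis using 3 supp[of i] i by auto
    next
      case 4
      then have "B $$ (i,j) = 0" using upper_triangularD[OF tri, of j i] i D by auto
      then show ?thesis using 4 by auto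
    qed
  qed
  also have "\<dots> = B $$ (q,q) * (Q *\<^sub>v w) $ i" using q by simp
  finally show ?thesis by simp
qed

text \<open>All complex roots are real, so the complex factorisation is the image of a real one, and
  the coefficient embedding is injective.\<close>

lemma real_char_poly_factors:
  fixes L :: "real Matrix.mat"
  assumes L: "L \<in> carrier_mat n n"
    and real: "\<And>mu. eigenvalue (map_mat complex_of_real L) mu \<Longrightarrow> Im mu = 0"
  shows "\<exists>es. char_poly L = (\<Prod>e\<leftarrow>es. [:- e, 1:])"
proof -
  let ?C = "map_mat complex_of_real L"
  have C: "?C \<in> carrier_mat n n" using L by simp
  interpret h: map_poly_inj_comm_ring_hom complex_of_real ..
  obtain as where as: "char_poly ?C = (\<Prod>a\<leftarrow>as. [:- a, 1:])"
    using char_poly_factorized[OF C] by auto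
  have "poly (char_poly ?C) b = 0" if "b \<in> set as" for b
    unfolding as using that by (induction as) auto
  then have re: "b = complex_of_real (Re b)" if "b \<in> set as" for b
    using real that eigenvalue_root_char_poly[OF C] by (simp add: complex_eq_iff)
  have "map_poly complex_of_real (char_poly L) = char_poly ?C"
    by (rule of_real_hom.char_poly_hom[OF L, symmetric])
  also have "\<dots> = (\<Prod>a\<leftarrow>map (complex_of_real \<circ> Re) as. [:- a, 1:])"
    unfolding as using re by (metis (mono_tags, lifting) comp_apply map_idI)
  also have "\<dots> = map_poly complex_of_real (\<Prod>e\<leftarrow>map Re as. [:- e, 1:])"
    by (induction as) (simp_all add: h.hom_mult del: mult_pCons_left)
  finally have "char_poly L = (\<Prod>e\<leftarrow>map Re as. [:- e, 1:])" by (rule h.injectivity)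
  then show ?thesis by blast
qed

text \<open>Cayley-Hamilton with the factors at 0 merged: by semisimplicity, whatever they
  annihilate is already annihilated by a single \<open>L\<close>, and that \<open>L\<close> commutes
  to the inside. The remaining factors therefore annihilate the range of \<open>L\<close>.\<close>

lemma annihilating_shifts:
  fixes L :: "real Matrix.mat"
  assumes L: "L \<in> carrier_mat n n"
    and real: "\<And>mu. eigenvalue (map_mat complex_of_real L) mu \<Longrightarrow> Im mu = 0"
    and sq: "\<And>x. x \<in> carrier_vec n \<Longrightarrow> L *\<^sub>v (L *\<^sub>v x) = 0\<^sub>v n \<Longrightarrow> L *\<^sub>v x = 0\<^sub>v n"
  shows "\<exists>rs. (\<forall>r\<in>set rs. r \<noteq> 0 \<and> eigenvalue L r)
    \<and> (\<forall>y\<in>carrier_vec n. foldr (shift_op L) rs (L *\<^sub>v y) = 0\<^sub>v n)"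
proof -
  obtain es0 where es0: "char_poly L = (\<Prod>e\<leftarrow>es0. [:- e, 1:])"
    using real_char_poly_factors[OF L real] by blast
  define rs where "rs = filter (\<lambda>e. e \<noteq> 0) es0"
  define m where "m = length (filter ((=) 0) es0)"
  \<comment> \<open>Zeros come first in the list, hence are applied last by
    \<open>foldr\<close>.\<close>
  define es where "es = replicate m 0 @ rs"
  have "prod_list (map f es0) = prod_list (map f (filter ((=) 0) es0)) * prod_list (map f rs)"
    for f :: "real \<Rightarrow> real poly"
    unfolding rs_def by (induction es0) (auto simp: mult.left_commute mult.assoc)
  then have "char_poly L = (\<Prod>e\<leftarrow>es. [:- e, 1:])"
    unfolding es0 es_def m_def replicate_length_filter by simp
  obtain B P Q where "schur_decomposition L es = (B, P, Q)" by (cases "schur_decomposition L es")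
  then have wit: "similar_mat_wit L B P Q" and tri: "upper_triangular B" and dg: "diag_mat B = es"
    using schur_decomposition[OF L \<open>char_poly L = (\<Prod>e\<leftarrow>es. [:- e, 1:])\<close>] by auto
  note D = similar_mat_witD2(1,2,4-7)[OF L wit]
  have len: "length es = n" using arg_cong[OF dg, of length] D by (simp add: diag_mat_def)
  have esq: "es ! q = B $$ (q,q)" if "q < n" for q
    using that D unfolding dg[symmetric] by (simp add: diag_mat_def)
  \<comment> \<open>Downward induction over the diagonal: each factor clears one more Schur
    coordinate, and at \<open>q = 0\<close> none is left.\<close>
  have supp: "\<forall>i. q \<le> i \<longrightarrow> i < n \<longrightarrow> (Q *\<^sub>v foldr (shift_op L) (drop q es) y) $ i = 0"
    if "q \<le> n" and y: "y \<in> carrier_vec n" for q y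
    using that(1)
  proof (induction q rule: inc_induct)
    case base
    then show ?case by simp
  next
    case (step q)
    have "drop q es = B $$ (q,q) # drop (Suc q) es"
      using step len by (simp add: Cons_nth_drop_Suc[symmetric] esq)
    then show ?case
      using triangular_shift_support[OF wit L tri, of q "foldr (shift_op L) (drop (Suc q) es) y"]
        step foldr_shift_op_carrier[OF L y] by simp
  qed
  have ev: "eigenvalue L r" if "r \<in> set es0" for r
  proof -
    have "poly (char_poly L) r = 0"
      unfolding es0 using that by (induction es0) auto
    then show ?thesis using eigenvalue_root_char_poly[OF L] by simp
  qed
  have "foldr (shift_op L) rs (L *\<^sub>v y) = 0\<^sub>v n" if y: "y \<in> carrier_vec n" for y
  proof -
    let ?w = "foldr (shift_op L) es y"
    have wc: "?w \<in> carrier_vec n" by (rule foldr_shift_op_carrier[OF L y])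
    have "Q *\<^sub>v ?w = 0\<^sub>v n"
      using supp[of 0, OF _ y] D by (intro eq_vecI) auto
    then have "P *\<^sub>v (Q *\<^sub>v ?w) = 0\<^sub>v n" using D by (auto intro!: eq_vecI)
    then have "(P * Q) *\<^sub>v ?w = 0\<^sub>v n" using assoc_mult_mat_vec[OF D(5,6) wc] by simp
    then have "?w = 0\<^sub>v n" using D(1) wc by simp
    then have "L *\<^sub>v foldr (shift_op L) rs y = 0\<^sub>v n"
      using foldr_shift_op_0_kernel[OF L sq foldr_shift_op_carrier[OF L y], of m rs]
      by (simp add: es_def)
    then show ?thesis using foldr_shift_op_commute[OF L y] by simp
  qed
  moreover have "\<forall>r\<in>set rs. r \<noteq> 0 \<and> eigenvalue L r" using ev by (auto simp: rs_def)
  ultimately show ?thesis by blast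
qed

section \<open>Real nonnegative spectrum of the layer matrices\<close>

context hierarchy
begin

lemma wip_add_smult:
  assumes "x \<in> carrier_vec (N l)" "z \<in> carrier_vec (N l)"
  shows "wip l y (p \<cdot>\<^sub>v x + q \<cdot>\<^sub>v z) = p * wip l y x + q * wip l y z"
proof -
  have "wip l y (p \<cdot>\<^sub>v x + q \<cdot>\<^sub>v z)
    = (\<Sum>i<N l. p * (wts k a l i * (y $ i * x $ i)) + q * (wts k a l i * (y $ i * z $ i)))"
    unfolding wip_def using carrier_vecD[OF assms(1)] carrier_vecD[OF assms(2)]
    by (intro sum.cong) (simp_all add: algebra_simps)
  then show ?thesis by (simp add: wip_def sum.distrib sum_distrib_left)
qed

text \<open>Real and imaginary part of the eigenvector span an invariant subspace. Its image under
  \<open>Cprod\<close> lies in layer \<open>l\<close>, where self-adjointness of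
  \<open>Smat l\<close> forces \<open>q = 0\<close> and nonnegativity forces
  \<open>p \<ge> 0\<close>, unless the image is zero.\<close>

lemma Lm_eigenvalue:
  assumes l: "1 \<le> l" "l \<le> M" and ev: "eigenvalue (map_mat complex_of_real (Lm l)) mu"
  shows "Im mu = 0" "Re mu \<ge> 0"
proof -
  let ?L = "Lm l" and ?n = "N 1"
  define p where "p = Re mu"
  define q where "q = Im mu"
  have l': "l \<in> {1..M}" using l by auto
  have L: "?L \<in> carrier_mat ?n ?n" by (rule Lm_carrier[OF l(1)])
  obtain v where v: "v \<in> carrier_vec ?n" "v \<noteq> 0\<^sub>v ?n"
    and Lv: "map_mat complex_of_real ?L *\<^sub>v v = mu \<cdot>\<^sub>v v"
    using ev L unfolding eigenvalue_def eigenvector_def by auto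
  define x where "x = Matrix.vec ?n (\<lambda>i. Re (v $ i))"
  define y where "y = Matrix.vec ?n (\<lambda>i. Im (v $ i))"
  have xc: "x \<in> carrier_vec ?n" and yc: "y \<in> carrier_vec ?n" by (simp_all add: x_def y_def)
  have e: "(\<Sum>j<?n. complex_of_real (?L $$ (i,j)) * v $ j) = mu * v $ i" if i: "i < ?n" for i
  proof -
    have "(map_mat complex_of_real ?L *\<^sub>v v) $ i = (\<Sum>j<?n. complex_of_real (?L $$ (i,j)) * v $ j)"
      using i L v by (subst mult_mat_vec_index) auto
    then show ?thesis using Lv i v by simp
  qed
  have Lx: "?L *\<^sub>v x = p \<cdot>\<^sub>v x + (- q) \<cdot>\<^sub>v y"
  proof
    fix i assume "i < dim_vec (p \<cdot>\<^sub>v x + (- q) \<cdot>\<^sub>v y)"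
    then have i: "i < ?n" by (simp add: y_def)
    have "(?L *\<^sub>v x) $ i = (\<Sum>j<?n. ?L $$ (i,j) * x $ j)"
      using i L xc by (subst mult_mat_vec_index) auto
    also have "\<dots> = Re (\<Sum>j<?n. complex_of_real (?L $$ (i,j)) * v $ j)"
      by (simp add: x_def)
    also have "\<dots> = (p \<cdot>\<^sub>v x + (- q) \<cdot>\<^sub>v y) $ i"
      using i by (simp add: e[OF i] x_def y_def p_def q_def)
    finally show "(?L *\<^sub>v x) $ i = (p \<cdot>\<^sub>v x + (- q) \<cdot>\<^sub>v y) $ i" .
  qed (use L in \<open>simp add: y_def\<close>)
  have Ly: "?L *\<^sub>v y = q \<cdot>\<^sub>v x + p \<cdot>\<^sub>v y"
  proof
    fix i assume "i < dim_vec (q \<cdot>\<^sub>v x + p \<cdot>\<^sub>v y)"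
    then have i: "i < ?n" by (simp add: y_def)
    have "(?L *\<^sub>v y) $ i = (\<Sum>j<?n. ?L $$ (i,j) * y $ j)"
      using i L yc by (subst mult_mat_vec_index) auto
    also have "\<dots> = Im (\<Sum>j<?n. complex_of_real (?L $$ (i,j)) * v $ j)"
      by (simp add: y_def)
    also have "\<dots> = (q \<cdot>\<^sub>v x + p \<cdot>\<^sub>v y) $ i"
      using i by (simp add: e[OF i] x_def y_def p_def q_def)
    finally show "(?L *\<^sub>v y) $ i = (q \<cdot>\<^sub>v x + p \<cdot>\<^sub>v y) $ i" .
  qed (use L in \<open>simp add: y_def\<close>)
  let ?C = "Cprod N k c l"
  note C = Cprod_carrier[OF l(1)]
  define w1 where "w1 = ?C *\<^sub>v x"
  define w2 where "w2 = ?C *\<^sub>v y"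
  have w1: "w1 \<in> carrier_vec (N l)" and w2: "w2 \<in> carrier_vec (N l)"
    unfolding w1_def w2_def by (rule Cprod_vec_carrier[OF l(1)])+
  have S1: "Smat l *\<^sub>v w1 = p \<cdot>\<^sub>v w1 + (- q) \<cdot>\<^sub>v w2"
    using Cprod_Lm[OF l xc] Lx xc yc C
    by (simp add: w1_def w2_def mult_add_distrib_mat_vec[OF C] mult_mat_vec[OF C])
  have S2: "Smat l *\<^sub>v w2 = q \<cdot>\<^sub>v w1 + p \<cdot>\<^sub>v w2"
    using Cprod_Lm[OF l yc] Ly xc yc C
    by (simp add: w1_def w2_def mult_add_distrib_mat_vec[OF C] mult_mat_vec[OF C])
  have com: "wip l w1 w2 = wip l w2 w1" by (simp add: wip_def mult.commute)
  have pos: "wip l w1 w1 \<ge> 0" "wip l w2 w2 \<ge> 0" using wip_self_pos(1)[OF l'] w1 w2 by auto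
  have q0: "q * (wip l w1 w1 + wip l w2 w2) = 0"
    using wip_Smat_sym[OF l' w1 w2] by (simp add: S1 S2 wip_add_smult w1 w2 com algebra_simps)
  have p0: "p * (wip l w1 w1 + wip l w2 w2) \<ge> 0"
    using wip_Smat_nonneg[OF l' w1] wip_Smat_nonneg[OF l' w2]
    by (simp add: S1 S2 wip_add_smult w1 w2 com algebra_simps)
  have "q = 0 \<and> p \<ge> 0"
  proof (cases "wip l w1 w1 + wip l w2 w2 = 0")
    case False
    then have "wip l w1 w1 + wip l w2 w2 > 0" using pos by linarith
    then show ?thesis using q0 p0 by (auto simp: zero_le_mult_iff)
  next
    \<comment> \<open>Layer \<open>l\<close> does not see the eigenvector, so \<open>Lm l\<close>
      annihilates it and the eigenvalue is 0.\<close>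
    case True
    then have "wip l w1 w1 = 0" "wip l w2 w2 = 0" using pos by auto
    then have "w1 = 0\<^sub>v (N l)" "w2 = 0\<^sub>v (N l)"
      using wip_self_pos(2)[OF l' w1] wip_self_pos(2)[OF l' w2] by auto
    then have "?L *\<^sub>v x = 0\<^sub>v ?n" "?L *\<^sub>v y = 0\<^sub>v ?n"
      using Lm_eq_0_iff[OF l xc] Lm_eq_0_iff[OF l yc] Smat_const[OF l', of 0]
      by (auto simp: w1_def w2_def zero_vec_def)
    then have zx: "p \<cdot>\<^sub>v x + (- q) \<cdot>\<^sub>v y = 0\<^sub>v ?n" and zy: "q \<cdot>\<^sub>v x + p \<cdot>\<^sub>v y = 0\<^sub>v ?n"
      using Lx Ly by simp_all
    have z: "p * x $ i - q * y $ i = 0 \<and> q * x $ i + p * y $ i = 0" if "i < ?n" for i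
      using that arg_cong[OF zx, of "\<lambda>v. v $ i"] arg_cong[OF zy, of "\<lambda>v. v $ i"]
        carrier_vecD[OF xc] carrier_vecD[OF yc] by simp
    have "mu * v $ i = 0" if "i < ?n" for i
      using z[OF that] that by (auto simp: complex_eq_iff x_def y_def p_def q_def algebra_simps)
    moreover obtain i where "i < ?n" "v $ i \<noteq> 0"
    proof -
      have "v = 0\<^sub>v ?n" if "\<And>i. i < ?n \<Longrightarrow> v $ i = 0"
        using that carrier_vecD[OF v(1)] by (intro eq_vecI) simp_all
      then show ?thesis using v(2) that by blast
    qed
    ultimately have "mu = 0" by auto
    then show ?thesis by (simp add: p_def q_def)
  qed
  then show "Im mu = 0" "Re mu \<ge> 0" by (simp_all add: p_def q_def)
qed

section \<open>The characteristic equation\<close>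

lemma Lm_Lm_entry:
  assumes l: "1 \<le> l" "l < m" "m \<le> M" and ij: "i < N 1" "j < N 1"
  shows "(\<Sum>q<N 1. Lm l $$ (i,q) * Lm m $$ (q,j)) = 0"
proof -
  have m1: "1 \<le> m" using l by simp
  let ?u = "unit_vec (N 1) j :: real Matrix.vec"
  have u: "(Lm m *\<^sub>v ?u) $ q = Lm m $$ (q,j)" if "q < N 1" for q
  proof -
    have "(Lm m *\<^sub>v ?u) $ q = (\<Sum>r<N 1. Lm m $$ (q,r) * ?u $ r)"
      using that Lm_carrier[OF m1] by (subst mult_mat_vec_index) auto
    also have "\<dots> = (\<Sum>r<N 1. if r = j then Lm m $$ (q,r) else 0)"
      by (intro sum.cong) (auto simp: unit_vec_def)
    finally show ?thesis using ij by simp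
  qed
  have "0 = (Lm l *\<^sub>v (Lm m *\<^sub>v ?u)) $ i"
    using Lm_Lm_vec[OF l, of ?u] ij by simp
  also have "\<dots> = (\<Sum>q<N 1. Lm l $$ (i,q) * (Lm m *\<^sub>v ?u) $ q)"
    using ij Lm_carrier[OF l(1)] Lm_carrier[OF m1] by (subst mult_mat_vec_index) auto
  finally show ?thesis by (simp add: u)
qed

text \<open>The index set is a parameter so that single layers and partial sums of layers are
  instances of one matrix.\<close>

definition pencil :: "complex \<Rightarrow> (nat \<Rightarrow> complex) \<Rightarrow> nat set \<Rightarrow> complex Matrix.mat" where
  "pencil s e I = Matrix.mat (N 1) (N 1)
     (\<lambda>(i,j). (if i = j then s else 0) + (\<Sum>l\<in>I. e l * complex_of_real (Lm l $$ (i,j))))"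

lemma pencil_carrier [simp]: "pencil s e I \<in> carrier_mat (N 1) (N 1)"
  by (simp add: pencil_def)

lemma pencil_mult:
  assumes m: "Suc m \<le> M"
  shows "pencil s e {1..m} * pencil s e {Suc m} = s \<cdot>\<^sub>m pencil s e {1..Suc m}"
proof (rule eq_matI)
  fix i j assume "i < dim_row (s \<cdot>\<^sub>m pencil s e {1..Suc m})" "j < dim_col (s \<cdot>\<^sub>m pencil s e {1..Suc m})"
  then have ij: "i < N 1" "j < N 1" by (simp_all add: pencil_def)
  let ?S = "Suc m"
  let ?f = "\<lambda>i j. \<Sum>l=1..m. e l * complex_of_real (Lm l $$ (i,j))"
  let ?g = "\<lambda>i j. e ?S * complex_of_real (Lm ?S $$ (i,j))"
  have "(pencil s e {1..m} * pencil s e {?S}) $$ (i,j)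
    = (\<Sum>q<N 1. pencil s e {1..m} $$ (i,q) * pencil s e {?S} $$ (q,j))"
    using ij by (simp add: pencil_def scalar_prod_def atLeast0LessThan)
  also have "\<dots> = (\<Sum>q<N 1. (if q = j then s * pencil s e {1..m} $$ (i,j) else 0)
      + (if q = i then s * ?g i j else 0) + ?f i q * ?g q j)"
    using ij by (intro sum.cong) (auto simp: pencil_def algebra_simps)
  also have "\<dots> = s * pencil s e {1..m} $$ (i,j) + s * ?g i j + (\<Sum>q<N 1. ?f i q * ?g q j)"
    using ij by (simp add: sum.distrib)
  also have "(\<Sum>q<N 1. ?f i q * ?g q j)
    = (\<Sum>l=1..m. \<Sum>q<N 1. e l * complex_of_real (Lm l $$ (i,q)) * ?g q j)"
    by (simp add: sum_distrib_right sum.swap[of _ "{..<N 1}"])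
  also have "\<dots> = (\<Sum>l=1..m. e l * e ?S * complex_of_real (\<Sum>q<N 1. Lm l $$ (i,q) * Lm ?S $$ (q,j)))"
    by (simp add: sum_distrib_left mult_ac)
  also have "\<dots> = 0"
    using Lm_Lm_entry[OF _ _ m ij] by (intro sum.neutral) auto
  finally show "(pencil s e {1..m} * pencil s e {?S}) $$ (i,j) = (s \<cdot>\<^sub>m pencil s e {1..?S}) $$ (i,j)"
    using ij by (simp add: pencil_def algebra_simps)
qed (simp_all add: pencil_def)

text \<open>The factor \<open>s\<close> in \<open>pencil_mult\<close> can be divided out only for
  nonzero \<open>s\<close>; the root 0 is therefore handled on its own.\<close>

lemma det_pencil:
  assumes s: "s \<noteq> 0"
  shows "m \<le> M \<Longrightarrow> det (pencil s e {1..m}) = 0 \<longleftrightarrow> (\<exists>l\<in>{1..m}. det (pencil s e {l}) = 0)"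
proof (induction m)
  case 0
  have "pencil s e {1..0} = s \<cdot>\<^sub>m 1\<^sub>m (N 1)"
    by (rule eq_matI) (auto simp: pencil_def)
  then show ?case using s by (simp add: det_smult)
next
  case (Suc m)
  have "det (pencil s e {1..m}) * det (pencil s e {Suc m}) = det (s \<cdot>\<^sub>m pencil s e {1..Suc m})"
    unfolding pencil_mult[OF Suc.prems, symmetric] by (rule det_mult[OF pencil_carrier pencil_carrier, symmetric])
  also have "\<dots> = s ^ N 1 * det (pencil s e {1..Suc m})"
    by (simp add: det_smult pencil_def)
  finally have "det (pencil s e {1..Suc m}) = 0
    \<longleftrightarrow> det (pencil s e {1..m}) = 0 \<or> det (pencil s e {Suc m}) = 0"
    using s by (metis mult_eq_0_iff power_not_zero)
  also have "\<dots> \<longleftrightarrow> (\<exists>l\<in>{1..Suc m}. det (pencil s e {l}) = 0)"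
    using Suc by (auto simp: atLeastAtMostSuc_conv)
  finally show ?case .
qed

lemma det_pencil_single:
  assumes l: "1 \<le> l" and e: "e l \<noteq> 0"
  shows "det (pencil s e {l}) = 0 \<longleftrightarrow> eigenvalue (map_mat complex_of_real (Lm l)) (- s / e l)"
proof -
  let ?C = "map_mat complex_of_real (Lm l)"
  have L: "Lm l \<in> carrier_mat (N 1) (N 1)" by (rule Lm_carrier[OF l])
  then have C: "?C \<in> carrier_mat (N 1) (N 1)" by simp
  have "pencil s e {l} = e l \<cdot>\<^sub>m char_matrix ?C (- s / e l)"
    using e L by (intro eq_matI) (auto simp: pencil_def char_matrix_def field_simps)
  then have "det (pencil s e {l}) = e l ^ N 1 * det (char_matrix ?C (- s / e l))"
    using L by (simp add: det_smult char_matrix_def)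
  then show ?thesis using e by (simp add: eigenvalue_det[OF C])
qed

text \<open>Every row of every \<open>Lm l\<close> sums to zero, so the all-ones vector is a kernel
  vector whatever the exponential factors are.\<close>

lemma det_pencil_0:
  assumes "m \<le> M"
  shows "det (pencil 0 e {1..m}) = 0"
proof -
  let ?v = "Matrix.vec (N 1) (\<lambda>_. 1 :: complex)"
  have row: "(\<Sum>j<N 1. Lm l $$ (i,j)) = 0" if "1 \<le> l" "l \<le> M" "i < N 1" for l i
  proof -
    have "(Lm l *\<^sub>v Matrix.vec (N 1) (\<lambda>_. 1)) $ i = (\<Sum>j<N 1. Lm l $$ (i,j))"
      using that Lm_carrier[OF that(1)] by (subst mult_mat_vec_index) auto
    then show ?thesis using Lm_const[OF that(1,2)] that(3) by simp
  qed
  have "pencil 0 e {1..m} *\<^sub>v ?v = 0\<^sub>v (N 1)"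
  proof
    fix i assume "i < dim_vec (0\<^sub>v (N 1) :: complex Matrix.vec)"
    then have i: "i < N 1" by simp
    have "(pencil 0 e {1..m} *\<^sub>v ?v) $ i
      = (\<Sum>j<N 1. \<Sum>l=1..m. e l * complex_of_real (Lm l $$ (i,j)))"
      using i by (subst mult_mat_vec_index) (auto simp: pencil_def)
    also have "\<dots> = (\<Sum>l=1..m. e l * complex_of_real (\<Sum>j<N 1. Lm l $$ (i,j)))"
      by (subst sum.swap) (simp add: sum_distrib_left)
    also have "\<dots> = 0" using row[OF _ _ i] assms by (intro sum.neutral) auto
    finally show "(pencil 0 e {1..m} *\<^sub>v ?v) $ i = 0\<^sub>v (N 1) $ i" using i by simp
  qed (simp add: pencil_def)
  moreover have "?v \<noteq> 0\<^sub>v (N 1)"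
  proof
    assume "?v = 0\<^sub>v (N 1)"
    then have "?v $ 0 = (0\<^sub>v (N 1) :: complex Matrix.vec) $ 0" by simp
    then show False using N_pos[of 1] M_ge_2 by simp
  qed
  ultimately show ?thesis
    using det_0_iff_vec_prod_zero[OF pencil_carrier] by (metis vec_carrier)
qed

theorem characteristic_roots:
  "{s. det (charmat M N k A a c \<tau> s) = 0}
     = {0}
       \<union> {s. \<exists>mu. mu \<noteq> 0 \<and> eigenvalue (map_mat complex_of_real (Lm 1)) mu \<and> s + mu = 0}
       \<union> (\<Union>l\<in>{2..M}. {s. \<exists>mu. mu \<noteq> 0 \<and> eigenvalue (map_mat complex_of_real (Lm l)) mu
            \<and> s * exp (2 * s * complex_of_real (Dsum \<tau> l)) + mu = 0})" (is "?A = ?B")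
proof (rule Set.set_eqI)
  fix s :: complex
  define e where "e l = exp (- 2 * s * complex_of_real (Dsum \<tau> l))" for l
  have e1: "e 1 = 1" by (simp add: e_def Dsum_def)
  have split: "{1..M} = insert 1 {2..M}" using M_ge_2 by auto
  have cm: "charmat M N k A a c \<tau> s = pencil s e {1..M}"
    unfolding charmat_def pencil_def split
    by (intro eq_matI) (auto simp: e1, simp_all add: e_def)
  show "s \<in> ?A \<longleftrightarrow> s \<in> ?B"
  proof (cases "s = 0")
    case True
    then show ?thesis using det_pencil_0[of M e] cm by simp
  next
    case False
    \<comment> \<open>Nonvanishing of \<open>mu\<close> follows from \<open>s \<noteq> 0\<close>, as
      \<open>mu = - s / e l\<close>.\<close>
    have ev: "eigenvalue C (- s / e l) \<longleftrightarrow> (\<exists>mu. mu \<noteq> 0 \<and> eigenvalue C mu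
        \<and> s * exp (2 * s * complex_of_real (Dsum \<tau> l)) + mu = 0)" for C l
    proof -
      have "- s / e l = - (s * exp (2 * s * complex_of_real (Dsum \<tau> l)))"
        by (simp add: e_def exp_minus field_simps)
      then show ?thesis using False by (auto simp: add_eq_0_iff)
    qed
    have "s \<in> ?A \<longleftrightarrow> (\<exists>l\<in>{1..M}. det (pencil s e {l}) = 0)"
      using det_pencil[OF False order_refl, of e] by (simp add: cm)
    also have "\<dots> \<longleftrightarrow> (\<exists>l\<in>{1..M}. eigenvalue (map_mat complex_of_real (Lm l)) (- s / e l))"
      using det_pencil_single[of _ e s] by (intro bex_cong) (auto simp: e_def)
    also have "\<dots> \<longleftrightarrow> s \<in> ?B"
      unfolding split bex_simps ev using False by (simp add: Dsum_def)
    finally show ?thesis .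
  qed
qed

end

section \<open>Scalar delay equations\<close>

text \<open>The starting time is existential because solutions jump at time 0 and are continuously
  differentiable only after the largest delay.\<close>
definition sqint :: "(real \<Rightarrow> real) \<Rightarrow> bool" where
  "sqint f \<longleftrightarrow> (\<exists>t0 B. continuous_on {t0..} f \<and> (\<forall>t\<ge>t0. integral {t0..t} (\<lambda>u. (f u)\<^sup>2) \<le> B))"

lemma continuous_square_integrable:
  fixes f :: "real \<Rightarrow> real"
  assumes "continuous_on {t0..} f" "t0 \<le> t1"
  shows "(\<lambda>u. (f u)\<^sup>2) integrable_on {t1..t}"
  by (intro integrable_continuous_interval continuous_on_power continuous_on_subset[OF assms(1)])
     (use assms in auto)

text \<open>The integrand is nonnegative, so one bound serves every later starting time; two signals
  can thus be compared from a common start.\<close>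

lemma sqintE:
  assumes "sqint f"
  obtains t0 B where "\<And>t1. t0 \<le> t1 \<Longrightarrow> continuous_on {t1..} f"
    and "\<And>t1 t. t0 \<le> t1 \<Longrightarrow> integral {t1..t} (\<lambda>u. (f u)\<^sup>2) \<le> B"
proof -
  obtain t0 B where c: "continuous_on {t0..} f"
    and B: "\<And>t. t \<ge> t0 \<Longrightarrow> integral {t0..t} (\<lambda>u. (f u)\<^sup>2) \<le> B"
    using assms by (auto simp: sqint_def)
  have "integral {t1..t} (\<lambda>u. (f u)\<^sup>2) \<le> B" if "t0 \<le> t1" for t1 t
  proof (cases "t1 \<le> t")
    case True
    have "integral {t1..t} (\<lambda>u. (f u)\<^sup>2) \<le> integral {t0..t} (\<lambda>u. (f u)\<^sup>2)"
      using that by (intro integral_subset_le continuous_square_integrable[OF c]) auto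
    then show ?thesis using B[of t] that True by linarith
  next
    case False
    then show ?thesis using B[of t0] by simp
  qed
  moreover have "continuous_on {t1..} f" if "t0 \<le> t1" for t1
    using that by (intro continuous_on_subset[OF c]) auto
  ultimately show ?thesis using that by blast
qed

section \<open>Closure properties of square integrable signals\<close>

lemma sqintI:
  assumes "continuous_on {t0..} f" "\<And>t. t \<ge> t0 \<Longrightarrow> integral {t0..t} (\<lambda>u. (f u)\<^sup>2) \<le> B"
  shows "sqint f"
  using assms unfolding sqint_def by blast

lemma sqint_zero: "sqint (\<lambda>_. 0)"
  by (rule sqintI[of 0 _ 0]) auto

lemma sqint_cmult:
  assumes "sqint f"
  shows "sqint (\<lambda>t. r * f t)"
proof -
  obtain t0 B where c: "continuous_on {t0..} f"
    and B: "\<And>t. integral {t0..t} (\<lambda>u. (f u)\<^sup>2) \<le> B"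
    using sqintE[OF assms] by (metis order_refl)
  show ?thesis
  proof (rule sqintI[of t0 _ "r\<^sup>2 * B"])
    show "continuous_on {t0..} (\<lambda>t. r * f t)" by (intro continuous_intros c)
    fix t
    have "integral {t0..t} (\<lambda>u. (r * f u)\<^sup>2) = r\<^sup>2 * integral {t0..t} (\<lambda>u. (f u)\<^sup>2)"
      by (simp add: power_mult_distrib)
    then show "integral {t0..t} (\<lambda>u. (r * f u)\<^sup>2) \<le> r\<^sup>2 * B"
      using B[of t] by (simp add: mult_left_mono)
  qed
qed

lemma sqint_add:
  assumes "sqint f" "sqint g"
  shows "sqint (\<lambda>t. f t + g t)"
proof -
  obtain t0 B where f: "\<And>t1. t0 \<le> t1 \<Longrightarrow> continuous_on {t1..} f"
    "\<And>t1 t. t0 \<le> t1 \<Longrightarrow> integral {t1..t} (\<lambda>u. (f u)\<^sup>2) \<le> B"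
    using sqintE[OF assms(1)] by metis
  obtain t1 D where g: "\<And>t2. t1 \<le> t2 \<Longrightarrow> continuous_on {t2..} g"
    "\<And>t2 t. t1 \<le> t2 \<Longrightarrow> integral {t2..t} (\<lambda>u. (g u)\<^sup>2) \<le> D"
    using sqintE[OF assms(2)] by metis
  define m where "m = max t0 t1"
  have m: "t0 \<le> m" "t1 \<le> m" by (auto simp: m_def)
  note cf = f(1)[OF m(1)] and cg = g(1)[OF m(2)]
  show ?thesis
  proof (rule sqintI[of m _ "2 * B + 2 * D"])
    show "continuous_on {m..} (\<lambda>t. f t + g t)" by (intro continuous_intros cf cg)
    fix t
    have i: "(\<lambda>u. (f u)\<^sup>2) integrable_on {m..t}" "(\<lambda>u. (g u)\<^sup>2) integrable_on {m..t}"
      by (rule continuous_square_integrable[OF cf order_refl] continuous_square_integrable[OF cg order_refl])+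
    have "integral {m..t} (\<lambda>u. (f u + g u)\<^sup>2) \<le> integral {m..t} (\<lambda>u. 2 * (f u)\<^sup>2 + 2 * (g u)\<^sup>2)"
    proof (rule integral_le)
      show "(\<lambda>u. (f u + g u)\<^sup>2) integrable_on {m..t}"
        by (rule continuous_square_integrable[OF _ order_refl]) (intro continuous_intros cf cg)
      show "(\<lambda>u. 2 * (f u)\<^sup>2 + 2 * (g u)\<^sup>2) integrable_on {m..t}"
        using i by (intro integrable_add integrable_on_mult_right)
      fix u
      have "(f u + g u)\<^sup>2 + (f u - g u)\<^sup>2 = 2 * (f u)\<^sup>2 + 2 * (g u)\<^sup>2"
        by (simp add: power2_eq_square algebra_simps)
      then show "(f u + g u)\<^sup>2 \<le> 2 * (f u)\<^sup>2 + 2 * (g u)\<^sup>2"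
        using zero_le_power2[of "f u - g u"] by linarith
    qed
    also have "\<dots> = 2 * integral {m..t} (\<lambda>u. (f u)\<^sup>2) + 2 * integral {m..t} (\<lambda>u. (g u)\<^sup>2)"
      using i by (simp add: integral_add integrable_on_mult_right)
    also have "\<dots> \<le> 2 * B + 2 * D"
      using f(2)[OF m(1), of t] g(2)[OF m(2), of t] by simp
    finally show "integral {m..t} (\<lambda>u. (f u + g u)\<^sup>2) \<le> 2 * B + 2 * D" .
  qed
qed

lemma sqint_sum:
  "(\<And>i. i \<in> I \<Longrightarrow> sqint (f i)) \<Longrightarrow> sqint (\<lambda>t. \<Sum>i\<in>I. f i t)"
  by (induction I rule: infinite_finite_induct) (auto intro: sqint_zero sqint_add)

lemma antideriv:
  fixes g :: "real \<Rightarrow> real"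
  assumes "continuous_on {b..} g" "b < t"
  shows "((\<lambda>t. integral {b..t} g) has_real_derivative g t) (at t)"
proof -
  have "((\<lambda>t. integral {b..t} g) has_real_derivative g t) (at t within {b..t+1})"
    by (rule integral_has_real_derivative[OF continuous_on_subset[OF assms(1)]]) (use assms in auto)
  then show ?thesis using at_within_Icc_at[of b t "t+1"] assms by simp
qed

lemma mono_on_by_deriv:
  fixes F :: "real \<Rightarrow> real"
  assumes "p \<le> q" "\<And>t. p \<le> t \<Longrightarrow> t \<le> q \<Longrightarrow> \<exists>d\<ge>0. (F has_real_derivative d) (at t)"
  shows "F p \<le> F q"
  by (rule DERIV_nonneg_imp_nondecreasing[OF assms(1)]) (use assms(2) in blast)

lemma square_integral_mono:
  fixes f :: "real \<Rightarrow> real"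
  assumes "continuous_on {b..} f" "p \<le> q"
  shows "integral {b..p} (\<lambda>u. (f u)\<^sup>2) \<le> integral {b..q} (\<lambda>u. (f u)\<^sup>2)"
  using assms(2) by (intro integral_subset_le continuous_square_integrable[OF assms(1)]) auto

lemma sqint_shift:
  assumes "sqint f"
  shows "sqint (\<lambda>t. f (t - d))"
proof -
  obtain t0 B where c: "continuous_on {t0..} f"
    and B: "\<And>t. integral {t0..t} (\<lambda>u. (f u)\<^sup>2) \<le> B"
    using sqintE[OF assms] by (metis order_refl)
  show ?thesis
  proof (rule sqintI[of "t0 + d" _ B])
    show "continuous_on {t0 + d..} (\<lambda>t. f (t - d))"
      by (rule continuous_on_compose2[OF c]) (auto intro!: continuous_intros)
    fix t assume t: "t0 + d \<le> t"
    have "((\<lambda>u. (f u)\<^sup>2) has_integral integral {t0..t-d} (\<lambda>u. (f u)\<^sup>2)) {t0..t-d}"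
      using continuous_square_integrable[OF c order_refl] by blast
    from has_integral_affinity[OF this[unfolded box_real[symmetric]], of 1 "-d"]
    have "((\<lambda>u. (f (u - d))\<^sup>2) has_integral integral {t0..t-d} (\<lambda>u. (f u)\<^sup>2)) ((\<lambda>x. x + d) ` {t0..t-d})"
      by simp
    also have "(\<lambda>x. x + d) ` {t0..t-d} = {t0+d..t}" by simp
    finally have "integral {t0+d..t} (\<lambda>u. (f (u - d))\<^sup>2) = integral {t0..t-d} (\<lambda>u. (f u)\<^sup>2)"
      by (rule integral_unique)
    then show "integral {t0+d..t} (\<lambda>u. (f (u - d))\<^sup>2) \<le> B" using B by simp
  qed
qed

text \<open>A Barbalat-type argument: \<open>H - v\<^sup>2\<close> has derivative
  \<open>(v - g)\<^sup>2\<close>, so \<open>v\<^sup>2\<close> can grow by no more than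
  \<open>H\<close> does, and the bounded increasing \<open>H\<close> eventually hardly grows. It
  then suffices that \<open>v\<close> is small once, which the mean value theorem provides.\<close>

lemma sqint_deriv_tendsto_0:
  assumes v: "sqint v" and g: "sqint g"
    and d: "\<And>t. t > t1 \<Longrightarrow> (v has_real_derivative g t) (at t)"
  shows "(v \<longlongrightarrow> 0) at_top"
proof -
  obtain t0 B where v': "\<And>t1. t0 \<le> t1 \<Longrightarrow> continuous_on {t1..} v"
    "\<And>t1 t. t0 \<le> t1 \<Longrightarrow> integral {t1..t} (\<lambda>u. (v u)\<^sup>2) \<le> B"
    using sqintE[OF v] by metis
  obtain t2 D where g': "\<And>t1. t2 \<le> t1 \<Longrightarrow> continuous_on {t1..} g"
    "\<And>t1 t. t2 \<le> t1 \<Longrightarrow> integral {t1..t} (\<lambda>u. (g u)\<^sup>2) \<le> D"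
    using sqintE[OF g] by metis
  define m where "m = max t0 (max t1 t2)"
  have m: "t0 \<le> m" "t1 \<le> m" "t2 \<le> m" by (auto simp: m_def)
  note cv = v'(1)[OF m(1)] and cg = g'(1)[OF m(3)]
  define Q where "Q t = integral {m..t} (\<lambda>u. (v u)\<^sup>2)" for t
  define G where "G t = integral {m..t} (\<lambda>u. (g u)\<^sup>2)" for t
  have dQ: "(Q has_real_derivative (v t)\<^sup>2) (at t)" if "m < t" for t
    unfolding Q_def by (rule antideriv) (use cv that in \<open>auto intro!: continuous_intros\<close>)
  have dG: "(G has_real_derivative (g t)\<^sup>2) (at t)" if "m < t" for t
    unfolding G_def by (rule antideriv) (use cg that in \<open>auto intro!: continuous_intros\<close>)
  define H where "H t = Q t + G t" for t
  define s where "s = Sup (H ` {m..})"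
  have bdd: "bdd_above (H ` {m..})"
    by (rule bdd_aboveI[of _ "B + D"]) (use v'(2)[OF m(1)] g'(2)[OF m(3)] in \<open>auto simp: H_def Q_def G_def intro: add_mono\<close>)
  have Gmono: "G p \<le> G q" if "p \<le> q" for p q
    unfolding G_def by (rule square_integral_mono[OF cg that])
  have Qmono: "Q p \<le> Q q" if "p \<le> q" for p q
    unfolding Q_def by (rule square_integral_mono[OF cv that])
  show ?thesis
  proof (rule tendstoI)
    fix e :: real assume e: "e > 0"
    \<comment> \<open>The estimate below ends with \<open>2 * r\<close>, which is half of
      \<open>e\<^sup>2\<close>.\<close>
    define r where "r = e\<^sup>2 / 4"
    have r: "r > 0" using e by (simp add: r_def)
    obtain p where p: "p \<ge> m" "H p > s - r"
    proof -
      have "\<exists>y\<in>H ` {m..}. s - r < y"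
        unfolding s_def by (rule less_cSupE[of "Sup (H ` {m..}) - r" "H ` {m..}"]) (use r in auto)
      then show ?thesis using that by auto
    qed
    have Hle: "H t - H p \<le> r" if "t \<ge> m" for t
    proof -
      have "H t \<le> s" unfolding s_def by (rule cSup_upper[OF _ bdd]) (use that in auto)
      then show ?thesis using p by linarith
    qed
    \<comment> \<open>One unit beyond \<open>p\<close>, because \<open>p\<close> may equal
      \<open>m\<close>, where \<open>Q\<close> is not known to be differentiable.\<close>
    define q where "q = p + 1"
    have "\<exists>z>q. z < q + 1 \<and> Q (q+1) - Q q = (q + 1 - q) * (v z)\<^sup>2"
      by (rule MVT2) (use dQ p in \<open>auto simp: q_def\<close>)
    then obtain z where z: "z > q" "z < q + 1" "Q (q+1) - Q q = (v z)\<^sup>2" by auto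
    have vz: "(v z)\<^sup>2 \<le> r"
      using z Hle[of "q+1"] Qmono[of p q] Gmono[of p "q+1"] p by (auto simp: H_def q_def)
    have "(v t)\<^sup>2 \<le> 2 * r" if "t \<ge> q + 1" for t
    proof -
      have "H z - (v z)\<^sup>2 \<le> H t - (v t)\<^sup>2"
      proof (rule mono_on_by_deriv[where F = "\<lambda>t. H t - (v t)\<^sup>2"])
        show "z \<le> t" using z that by simp
        fix u assume u: "z \<le> u" "u \<le> t"
        then have um: "u > m" using z p by (simp add: q_def)
        have "((\<lambda>t. H t - (v t)\<^sup>2) has_real_derivative ((v u)\<^sup>2 + (g u)\<^sup>2 - 2 * v u * g u)) (at u)"
          unfolding H_def using um m
          by (auto intro!: derivative_eq_intros dQ dG d)
        moreover have "(v u)\<^sup>2 + (g u)\<^sup>2 - 2 * v u * g u = (v u - g u)\<^sup>2"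
          by (simp add: power2_eq_square algebra_simps)
        ultimately show "\<exists>d\<ge>0. ((\<lambda>t. H t - (v t)\<^sup>2) has_real_derivative d) (at u)" by (metis zero_le_power2)
      qed
      moreover have "H p \<le> H z" using Qmono[of p z] Gmono[of p z] z by (simp add: H_def q_def)
      moreover have "H t - H p \<le> r" using that p by (intro Hle) (auto simp: q_def)
      ultimately show ?thesis using vz by linarith
    qed
    then have "\<bar>v t\<bar> < e" if "t \<ge> q + 1" for t
    proof -
      have "(v t)\<^sup>2 < e\<^sup>2" using \<open>\<And>t. q + 1 \<le> t \<Longrightarrow> (v t)\<^sup>2 \<le> 2 * r\<close>[OF that] zero_less_power[OF e, of 2]
        unfolding r_def by linarith
      then show ?thesis using e by (metis abs_le_square_iff abs_of_pos not_le)
    qed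
    then show "\<forall>\<^sub>F t in at_top. dist (v t) 0 < e"
      unfolding eventually_at_top_linorder by (auto simp: dist_real_def)
  qed
qed

section \<open>Tools for integrals over moving windows\<close>

lemma continuous_on_interval_halfline:
  fixes g :: "real \<Rightarrow> real"
  assumes "\<And>r. continuous_on {b..r} g"
  shows "continuous_on {b..} g"
  unfolding continuous_on_eq_continuous_within
proof
  fix t assume t: "t \<in> {b..}"
  have "at t within {b..} = at t within {b..t+1}"
    by (rule at_within_nhd[of _ "{..<t+1}"]) (use t in auto)
  then show "continuous (at t within {b..}) g"
    using assms[of "t+1"] t by (auto simp: continuous_on_eq_continuous_within)
qed

lemma integral_from_continuous:
  fixes g :: "real \<Rightarrow> real"
  assumes "continuous_on {b..} g"
  shows "continuous_on {b..} (\<lambda>t. integral {b..t} g)"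
proof (rule continuous_on_interval_halfline)
  fix r
  show "continuous_on {b..r} (\<lambda>t. integral {b..t} g)"
    by (intro indefinite_integral_continuous_1 integrable_continuous_interval
        continuous_on_subset[OF assms]) auto
qed

text \<open>Cauchy-Schwarz for window integrals given by antiderivatives: with \<open>m\<close> the
  mean slope, the integral of \<open>(h - m)\<^sup>2\<close> is nonnegative.\<close>

lemma increment_square_le:
  fixes F Q :: "real \<Rightarrow> real"
  assumes pq: "p \<le> q"
    and F: "\<And>t. p \<le> t \<Longrightarrow> t \<le> q \<Longrightarrow> (F has_real_derivative h t) (at t)"
    and Q: "\<And>t. p \<le> t \<Longrightarrow> t \<le> q \<Longrightarrow> (Q has_real_derivative w t) (at t)"
    and hw: "\<And>t. (h t)\<^sup>2 \<le> w t"
  shows "(F q - F p)\<^sup>2 \<le> (q - p) * (Q q - Q p)"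
proof (cases "p = q")
  case True
  then show ?thesis by simp
next
  case False
  define m where "m = (F q - F p) / (q - p)"
  have "Q p - 2 * m * F p + m\<^sup>2 * p \<le> Q q - 2 * m * F q + m\<^sup>2 * q"
  proof (rule mono_on_by_deriv[where F = "\<lambda>t. Q t - 2 * m * F t + m\<^sup>2 * t", OF pq])
    fix t assume t: "p \<le> t" "t \<le> q"
    have "((\<lambda>t. Q t - 2 * m * F t + m\<^sup>2 * t) has_real_derivative (w t - 2 * m * h t + m\<^sup>2)) (at t)"
      using t by (auto intro!: derivative_eq_intros F Q)
    moreover have "w t - 2 * m * h t + m\<^sup>2 \<ge> 0"
      using hw[of t] zero_le_power2[of "h t - m"] by (simp add: power2_eq_square algebra_simps)
    ultimately show "\<exists>d\<ge>0. ((\<lambda>t. Q t - 2 * m * F t + m\<^sup>2 * t) has_real_derivative d) (at t)" by blast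
  qed
  then have "2 * m * (F q - F p) \<le> (Q q - Q p) + m\<^sup>2 * (q - p)" by (simp add: algebra_simps)
  moreover have mF: "F q - F p = m * (q - p)" using False by (simp add: m_def)
  ultimately have "m\<^sup>2 * (q - p) \<le> Q q - Q p"
    by (simp add: power2_eq_square)
  then have "(q - p) * (m\<^sup>2 * (q - p)) \<le> (q - p) * (Q q - Q p)"
    using pq by (intro mult_left_mono) auto
  then show ?thesis unfolding mF by (simp add: power2_eq_square mult_ac)
qed

text \<open>Since \<open>E' = 2 cot(l v) S S'\<close>, integration by parts gives
  \<open>E = cot(l d) S\<^sup>2 + \<integral> l S\<^sup>2 / sin\<^sup>2\<close>, and both terms are nonnegative.\<close>
lemma delay_form_nonneg:
  fixes S E z :: "real \<Rightarrow> real"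
  assumes l: "l > 0" and d: "0 \<le> d" and ld: "l * d < pi / 2"
    and S0: "S 0 = 0" and E0: "E 0 = 0"
    and z: "continuous_on {0..d} z"
    and dS: "\<And>v. 0 \<le> v \<Longrightarrow> v \<le> d \<Longrightarrow> (S has_real_derivative sin (l * v) * z v) (at v)"
    and dE: "\<And>v. 0 \<le> v \<Longrightarrow> v \<le> d \<Longrightarrow> (E has_real_derivative 2 * cos (l * v) * z v * S v) (at v)"
  shows "E d \<ge> 0"
proof (cases "d = 0")
  case True
  then show ?thesis using E0 by simp
next
  case False
  then have d0: "d > 0" using d by simp
  have lv: "0 < l * v \<and> l * v < pi / 2" if "0 < v" "v \<le> d" for v
    using that l ld mult_left_mono[of v d l] mult_pos_pos[of l v] by linarith
  have sc: "sin (l * v) > 0 \<and> cos (l * v) > 0" if "0 < v" "v \<le> d" for v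
    using lv[OF that] by (auto intro!: sin_gt_zero cos_gt_zero)
  obtain K where K: "\<And>v. 0 \<le> v \<Longrightarrow> v \<le> d \<Longrightarrow> \<bar>z v\<bar> \<le> K"
    using compact_imp_bounded[OF compact_continuous_image[OF z compact_Icc]]
    by (auto simp: bounded_iff) (metis atLeastAtMost_iff)
  have K0: "K \<ge> 0" using K[of 0] d by simp
  \<comment> \<open>\<open>E\<close> minus the boundary term of the integration by parts; it plays
    the role of the remaining integral and is nondecreasing.\<close>
  define H where "H v = E v - cos (l * v) / sin (l * v) * (S v)\<^sup>2" for v
  \<comment> \<open>The cotangent is singular at 0; the factor \<open>sin (l * v)\<close> in this
    bound for \<open>S\<close> compensates it.\<close>
  have Sb: "\<bar>S v\<bar> \<le> K * v * sin (l * v)" if v: "0 < v" "v \<le> d" for v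
  proof -
    have "\<exists>x>0. x < v \<and> S v - S 0 = (v - 0) * (sin (l * x) * z x)"
      by (rule MVT2) (use v dS in auto)
    then obtain x where x: "0 < x" "x < v" "S v = v * (sin (l * x) * z x)" using S0 by auto
    have "\<bar>S v\<bar> = v * (sin (l * x) * \<bar>z x\<bar>)" using x v sc[of x] by (simp add: abs_mult)
    also have "\<dots> \<le> v * (sin (l * v) * K)"
    proof (intro mult_left_mono mult_mono)
      have "l * x \<le> l * v" using x l by simp
      then show "sin (l * x) \<le> sin (l * v)"
        using lv[of v] lv[of x] x v pi_gt_zero by (intro sin_monotone_2pi_le) linarith+
    qed (use K[of x] x v sc[of v] K0 in auto)
    finally show ?thesis by (simp add: algebra_simps)
  qed
  have HE: "H v \<ge> E v - K\<^sup>2 * v\<^sup>2" if v: "0 < v" "v \<le> d" for v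
  proof -
    let ?s = "sin (l * v)" and ?c = "cos (l * v)"
    have "(S v)\<^sup>2 \<le> (K * v * ?s)\<^sup>2"
      using Sb[OF v] by (intro abs_le_square_iff[THEN iffD1]) simp
    then have "?c / ?s * (S v)\<^sup>2 \<le> ?c / ?s * (K * v * ?s)\<^sup>2"
      using sc[OF v] by (intro mult_left_mono) auto
    also have "\<dots> = (K\<^sup>2 * v\<^sup>2) * (?c * ?s)"
      using sc[OF v] by (simp add: power2_eq_square field_simps)
    also have "\<dots> \<le> (K\<^sup>2 * v\<^sup>2) * 1"
      using sc[OF v] by (intro mult_left_mono mult_le_one) auto
    finally show ?thesis by (simp add: H_def)
  qed
  have Hmono: "H v \<le> H d" if v: "0 < v" "v \<le> d" for v
  proof (rule mono_on_by_deriv[OF v(2)])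
    fix u assume u: "v \<le> u" "u \<le> d"
    let ?s = "sin (l * u)" and ?c = "cos (l * u)"
    have s: "?s > 0" using sc[of u] u v by auto
    have "(H has_real_derivative 2 * ?c * z u * S u
       - ((- l * ?s * ?s - ?c * (l * ?c)) / ?s\<^sup>2 * (S u)\<^sup>2 + ?c / ?s * (2 * S u * (?s * z u)))) (at u)"
      unfolding H_def[abs_def] using s u v
      by (auto intro!: derivative_eq_intros dS dE simp: power2_eq_square) (simp add: field_simps)
    moreover have "2 * ?c * z u * S u
       - ((- l * ?s * ?s - ?c * (l * ?c)) / ?s\<^sup>2 * (S u)\<^sup>2 + ?c / ?s * (2 * S u * (?s * z u)))
       = l * (S u)\<^sup>2 / ?s\<^sup>2 * (?s * ?s + ?c * ?c)"
      using s by (simp add: field_simps power2_eq_square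
          del: sin_cos_squared_add sin_cos_squared_add2 sin_cos_squared_add3)
    ultimately show "\<exists>d\<ge>0. (H has_real_derivative d) (at u)"
      using l by (metis (no_types, lifting) sin_cos_squared_add3 mult.right_neutral add.commute
          divide_nonneg_nonneg mult_nonneg_nonneg zero_le_power2 less_imp_le)
  qed
  \<comment> \<open>The representation breaks down at \<open>v = 0\<close>; instead the lower bound
    of \<open>H v\<close> is followed to its limit from the right.\<close>
  have "((\<lambda>v. E v - K\<^sup>2 * v\<^sup>2) \<longlongrightarrow> E 0 - K\<^sup>2 * 0\<^sup>2) (at_right 0)"
    using DERIV_isCont[OF dE[OF order_refl d]] unfolding isCont_def
    by (intro tendsto_intros) (auto intro: tendsto_within_subset)
  then have "((\<lambda>v. E v - K\<^sup>2 * v\<^sup>2) \<longlongrightarrow> 0) (at_right 0)" using E0 by simp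
  moreover have "\<forall>\<^sub>F v in at_right 0. E v - K\<^sup>2 * v\<^sup>2 \<le> H d"
    using eventually_at_right_real[OF d0]
  proof eventually_elim
    case (elim v)
    then show ?case using HE[of v] Hmono[of v] by force
  qed
  ultimately have "0 \<le> H d" by (intro tendsto_upperbound) auto
  also have "H d \<le> E d" using sc[of d] d0 by (simp add: H_def)
  finally show ?thesis .
qed

text \<open>The Lyapunov functional is
  \<open>V = (1 + sin \<kappa>) ((z - l C)\<^sup>2 + l\<^sup>2 S\<^sup>2) + 2 l cos \<kappa> (z S - l J)\<close> with \<open>\<kappa> = l d\<close>, where
  \<open>C\<close>, \<open>S\<close> are the integrals of \<open>cos (l (u - (t - d))) z u\<close>, \<open>sin (l (u - (t - d))) z u\<close> over the
  window \<open>[t - d, t]\<close> and \<open>J\<close> is the integral of \<open>sin (l (v - u)) z u z v\<close> over \<open>u < v\<close> in it.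
  Along solutions \<open>V' = - 2 l cos \<kappa> z\<^sup>2 + 2 f W\<close> with \<open>W\<close> linear in \<open>z\<close>, \<open>C\<close>, \<open>S\<close>.\<close>
lemma delay_equation_sqint:
  fixes z f :: "real \<Rightarrow> real"
  assumes l: "l > 0" and d: "0 \<le> d" and ld: "l * d < pi / 2"
    and cz0: "continuous_on {b0..} z"
    and dz0: "\<And>t. t > b0 + d \<Longrightarrow> (z has_real_derivative - l * z (t - d) + f t) (at t)"
    and f: "sqint f"
  shows "sqint z"
proof -
  obtain tf B where f': "\<And>t1. tf \<le> t1 \<Longrightarrow> continuous_on {t1..} f"
    "\<And>t1 t. tf \<le> t1 \<Longrightarrow> integral {t1..t} (\<lambda>u. (f u)\<^sup>2) \<le> B"
    using sqintE[OF f] by metis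
  define b where "b = max b0 tf"
  have b: "b0 \<le> b" "tf \<le> b" by (auto simp: b_def)
  note cf = f'(1)[OF b(2)] and fB = f'(2)[OF b(2)]
  have cz: "continuous_on {b..} z" by (rule continuous_on_subset[OF cz0]) (use b in auto)
  have dz: "(z has_real_derivative - l * z (t - d) + f t) (at t)" if "t > b + d" for t
    using dz0[of t] that b by simp
  define kp where "kp = l * d"
  \<comment> \<open>Antiderivatives from a fixed base point: integrals over the moving window become
    differences of them, so only ordinary derivatives occur.\<close>
  define c where "c t = integral {b..t} (\<lambda>u. cos (l * u) * z u)" for t
  define s where "s t = integral {b..t} (\<lambda>u. sin (l * u) * z u)" for t
  have dc: "(c has_real_derivative cos (l * t) * z t) (at t)" if "b < t" for t
    unfolding c_def by (rule antideriv) (use cz that in \<open>auto intro!: continuous_intros\<close>)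
  have ds: "(s has_real_derivative sin (l * t) * z t) (at t)" if "b < t" for t
    unfolding s_def by (rule antideriv) (use cz that in \<open>auto intro!: continuous_intros\<close>)
  have cc: "continuous_on {b..} c"
    unfolding c_def by (rule integral_from_continuous) (intro continuous_intros cz)
  have cs: "continuous_on {b..} s"
    unfolding s_def by (rule integral_from_continuous) (intro continuous_intros cz)
  \<comment> \<open>The inner integral of \<open>J\<close> with \<open>sin (l * (v - u))\<close>
    expanded.\<close>
  define q where "q t = integral {b..t} (\<lambda>u. z u * (sin (l * u) * c u - cos (l * u) * s u))" for t
  have dq: "(q has_real_derivative z t * (sin (l * t) * c t - cos (l * t) * s t)) (at t)" if "b < t" for t
    unfolding q_def by (rule antideriv) (use cz cc cs that in \<open>auto intro!: continuous_intros\<close>)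
  define Q where "Q t = integral {b..t} (\<lambda>u. (z u)\<^sup>2)" for t
  have dQ: "(Q has_real_derivative (z t)\<^sup>2) (at t)" if "b < t" for t
    unfolding Q_def by (rule antideriv) (use cz that in \<open>auto intro!: continuous_intros\<close>)
  have cQ: "continuous_on {b..} Q"
    unfolding Q_def by (rule integral_from_continuous) (intro continuous_intros cz)
  have Qmono: "Q p \<le> Q t" if "p \<le> t" for p t
    unfolding Q_def by (rule square_integral_mono[OF cz that])
  \<comment> \<open>\<open>R t - R (t - d)\<close> grows at the rate \<open>Q t - Q (t - d)\<close>,
    the energy in the window; it pays for the terms in \<open>C\<close> and
    \<open>S\<close>.\<close>
  define R where "R t = integral {b..t} Q" for t
  have dR: "(R has_real_derivative Q t) (at t)" if "b < t" for t
    unfolding R_def by (rule antideriv[OF cQ that])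
  define F where "F t = integral {b..t} (\<lambda>u. (f u)\<^sup>2)" for t
  have dF: "(F has_real_derivative (f t)\<^sup>2) (at t)" if "b < t" for t
    unfolding F_def by (rule antideriv) (use cf that in \<open>auto intro!: continuous_intros\<close>)

  \<comment> \<open>The addition formulas shift the phase from the origin to \<open>p\<close>. In
    \<open>Jw\<close> the last two terms remove the pairs whose earlier point lies before
    \<open>p\<close>.\<close>
  define Cw where "Cw p t = cos (l * p) * (c t - c p) + sin (l * p) * (s t - s p)" for p t
  define Sw where "Sw p t = cos (l * p) * (s t - s p) - sin (l * p) * (c t - c p)" for p t
  define Jw where "Jw p t = q t - q p - c p * (s t - s p) + s p * (c t - c p)" for p t
  have dCw: "(Cw p has_real_derivative cos (l * (t - p)) * z t) (at t)" if "b < t" for p t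
    unfolding Cw_def[abs_def] right_diff_distrib cos_diff
    by (rule derivative_eq_intros dc ds that refl)+ (simp add: algebra_simps)
  have dSw: "(Sw p has_real_derivative sin (l * (t - p)) * z t) (at t)" if "b < t" for p t
    unfolding Sw_def[abs_def] right_diff_distrib sin_diff
    by (rule derivative_eq_intros dc ds that refl)+ (simp add: algebra_simps)
  have sinp: "sin (l * t) = sin (l * (t - p)) * cos (l * p) + cos (l * (t - p)) * sin (l * p)" for t p
    using sin_add[of "l * (t - p)" "l * p"] by (simp add: algebra_simps)
  have cosp: "cos (l * t) = cos (l * (t - p)) * cos (l * p) - sin (l * (t - p)) * sin (l * p)" for t p
    using cos_add[of "l * (t - p)" "l * p"] by (simp add: algebra_simps)
  have Jalg: "sin (l * t) * (c t - c p) - cos (l * t) * (s t - s p)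
    = sin (l * (t - p)) * Cw p t - cos (l * (t - p)) * Sw p t" for p t
    unfolding sinp[of t p] cosp[of t p] Cw_def Sw_def by (simp add: algebra_simps)
  have dJw: "(Jw p has_real_derivative
      z t * (sin (l * (t - p)) * Cw p t - cos (l * (t - p)) * Sw p t)) (at t)" if "b < t" for p t
    unfolding Jw_def[abs_def] Jalg[symmetric]
    by (rule derivative_eq_intros dc ds dq that refl)+ (simp add: algebra_simps)

  define C where "C t = Cw (t - d) t" for t
  define S where "S t = Sw (t - d) t" for t
  define J where "J t = Jw (t - d) t" for t
  have trig: "cos (l * t) = cos (l * (t - d)) * cos kp - sin (l * (t - d)) * sin kp"
    "sin (l * t) = sin (l * (t - d)) * cos kp + cos (l * (t - d)) * sin kp" for t
    using cos_add[of "l * (t - d)" kp] sin_add[of "l * (t - d)" kp]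
    by (simp_all add: kp_def algebra_simps)
  have pyth: "cos x * cos x = 1 - sin x * sin x" for x :: real
    using sin_cos_squared_add3[of x] by linarith
  have pyth': "cos x * (cos x * y) = y - sin x * (sin x * y)" for x y :: real
    using pyth[of x] by (simp add: mult.assoc[symmetric] left_diff_distrib)
  have shiftd: "((\<lambda>t. t - d) has_real_derivative 1) (at t)" for t
    by (auto intro!: derivative_eq_intros)
  have dcd: "((\<lambda>t. c (t - d)) has_real_derivative cos (l * (t - d)) * z (t - d)) (at t)" if "b + d < t" for t
    using DERIV_chain2[OF dc shiftd, of t] that by simp
  have dsd: "((\<lambda>t. s (t - d)) has_real_derivative sin (l * (t - d)) * z (t - d)) (at t)" if "b + d < t" for t
    using DERIV_chain2[OF ds shiftd, of t] that by simp
  have dqd: "((\<lambda>t. q (t - d)) has_real_derivative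
      z (t - d) * (sin (l * (t - d)) * c (t - d) - cos (l * (t - d)) * s (t - d))) (at t)" if "b + d < t" for t
    using DERIV_chain2[OF dq shiftd, of t] that by simp
  have bt: "b < t" if "b + d < t" for t using that d by simp
  have dC: "(C has_real_derivative l * S t + cos kp * z t - z (t - d)) (at t)" if t: "b + d < t" for t
    unfolding C_def[abs_def] Cw_def S_def Sw_def
    by (rule derivative_eq_intros dc ds dcd dsd t bt refl)+
       (simp add: trig[of t], simp add: algebra_simps pyth)
  have dS: "(S has_real_derivative sin kp * z t - l * C t) (at t)" if t: "b + d < t" for t
    unfolding S_def[abs_def] Cw_def C_def Sw_def
    by (rule derivative_eq_intros dc ds dcd dsd t bt refl)+
       (simp add: trig[of t], simp add: algebra_simps pyth)
  have dJ: "(J has_real_derivative z t * (sin kp * C t - cos kp * S t) - z (t - d) * S t) (at t)"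
    if t: "b + d < t" for t
    unfolding J_def[abs_def] Jw_def C_def Cw_def S_def Sw_def
    by (rule derivative_eq_intros dc ds dcd dsd dq dqd t bt refl)+
       (simp add: trig[of t], simp add: algebra_simps pyth)

  \<comment> \<open>The delayed value cancels in the derivative of \<open>z - l * C\<close> and in
    that of \<open>z * S - l * J\<close>. The weights \<open>1 + sin kp\<close> and
    \<open>cos kp\<close> make the mixed terms \<open>z * C\<close> and \<open>z * S\<close> cancel,
    the latter by \<open>(1 + sin kp) * (1 - sin kp) = (cos kp)\<^sup>2\<close>.\<close>
  define V where "V t = (1 + sin kp) * ((z t - l * C t)\<^sup>2 + l\<^sup>2 * (S t)\<^sup>2)
    + 2 * l * cos kp * (z t * S t - l * J t)" for t
  define W where "W t = (1 + sin kp) * (z t - l * C t) + l * cos kp * S t" for t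
  have kp: "0 \<le> kp" "kp < pi / 2" using l d ld by (auto simp: kp_def)
  have sk: "0 \<le> sin kp" "sin kp \<le> 1" and ck: "0 < cos kp" "cos kp \<le> 1"
    using kp by (auto intro!: sin_ge_zero cos_gt_zero_pi)
  have dV: "(V has_real_derivative - 2 * l * cos kp * (z t)\<^sup>2 + 2 * f t * W t) (at t)"
    if t: "b + d < t" for t
    unfolding V_def[abs_def] W_def
    by (rule derivative_eq_intros dz dC dS dJ t refl)+
       (simp add: power2_eq_square algebra_simps pyth pyth')

  have V_nonneg: "V t \<ge> 0" if t: "b + d < t" for t
  proof -
    define p where "p = t - d"
    have p: "b < p" using t by (simp add: p_def)
    \<comment> \<open>As a function of the window length \<open>v\<close>, \<open>C * S - J\<close>
      has derivative \<open>2 * cos (l * v) * z * S\<close>, the form treated in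
      \<open>delay_form_nonneg\<close>.\<close>
    have "Cw p (p + d) * Sw p (p + d) - Jw p (p + d) \<ge> 0"
    proof (rule delay_form_nonneg[OF l d ld, of "\<lambda>v. Sw p (p + v)"
          "\<lambda>v. Cw p (p + v) * Sw p (p + v) - Jw p (p + v)" "\<lambda>v. z (p + v)"])
      show "continuous_on {0..d} (\<lambda>v. z (p + v))"
        by (rule continuous_on_compose2[OF cz]) (use p in \<open>auto intro!: continuous_intros\<close>)
      fix v assume v: "0 \<le> v" "v \<le> d"
      have sh: "((\<lambda>v. p + v) has_real_derivative 1) (at v)"
        by (auto intro!: derivative_eq_intros)
      have pv: "b < p + v" using p v by simp
      have 1: "((\<lambda>v. Sw p (p + v)) has_real_derivative sin (l * v) * z (p + v)) (at v)"
        using DERIV_chain2[OF dSw[OF pv, of p] sh] by simp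
      have 2: "((\<lambda>v. Cw p (p + v)) has_real_derivative cos (l * v) * z (p + v)) (at v)"
        using DERIV_chain2[OF dCw[OF pv, of p] sh] by simp
      have 3: "((\<lambda>v. Jw p (p + v)) has_real_derivative
          z (p + v) * (sin (l * v) * Cw p (p + v) - cos (l * v) * Sw p (p + v))) (at v)"
        using DERIV_chain2[OF dJw[OF pv, of p] sh] by simp
      show "((\<lambda>v. Sw p (p + v)) has_real_derivative sin (l * v) * z (p + v)) (at v)" by (rule 1)
      show "((\<lambda>v. Cw p (p + v) * Sw p (p + v) - Jw p (p + v)) has_real_derivative
          2 * cos (l * v) * z (p + v) * Sw p (p + v)) (at v)"
        by (rule derivative_eq_intros 1 2 3 refl)+ (simp add: algebra_simps)
    qed (simp_all add: Sw_def Cw_def Jw_def)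
    then have E: "C t * S t - J t \<ge> 0" by (simp add: C_def S_def J_def p_def)
    let ?Y = "z t - l * C t"
    have "V t = (1 + sin kp) * (?Y\<^sup>2 + l\<^sup>2 * (S t)\<^sup>2) + 2 * l * cos kp * ?Y * S t
      + 2 * l\<^sup>2 * cos kp * (C t * S t - J t)"
      unfolding V_def by (simp add: power2_eq_square algebra_simps)
    moreover have "2 * l\<^sup>2 * cos kp * (C t * S t - J t) \<ge> 0"
      using E ck by simp
    moreover have "(1 + sin kp) * (?Y\<^sup>2 + l\<^sup>2 * (S t)\<^sup>2) + 2 * l * cos kp * ?Y * S t
      = (1 + sin kp - cos kp) * (?Y\<^sup>2 + l\<^sup>2 * (S t)\<^sup>2) + cos kp * (?Y + l * S t)\<^sup>2"
      by (simp add: power2_eq_square algebra_simps)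
    moreover have "1 + sin kp - cos kp \<ge> 0" using sk(1) ck(2) by linarith
    then have "(1 + sin kp - cos kp) * (?Y\<^sup>2 + l\<^sup>2 * (S t)\<^sup>2) + cos kp * (?Y + l * S t)\<^sup>2 \<ge> 0"
      using ck(1) by (intro add_nonneg_nonneg mult_nonneg_nonneg zero_le_power2) auto
    ultimately show ?thesis by linarith
  qed

  have win: "(C t)\<^sup>2 \<le> d * (Q t - Q (t - d))" "(S t)\<^sup>2 \<le> d * (Q t - Q (t - d))" if t: "b + d < t" for t
  proof -
    have le: "(cos x * z u)\<^sup>2 \<le> (z u)\<^sup>2" "(sin x * z u)\<^sup>2 \<le> (z u)\<^sup>2" for x u
      by (simp_all add: power_mult_distrib mult_left_le_one_le power_le_one_iff abs_square_le_1)
    have "(Cw (t - d) t - Cw (t - d) (t - d))\<^sup>2 \<le> (t - (t - d)) * (Q t - Q (t - d))"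
      by (rule increment_square_le[where h = "\<lambda>u. cos (l * (u - (t - d))) * z u" and w = "\<lambda>u. (z u)\<^sup>2"])
         (use t d in \<open>auto intro!: dCw dQ le\<close>)
    then show "(C t)\<^sup>2 \<le> d * (Q t - Q (t - d))" by (simp add: C_def Cw_def)
    have "(Sw (t - d) t - Sw (t - d) (t - d))\<^sup>2 \<le> (t - (t - d)) * (Q t - Q (t - d))"
      by (rule increment_square_le[where h = "\<lambda>u. sin (l * (u - (t - d))) * z u" and w = "\<lambda>u. (z u)\<^sup>2"])
         (use t d in \<open>auto intro!: dSw dQ le\<close>)
    then show "(S t)\<^sup>2 \<le> d * (Q t - Q (t - d))" by (simp add: S_def Sw_def)
  qed
  \<comment> \<open>Splitting \<open>W\<close> into three squares costs a factor 3. With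
    \<open>(1 + sin kp)\<^sup>2 \<le> 4\<close> this gives 12 for \<open>z\<close>, and 12 for
    \<open>C\<close> plus 3 for \<open>S\<close> over the window.\<close>
  define K where "K = 12 + 15 * l\<^sup>2 * d"
  have K: "K > 0" using d by (simp add: K_def add_pos_nonneg)
  have W_le: "(W t)\<^sup>2 \<le> K * ((z t)\<^sup>2 + (Q t - Q (t - d)))" if t: "b + d < t" for t
  proof -
    have sq3: "(x + y + w)\<^sup>2 \<le> 3 * x\<^sup>2 + 3 * y\<^sup>2 + 3 * w\<^sup>2" for x y w :: real
      using zero_le_power2[of "x - y"] zero_le_power2[of "y - w"] zero_le_power2[of "x - w"]
      by (simp add: power2_eq_square algebra_simps)
    have m: "x * y \<le> e * y" if "x \<le> e" "0 \<le> y" for x y e :: real using that by (rule mult_right_mono)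
    have s4: "(1 + sin kp)\<^sup>2 \<le> 4" using power_mono[of "1 + sin kp" 2 2] sk by simp
    have c1: "(cos kp)\<^sup>2 \<le> 1" using ck by (simp add: power_le_one)
    have "W t = (1 + sin kp) * z t + (- ((1 + sin kp) * (l * C t))) + l * cos kp * S t"
      by (simp add: W_def algebra_simps)
    then have "(W t)\<^sup>2 \<le> 3 * ((1 + sin kp) * z t)\<^sup>2 + 3 * (- ((1 + sin kp) * (l * C t)))\<^sup>2
        + 3 * (l * cos kp * S t)\<^sup>2"
      using sq3 by metis
    also have "\<dots> = 3 * ((1 + sin kp)\<^sup>2 * (z t)\<^sup>2) + 3 * ((1 + sin kp)\<^sup>2 * (l\<^sup>2 * (C t)\<^sup>2))
        + 3 * ((cos kp)\<^sup>2 * (l\<^sup>2 * (S t)\<^sup>2))"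
      by (simp add: power_mult_distrib)
    also have "\<dots> \<le> 3 * (4 * (z t)\<^sup>2) + 3 * (4 * (l\<^sup>2 * (C t)\<^sup>2)) + 3 * (1 * (l\<^sup>2 * (S t)\<^sup>2))"
      using m[OF s4, of "(z t)\<^sup>2"] m[OF s4, of "l\<^sup>2 * (C t)\<^sup>2"] m[OF c1, of "l\<^sup>2 * (S t)\<^sup>2"] by simp
    also have "\<dots> \<le> 12 * (z t)\<^sup>2 + 12 * (l\<^sup>2 * (d * (Q t - Q (t - d)))) + 3 * (l\<^sup>2 * (d * (Q t - Q (t - d))))"
      using mult_left_mono[OF win(1)[OF t] zero_le_power2[of l]]
        mult_left_mono[OF win(2)[OF t] zero_le_power2[of l]] by linarith
    also have "\<dots> = 12 * (z t)\<^sup>2 + 15 * l\<^sup>2 * d * (Q t - Q (t - d))" by (simp add: algebra_simps)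
    also have "\<dots> \<le> K * (z t)\<^sup>2 + K * (Q t - Q (t - d))"
      using d Qmono[of "t - d" t] by (intro add_mono mult_right_mono) (auto simp: K_def)
    finally show ?thesis by (simp add: algebra_simps)
  qed

  define dl where "dl = l * cos kp"
  have dl: "dl > 0" using l ck by (simp add: dl_def)
  \<comment> \<open>By Young's inequality the forcing costs
    \<open>e * W\<^sup>2 + f\<^sup>2 / e\<close>. Over time the first term amounts to at most
    \<open>e * K * (1 + d)\<close> times \<open>Q\<close>; this \<open>e\<close> makes that one half
    of the dissipation rate \<open>2 * dl\<close>.\<close>
  define e where "e = dl / (K * (1 + d))"
  have e: "e > 0" using dl K d by (simp add: e_def)
  have eK: "e * K * (1 + d) = dl" using K d by (simp add: e_def)
  \<comment> \<open>Nonincreasing along solutions: \<open>V\<close> together with the accumulated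
    dissipation, less the accumulated costs.\<close>
  define U where "U t = V t - e * K * (R t - R (t - d)) - F t / e + (2 * dl - e * K) * Q t" for t
  define t2 where "t2 = b + d + 1"
  have Umono: "- U t2 \<le> - U t" if t: "t2 \<le> t" for t
  proof (rule mono_on_by_deriv[OF t])
    fix u assume "t2 \<le> u" "u \<le> t"
    then have u: "b + d < u" by (simp add: t2_def)
    note bu = bt[OF u]
    have dRd: "((\<lambda>t. R (t - d)) has_real_derivative Q (u - d)) (at u)"
      using DERIV_chain2[OF dR shiftd, of u] u by simp
    have D: "((\<lambda>u. - U u) has_real_derivative
       - (- 2 * l * cos kp * (z u)\<^sup>2 + 2 * f u * W u - e * K * (Q u - Q (u - d)) - (f u)\<^sup>2 / e
         + (2 * dl - e * K) * (z u)\<^sup>2)) (at u)"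
      unfolding U_def[abs_def]
      by (intro DERIV_minus DERIV_add DERIV_diff DERIV_cmult DERIV_cdivide
          dV[OF u] dR[OF bu] dRd dF[OF bu] dQ[OF bu])
    have "2 * f u * W u \<le> e * (W u)\<^sup>2 + (f u)\<^sup>2 / e"
    proof -
      have "0 \<le> (e * W u - f u)\<^sup>2 / e" using e by simp
      also have "\<dots> = e * (W u)\<^sup>2 + (f u)\<^sup>2 / e - 2 * f u * W u"
        using e by (simp add: power2_eq_square field_simps)
      finally show ?thesis by simp
    qed
    moreover have "e * (W u)\<^sup>2 \<le> e * (K * ((z u)\<^sup>2 + (Q u - Q (u - d))))"
      using W_le[OF u] e by simp
    moreover have "e * (K * ((z u)\<^sup>2 + (Q u - Q (u - d)))) = e * K * (z u)\<^sup>2 + e * K * (Q u - Q (u - d))"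
      by (simp only: distrib_left mult.assoc)
    moreover have "(2 * dl - e * K) * (z u)\<^sup>2 = 2 * l * cos kp * (z u)\<^sup>2 - e * K * (z u)\<^sup>2"
      by (simp add: dl_def left_diff_distrib)
    ultimately have "0 \<le> - (- 2 * l * cos kp * (z u)\<^sup>2 + 2 * f u * W u - e * K * (Q u - Q (u - d)) - (f u)\<^sup>2 / e
         + (2 * dl - e * K) * (z u)\<^sup>2)"
      by linarith
    then show "\<exists>g\<ge>0. ((\<lambda>u. - U u) has_real_derivative g) (at u)"
      using D by blast
  qed
  have "Q t \<le> (U t2 + B / e) / dl" if t: "t2 \<le> t" for t
  proof -
    have tb: "b + d < t" using t by (simp add: t2_def)
    have Rle: "R t - R (t - d) \<le> d * Q t"
    proof (cases "d = 0")
      case False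
      then have d0: "d > 0" using d by simp
      have "\<exists>x>t - d. x < t \<and> R t - R (t - d) = (t - (t - d)) * Q x"
        by (rule MVT2) (use d0 tb dR in auto)
      then show ?thesis using d Qmono by (auto intro!: mult_left_mono)
    qed simp
    have "V t - e * K * (R t - R (t - d)) - F t / e + (2 * dl - e * K) * Q t \<le> U t2"
      using Umono[OF t] by (simp add: U_def)
    moreover have "e * K * (R t - R (t - d)) \<le> e * K * (d * Q t)"
      using Rle e K by (intro mult_left_mono) auto
    moreover have "F t / e \<le> B / e" using fB[of t] e by (simp add: F_def divide_right_mono)
    moreover have "e * K * (d * Q t) + e * K * Q t = dl * Q t"
      unfolding eK[symmetric] by (simp add: algebra_simps)
    ultimately have "dl * Q t \<le> U t2 + B / e"
      using V_nonneg[OF tb] by (simp add: left_diff_distrib)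
    then show ?thesis using dl by (simp add: field_simps)
  qed
  then have "Q t \<le> (U t2 + B / e) / dl" for t
    using Qmono[of t "max t t2"] by (meson max.cobounded1 max.cobounded2 order_trans)
  then show ?thesis unfolding Q_def by (intro sqintI[OF cz])
qed

text \<open>With \<open>q = w * d\<close> and \<open>P = r * d\<close> the two equations say
  \<open>P = - q * cot q\<close> and \<open>g q = \<kappa>\<close> for the function \<open>g\<close>
  below. Between \<open>\<pi>/2\<close> and \<open>\<pi>\<close> the cotangent is nonpositive, so
  \<open>P \<ge> 0\<close>, and the intermediate value theorem solves for \<open>q\<close>.\<close>

lemma unstable_delay_root:
  fixes l d :: real
  assumes l: "l > 0" and d: "d > 0" and ld: "l * d \<ge> pi / 2"
  shows "\<exists>r w. r \<ge> 0 \<and> l * exp (- r * d) * cos (w * d) = - r \<and> l * exp (- r * d) * sin (w * d) = w"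
proof -
  define \<kappa> where "\<kappa> = l * d"
  have k1: "1 < \<kappa>" "pi / 2 \<le> \<kappa>" using ld pi_gt3 by (auto simp: \<kappa>_def)
  define P where "P q = - q * cos q / sin q" for q :: real
  define g where "g q = q * exp (P q) / sin q" for q :: real
  \<comment> \<open>Chosen so that \<open>1 / sin q1 = \<kappa>\<close>, which makes
    \<open>g q1 \<ge> \<kappa>\<close>; at \<open>\<pi>/2\<close> the value of \<open>g\<close> is
    \<open>\<pi>/2\<close>, at most \<open>\<kappa>\<close>.\<close>
  define q1 where "q1 = pi - arcsin (1 / \<kappa>)"
  have b1: "- 1 \<le> 1 / \<kappa>" by (rule order_trans[of _ 0]) (use k1 in auto)
  then have as: "0 < arcsin (1 / \<kappa>)" "arcsin (1 / \<kappa>) < pi / 2"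
    using arcsin_less_arcsin[of 0 "1 / \<kappa>"] arcsin_less_arcsin[of "1 / \<kappa>" 1] k1 by auto
  have q1: "pi / 2 < q1" "q1 < pi" "sin q1 = 1 / \<kappa>"
    using as k1 sin_arcsin[OF b1] by (auto simp: q1_def)
  have sp: "sin q > 0" and cn: "cos q \<le> 0" if "pi / 2 \<le> q" "q \<le> q1" for q
  proof -
    show "sin q > 0" using that q1 pi_gt_zero by (intro sin_gt_zero) linarith+
    have "cos q \<le> cos (pi / 2)" using that q1 pi_gt_zero by (intro cos_monotone_0_pi_le) linarith+
    then show "cos q \<le> 0" by simp
  qed
  have Pn: "P q \<ge> 0" if "pi / 2 \<le> q" "q \<le> q1" for q
  proof -
    have "- cos q * q \<ge> 0" using that cn[OF that] pi_gt_zero by (intro mult_nonneg_nonneg) linarith+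
    then show ?thesis using sp[OF that] by (simp add: P_def divide_nonpos_pos mult.commute)
  qed
  have "g (pi / 2) \<le> \<kappa>" using k1 by (simp add: g_def P_def)
  moreover have "\<kappa> \<le> g q1"
  proof -
    have "\<kappa> * 1 \<le> \<kappa> * (q1 * exp (P q1))"
    proof (intro mult_left_mono)
      have "1 * 1 \<le> q1 * exp (P q1)"
        using q1 pi_gt3 Pn[of q1] by (intro mult_mono) auto
      then show "1 \<le> q1 * exp (P q1)" by simp
    qed (use k1 in auto)
    then show ?thesis unfolding g_def q1(3) by (simp add: mult.commute)
  qed
  moreover have "continuous_on {pi / 2..q1} g"
  proof -
    have "sin x \<noteq> 0" if "x \<in> {pi / 2..q1}" for x using sp[of x] that by auto
    then show ?thesis unfolding g_def P_def by (intro continuous_intros) auto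
  qed
  ultimately obtain q where q: "pi / 2 \<le> q" "q \<le> q1" "g q = \<kappa>"
    using IVT'[of g "pi / 2" \<kappa> q1] q1 by auto
  have s: "sin q > 0" by (rule sp[OF q(1,2)])
  have e: "\<kappa> * exp (- P q) * sin q = q"
    using q(3) s by (simp add: g_def exp_minus field_simps)
  then have "\<kappa> * exp (- P q) * cos q = - P q"
    using s by (simp add: P_def field_simps)
  moreover have "P q / d \<ge> 0" using Pn[OF q(1,2)] d by simp
  ultimately show ?thesis
    using e d by (intro exI[of _ "P q / d"] exI[of _ "q / d"]) (auto simp: \<kappa>_def field_simps)
qed

section \<open>Integral equations and the existence of solutions\<close>

lemma continuous_of_integral_equation:
  fixes F h :: "real \<Rightarrow> real"
  assumes "\<And>t. t \<ge> b \<Longrightarrow> (h has_integral F t - r) {b..t}"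
  shows "continuous_on {b..} F"
proof (rule continuous_on_interval_halfline)
  fix e
  have eq: "F t = r + integral {b..t} h" if "t \<in> {b..e}" for t
    using integral_unique[OF assms[of t]] that by simp
  have "continuous_on {b..e} (\<lambda>t. r + integral {b..t} h)"
  proof (cases "b \<le> e")
    case True
    then show ?thesis
      using assms[of e] by (intro continuous_intros indefinite_integral_continuous_1) blast
  qed simp
  then show "continuous_on {b..e} F" by (rule continuous_on_eq) (simp add: eq)
qed

text \<open>The integrand may jump before \<open>b\<close>, as delayed copies of the initial jump
  do; the base point is therefore moved from \<open>a\<close> to \<open>b\<close> before
  differentiating.\<close>

lemma deriv_of_integral_equation:
  fixes F h :: "real \<Rightarrow> real"
  assumes int: "\<And>t. t \<ge> a \<Longrightarrow> (h has_integral F t - r) {a..t}"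
    and ch: "continuous_on {b..} h" and ab: "a \<le> b" and t: "b < t"
  shows "(F has_real_derivative h t) (at t)"
proof -
  have "F u = F b + integral {b..u} h" if u: "u \<in> {b<..}" for u
  proof -
    have "integral {a..b} h + integral {b..u} h = integral {a..u} h"
      using u ab int[of u] by (intro Henstock_Kurzweil_Integration.integral_combine) auto
    then show ?thesis
      using integral_unique[OF int[of u]] integral_unique[OF int[of b]] u ab by simp
  qed
  moreover have "((\<lambda>u. F b + integral {b..u} h) has_real_derivative h t) (at t)"
    using antideriv[OF ch t] by (auto intro!: derivative_eq_intros)
  ultimately show ?thesis
    using t has_field_derivative_transform_within_open[of "\<lambda>u. F b + integral {b..u} h" "h t" t "{b<..}" F]
    by auto
qed

text \<open>A signal that jumps at 0 becomes, when shifted, piecewise continuous with a jump at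
  \<open>d\<close>; the two pieces are integrated separately.\<close>

lemma causal_shift_integrable:
  fixes f :: "real \<Rightarrow> real"
  assumes c: "continuous_on {0..} f" and z: "\<And>t. t < 0 \<Longrightarrow> f t = 0" and d: "0 \<le> d"
  shows "(\<lambda>s. f (s - d)) integrable_on {0..t}"
proof -
  have i1: "(\<lambda>s. f (s - d)) integrable_on {0..d}"
    by (rule integrable_spike_finite[of "{d}" _ _ "\<lambda>_. 0"]) (auto simp: z)
  have i2: "(\<lambda>s. f (s - d)) integrable_on {d..max d t}"
    by (intro integrable_continuous_interval continuous_on_compose2[OF c]) (auto intro!: continuous_intros)
  have "(\<lambda>s. f (s - d)) integrable_on {0..max d t}"
    by (rule Henstock_Kurzweil_Integration.integrable_combine[OF d _ i1 i2]) simp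
  then show ?thesis by (rule integrable_on_subinterval) auto
qed

text \<open>With \<open>p t = Re (exp (- s t))\<close> for a root \<open>s\<close> of \<open>s + l exp (- s d) = 0\<close>, \<open>Re s \<ge> 0\<close>, one has
  \<open>p' t = l p (t + d)\<close>, so \<open>p t z t - l \<integral> p (u + d) z u du\<close> over \<open>[t - d, t]\<close> is conserved.\<close>
lemma delay_equation_no_decay:
  fixes z :: "real \<Rightarrow> real"
  assumes l: "l > 0" and d: "d > 0" and ld: "l * d \<ge> pi / 2"
    and zn: "\<And>t. t < 0 \<Longrightarrow> z t = 0"
    and int: "\<And>t. t \<ge> 0 \<Longrightarrow> ((\<lambda>s. - l * z (s - d)) has_integral z t - z0) {0..t}"
    and z0: "z0 \<noteq> 0"
  shows "\<not> (z \<longlongrightarrow> 0) at_top"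
proof
  assume lim: "(z \<longlongrightarrow> 0) at_top"
  obtain r w where r: "r \<ge> 0" and rw: "l * exp (- r * d) * cos (w * d) = - r"
    "l * exp (- r * d) * sin (w * d) = w"
    using unstable_delay_root[OF l d ld] by blast
  define p where "p t = exp (- r * t) * cos (w * t)" for t
  have p0: "p 0 = 1" by (simp add: p_def)
  have pd: "(p has_real_derivative l * p (t + d)) (at t)" for t
  proof -
    have "(p has_real_derivative exp (- r * t) * (- r * cos (w * t) - w * sin (w * t))) (at t)"
      unfolding p_def[abs_def] by (auto intro!: derivative_eq_intros simp: algebra_simps)
    also have "exp (- r * t) * (- r * cos (w * t) - w * sin (w * t))
      = exp (- r * t) * (l * exp (- r * d) * (cos (w * t) * cos (w * d) - sin (w * t) * sin (w * d)))"
    proof -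
      have "l * exp (- r * d) * (cos (w * t) * cos (w * d) - sin (w * t) * sin (w * d))
        = (l * exp (- r * d) * cos (w * d)) * cos (w * t) - (l * exp (- r * d) * sin (w * d)) * sin (w * t)"
        by (simp add: algebra_simps)
      then show ?thesis unfolding rw by simp
    qed
    also have "\<dots> = l * p (t + d)"
      by (simp add: p_def distrib_left cos_add exp_add[symmetric] mult_ac)
    finally show ?thesis .
  qed
  have p1: "\<bar>p t\<bar> \<le> 1" if "t \<ge> 0" for t
    using that r mult_mono[of "exp (- r * t)" 1 "\<bar>cos (w * t)\<bar>" 1] by (simp add: p_def abs_mult)
  have cp: "continuous_on S p" for S
    by (rule DERIV_continuous_on) (rule DERIV_subset[OF pd subset_UNIV])
  have cz: "continuous_on {0..} z" by (rule continuous_of_integral_equation[OF int])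
  have dz: "(z has_real_derivative - l * z (t - d)) (at t)" if "t > d" for t
  proof (rule deriv_of_integral_equation[OF int _ _ that])
    show "continuous_on {d..} (\<lambda>s. - l * z (s - d))"
      by (intro continuous_intros continuous_on_compose2[OF cz]) auto
  qed (use d in auto)
  \<comment> \<open>On the first delay interval the equation only sees the zero history.\<close>
  have zd: "z t = z0" if "0 \<le> t" "t \<le> d" for t
  proof -
    have "((\<lambda>s. - l * z (s - d)) has_integral 0) {0..t}"
      by (rule has_integral_spike_finite[of "{d}" _ _ "\<lambda>_. 0"]) (use that in \<open>auto simp: zn\<close>)
    then show ?thesis using has_integral_unique[OF int[OF that(1)]] by fastforce
  qed
  define I where "I t = integral {0..t} (\<lambda>u. p (u + d) * z u)" for t
  have cpz: "continuous_on {0..} (\<lambda>u. p (u + d) * z u)"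
    by (intro continuous_intros cz continuous_on_compose2[OF cp[of UNIV]]) auto
  have dI: "(I has_real_derivative p (t + d) * z t) (at t)" if "t > 0" for t
    unfolding I_def by (rule antideriv[OF cpz that])
  have cI: "continuous_on {0..} I"
    unfolding I_def by (rule integral_from_continuous[OF cpz])
  define F where "F t = p t * z t - l * (I t - I (t - d))" for t
  \<comment> \<open>The integral uses \<open>p' u = l * p (u + d)\<close>, so its contribution
    cancels \<open>p d * z0\<close> and leaves \<open>p 0 * z0\<close>.\<close>
  have Fd: "F d = z0"
  proof -
    have "((\<lambda>u. p (u + d) * z u) has_integral z0 / l * p d - z0 / l * p 0) {0..d}"
    proof (rule has_integral_eq)
      have "((\<lambda>u. z0 / l * (l * p (u + d))) has_integral z0 / l * p d - z0 / l * p 0) {0..d}"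
      proof (rule fundamental_theorem_of_calculus)
        fix u
        have "((\<lambda>u. z0 / l * p u) has_real_derivative z0 / l * (l * p (u + d))) (at u within {0..d})"
          by (rule DERIV_subset[OF DERIV_cmult[OF pd] subset_UNIV])
        then show "((\<lambda>u. z0 / l * p u) has_vector_derivative z0 / l * (l * p (u + d))) (at u within {0..d})"
          by (simp only: has_real_derivative_iff_has_vector_derivative)
      qed (use d in simp)
      then show "((\<lambda>u. z0 * p (u + d)) has_integral z0 / l * p d - z0 / l * p 0) {0..d}"
        using l by simp
    qed (auto simp: zd)
    then have "I d = z0 / l * p d - z0 / l" unfolding I_def p0 by (simp add: integral_unique)
    moreover have "I 0 = 0" by (simp add: I_def)
    ultimately show ?thesis using l d by (simp add: F_def zd field_simps)
  qed
  have F: "F t = z0" if t: "d \<le> t" for t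
  proof (cases "t = d")
    case False
    then have dt: "d < t" using t by simp
    have "continuous_on {d..t} F"
      unfolding F_def using d
      by (intro continuous_intros cp continuous_on_subset[OF cz] continuous_on_subset[OF cI]
          continuous_on_compose2[OF cI]) auto
    moreover have "(F has_real_derivative 0) (at u)" if u: "d < u" "u < t" for u
    proof -
      have sh: "((\<lambda>t. I (t - d)) has_real_derivative p u * z (u - d)) (at u)"
      proof -
        have "((\<lambda>t. t - d) has_real_derivative 1) (at u)" by (auto intro!: derivative_eq_intros)
        from DERIV_chain2[OF dI this] show ?thesis using u by simp
      qed
      have "u > 0" using u d by linarith
      then show ?thesis
        unfolding F_def[abs_def] using u
        by (auto intro!: derivative_eq_intros pd dz dI sh simp: algebra_simps)
    qed
    ultimately show ?thesis using DERIV_isconst2[OF dt, of F t] Fd dt by simp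
  qed (simp add: Fd)
  \<comment> \<open>With \<open>z\<close> below \<open>e\<close> on a whole window, \<open>F\<close>
    is at most \<open>e * (1 + l * d)\<close>, that is half of
    \<open>\<bar>z0\<bar>\<close>.\<close>
  define e where "e = \<bar>z0\<bar> / 2 / (1 + l * d)"
  have ld0: "1 + l * d > 0" using l d by (simp add: add_pos_pos)
  have e: "e > 0" using z0 ld0 by (simp add: e_def)
  obtain t1 where t1: "\<And>t. t \<ge> t1 \<Longrightarrow> \<bar>z t\<bar> < e"
    using tendstoD[OF lim e] by (auto simp: eventually_at_top_linorder dist_real_def)
  define t where "t = max t1 0 + d"
  have t: "d \<le> t" "t - d \<ge> t1" "t - d \<ge> 0" "t \<ge> t1" "t \<ge> 0" using d by (auto simp: t_def)
  have "\<bar>I t - I (t - d)\<bar> \<le> e * d"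
  proof -
    have "integral {0..t - d} (\<lambda>u. p (u + d) * z u) + integral {t - d..t} (\<lambda>u. p (u + d) * z u)
        = integral {0..t} (\<lambda>u. p (u + d) * z u)"
      using t d by (intro Henstock_Kurzweil_Integration.integral_combine
          integrable_continuous_interval continuous_on_subset[OF cpz]) auto
    then have "I t - I (t - d) = integral {t - d..t} (\<lambda>u. p (u + d) * z u)" by (simp add: I_def)
    moreover have "norm (integral {t - d..t} (\<lambda>u. p (u + d) * z u)) \<le> e * (t - (t - d))"
    proof (rule integral_bound)
      show "continuous_on {t - d..t} (\<lambda>u. p (u + d) * z u)"
        by (rule continuous_on_subset[OF cpz]) (use t in auto)
      fix u assume u: "u \<in> {t - d..t}"
      have "\<bar>p (u + d)\<bar> * \<bar>z u\<bar> \<le> 1 * e"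
        using u t d t1[of u] by (intro mult_mono p1) auto
      then show "norm (p (u + d) * z u) \<le> e" by (simp add: abs_mult)
    qed (use d in auto)
    ultimately show ?thesis by simp
  qed
  then have "l * \<bar>I t - I (t - d)\<bar> \<le> l * (e * d)" using l by (intro mult_left_mono) auto
  moreover have "\<bar>p t * z t\<bar> \<le> 1 * e"
    unfolding abs_mult using p1[OF t(5)] t1[OF t(4)] by (intro mult_mono) auto
  moreover have "\<bar>F t\<bar> \<le> \<bar>p t * z t\<bar> + l * \<bar>I t - I (t - d)\<bar>"
    unfolding F_def using abs_triangle_ineq4[of "p t * z t" "l * (I t - I (t - d))"] l by (simp add: abs_mult)
  ultimately have "\<bar>z0\<bar> \<le> e + l * (e * d)" using F[OF t(1)] by simp
  also have "\<dots> = e * (1 + l * d)" by (simp add: algebra_simps)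
  also have "\<dots> = \<bar>z0\<bar> / 2"
    using e_def ld0 nonzero_eq_divide_eq[of "1 + l * d" e "\<bar>z0\<bar> / 2"] by simp
  finally show False using z0 by simp
qed

text \<open>Method of steps: the iterates of the integral operator stabilise on \<open>(-\<infinity>, k \<delta>)\<close> after
  \<open>k\<close> rounds because every delay is at least \<open>\<delta>\<close>.\<close>
lemma method_of_steps:
  fixes K :: "'j \<Rightarrow> nat \<Rightarrow> nat \<Rightarrow> real" and d :: "'j \<Rightarrow> real" and x0 :: "nat \<Rightarrow> real"
  assumes J: "finite J" and \<delta>: "\<delta> > 0" and d: "\<And>j. j \<in> J \<Longrightarrow> \<delta> \<le> d j"
  shows "\<exists>z. (\<forall>t<0. \<forall>i. z t i = 0) \<and> (\<forall>t\<ge>0. \<forall>i.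
    ((\<lambda>s. - (\<Sum>j\<in>J. \<Sum>q<n. K j i q * z (s - d j) q)) has_integral z t i - x0 i) {0..t})"
proof -
  define H where "H u i s = - (\<Sum>j\<in>J. \<Sum>q<n. K j i q * u (s - d j) q)"
    for u :: "real \<Rightarrow> nat \<Rightarrow> real" and i s
  define \<Phi> where "\<Phi> u t i = (if t < 0 then 0 else x0 i + integral {0..t} (H u i))" for u t i
  define u where "u m = (\<Phi> ^^ m) (\<lambda>_ _. 0)" for m
  have uS: "u (Suc m) = \<Phi> (u m)" for m by (simp add: u_def)
  have un: "u m t i = 0" if "t < 0" for m t i
    using that by (cases m) (auto simp: u_def \<Phi>_def)
  have Hint: "H v i integrable_on {0..t}"
    if "\<And>q. continuous_on {0..} (\<lambda>t. v t q)" "\<And>t q. t < 0 \<Longrightarrow> v t q = 0" for v i t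
    unfolding H_def[abs_def] using J that d \<delta>
    by (intro integrable_neg integrable_sum integrable_on_mult_right causal_shift_integrable)
       (auto, force)
  have uc: "continuous_on {0..} (\<lambda>t. u m t i)" for m i
  proof (induction m arbitrary: i)
    case 0
    then show ?case by (simp add: u_def)
  next
    case (Suc m)
    show ?case
    proof (rule continuous_of_integral_equation[of 0 "H (u m) i" _ "x0 i"])
      fix t :: real assume "0 \<le> t"
      then show "(H (u m) i has_integral u (Suc m) t i - x0 i) {0..t}"
        using integrable_integral[OF Hint[OF Suc.IH un]] by (simp add: uS \<Phi>_def)
    qed
  qed
  have stable: "u (Suc m) t i = u m t i" if "t < m * \<delta>" for m t i
    using that
  proof (induction m arbitrary: t i)
    case 0
    then show ?case using un by simp
  next
    case (Suc m)
    have "H (u (Suc m)) i s = H (u m) i s" if s: "s \<le> t" for s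
    proof -
      have "u (Suc m) (s - d j) q = u m (s - d j) q" if "j \<in> J" for j q
        using Suc.prems s d[OF that] by (intro Suc.IH) (simp add: algebra_simps)
      then show ?thesis by (simp add: H_def)
    qed
    then have "integral {0..t} (H (u (Suc m)) i) = integral {0..t} (H (u m) i)"
      by (intro integral_cong) auto
    then show ?case unfolding uS[of "Suc m"] uS[of m] \<Phi>_def by simp
  qed
  have stable': "u (m + r) t i = u m t i" if "t < m * \<delta>" for m r t i
  proof (induction r)
    case (Suc r)
    have "t < real (m + r) * \<delta>" using that mult_right_mono[of "real m" "real (m + r)" \<delta>] \<delta> by linarith
    then show ?case using stable[of t "m + r" i] Suc by simp
  qed simp
  define k where "k t = Suc (nat \<lceil>t / \<delta>\<rceil>)" for t
  have k: "t < k t * \<delta>" for t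
  proof -
    have "t / \<delta> < real (k t)" unfolding k_def by linarith
    then show ?thesis using \<delta> by (simp add: field_simps)
  qed
  define z where "z t = u (k t) t" for t
  have zu: "z t i = u m t i" if "t < m * \<delta>" for m t i
    unfolding z_def using stable'[OF that, of "k t"] stable'[OF k, of t m i] by (simp add: add.commute)
  have "(H z i has_integral z t i - x0 i) {0..t}" if t: "0 \<le> t" for t i
  proof -
    define m where "m = k t"
    have tm: "t < m * \<delta>" using k by (simp add: m_def)
    have "z t i = u (Suc m) t i" using zu[OF tm] stable[OF tm] by simp
    then have e: "z t i - x0 i = integral {0..t} (H (u m) i)"
      using t by (simp add: uS \<Phi>_def)
    have "(H (u m) i has_integral z t i - x0 i) {0..t}"
      unfolding e by (rule integrable_integral[OF Hint[OF uc un]])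
    moreover have "H (u m) i s = H z i s" if "s \<in> {0..t}" for s
    proof -
      have "u m (s - d j) q = z (s - d j) q" if "j \<in> J" for j q
        using \<open>s \<in> {0..t}\<close> tm d[OF that] \<delta> by (intro zu[symmetric]) auto
      then show ?thesis by (simp add: H_def)
    qed
    ultimately show ?thesis by (rule has_integral_eq[rotated])
  qed
  moreover have "z t i = 0" if "t < 0" for t i unfolding z_def by (rule un[OF that])
  ultimately show ?thesis unfolding H_def by blast
qed

section \<open>Decay of the layer components\<close>

definition vsq :: "nat \<Rightarrow> (real \<Rightarrow> real Matrix.vec) \<Rightarrow> bool" where
  "vsq n y \<longleftrightarrow> (\<forall>i<n. sqint (\<lambda>t. y t $ i))"

definition vder :: "nat \<Rightarrow> (real \<Rightarrow> real Matrix.vec) \<Rightarrow> real Matrix.vec \<Rightarrow> real \<Rightarrow> bool" where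
  "vder n y g t \<longleftrightarrow> (\<forall>i<n. ((\<lambda>t. y t $ i) has_real_derivative g $ i) (at t))"

definition vcont :: "nat \<Rightarrow> (real \<Rightarrow> real Matrix.vec) \<Rightarrow> real \<Rightarrow> bool" where
  "vcont n y b \<longleftrightarrow> (\<forall>i<n. continuous_on {b..} (\<lambda>t. y t $ i))"

lemma square_mult_index:
  assumes "L \<in> carrier_mat n n" "v \<in> carrier_vec n" "i < n"
  shows "(L *\<^sub>v v) $ i = (\<Sum>j<n. L $$ (i,j) * v $ j)"
  using mult_mat_vec_index[of i L v] assms by auto

lemma vsq_mult:
  assumes L: "L \<in> carrier_mat n n" and y: "\<And>t. y t \<in> carrier_vec n" and s: "vsq n y"
  shows "vsq n (\<lambda>t. L *\<^sub>v y t)"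
  unfolding vsq_def using s
  by (auto simp: square_mult_index[OF L y] vsq_def intro!: sqint_sum sqint_cmult)

lemma vder_mult:
  assumes L: "L \<in> carrier_mat n n" and y: "\<And>t. y t \<in> carrier_vec n" and g: "g \<in> carrier_vec n"
    and s: "vder n y g t"
  shows "vder n (\<lambda>t. L *\<^sub>v y t) (L *\<^sub>v g) t"
  unfolding vder_def using s
  by (auto simp: square_mult_index[OF L y] square_mult_index[OF L g] vder_def
      intro!: DERIV_sum DERIV_cmult)

lemma vcont_mult:
  assumes L: "L \<in> carrier_mat n n" and y: "\<And>t. y t \<in> carrier_vec n" and s: "vcont n y b"
  shows "vcont n (\<lambda>t. L *\<^sub>v y t) b"
  unfolding vcont_def using s
  by (auto simp: square_mult_index[OF L y] vcont_def intro!: continuous_intros)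

lemma shift_op_index:
  assumes "L \<in> carrier_mat n n" "v \<in> carrier_vec n" "i < n"
  shows "shift_op L r v $ i = (L *\<^sub>v v) $ i - r * v $ i"
  using assms by (simp add: shift_op_def)

text \<open>Peeling off one factor \<open>L - r\<close> at a time reduces the vector equation to scalar ones:
  \<open>- L w = - r w - (L - r) w\<close>, where \<open>(L - r) w\<close> is already under control.\<close>
lemma shifted_delay_system_vsq:
  assumes L: "L \<in> carrier_mat n n" and d: "0 \<le> d"
    and rs: "\<And>r. r \<in> set rs \<Longrightarrow> 0 < r \<and> r * d < pi / 2"
    and w: "\<And>t. w t \<in> carrier_vec n" and F: "\<And>t. F t \<in> carrier_vec n"
    and cw: "vcont n w b"
    and dw: "\<And>t. t > b + d \<Longrightarrow> vder n w (F t - L *\<^sub>v w (t - d)) t"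
    and sF: "vsq n F"
    and z: "\<And>t. foldr (shift_op L) rs (w t) = 0\<^sub>v n"
  shows "vsq n w"
  using rs w F cw dw sF z
\<comment> \<open>The last factor of \<open>foldr\<close> acts first, so removing it replaces
  \<open>w\<close> by \<open>shift_op L r w\<close> and shortens the list.\<close>
proof (induction rs arbitrary: w F rule: rev_induct)
  case Nil
  then show ?case by (auto simp: vsq_def intro: sqint_zero)
next
  case (snoc r rs)
  let ?S = "shift_op L r"
  note w = snoc.prems(2) and F = snoc.prems(3)
  have r: "0 < r" "r * d < pi / 2" using snoc.prems(1)[of r] by auto
  have sc: "?S v \<in> carrier_vec n" if "v \<in> carrier_vec n" for v using L that by simp
  have Lc: "L *\<^sub>v v \<in> carrier_vec n" if "v \<in> carrier_vec n" for v using L that by simp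
  \<comment> \<open>\<open>L - r\<close> commutes with \<open>L\<close>, so the shifted signal
    solves the same equation with the shifted forcing.\<close>
  have lin: "?S (F t - L *\<^sub>v w (t - d)) = ?S (F t) - L *\<^sub>v ?S (w (t - d))" for t
  proof -
    have "L *\<^sub>v (F t - L *\<^sub>v w (t - d)) = L *\<^sub>v F t - L *\<^sub>v (L *\<^sub>v w (t - d))"
      by (rule mult_minus_distrib_mat_vec[OF L F Lc[OF w]])
    moreover have rw: "r \<cdot>\<^sub>v w (t - d) \<in> carrier_vec n" using w by simp
    have "L *\<^sub>v ?S (w (t - d)) = L *\<^sub>v (L *\<^sub>v w (t - d)) - r \<cdot>\<^sub>v (L *\<^sub>v w (t - d))"
      unfolding shift_op_def using mult_minus_distrib_mat_vec[OF L Lc[OF w] rw]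
        mult_mat_vec[OF L w] w by simp
    ultimately show ?thesis
      unfolding shift_op_def using F w Lc
      by (intro eq_vecI) (auto simp: carrier_vecD[OF F] carrier_vecD[OF w] carrier_matD[OF L] algebra_simps)
  qed
  have sqS: "vsq n (\<lambda>t. ?S (F t))"
    unfolding vsq_def
  proof (intro allI impI)
    fix i assume i: "i < n"
    have "sqint (\<lambda>t. (L *\<^sub>v F t) $ i + (- r) * F t $ i)"
      using vsq_mult[OF L F snoc.prems(6)] snoc.prems(6) i
      by (intro sqint_add sqint_cmult) (auto simp: vsq_def)
    then show "sqint (\<lambda>t. ?S (F t) $ i)" by (simp add: shift_op_index[OF L F i])
  qed
  have "vsq n (\<lambda>t. ?S (w t))"
  proof (rule snoc.IH[where F = "\<lambda>t. ?S (F t)"])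
    show "vcont n (\<lambda>t. ?S (w t)) b"
      unfolding vcont_def
      using vcont_mult[OF L w snoc.prems(4)] snoc.prems(4)
      by (auto simp: shift_op_index[OF L w] vcont_def intro!: continuous_intros)
    fix t assume t: "b + d < t"
    let ?g = "F t - L *\<^sub>v w (t - d)"
    have g: "?g \<in> carrier_vec n" using F Lc[OF w] by simp
    note D = snoc.prems(5)[OF t]
    have "vder n (\<lambda>t. ?S (w t)) (?S ?g) t"
      unfolding vder_def
    proof (intro allI impI)
      fix i assume i: "i < n"
      show "((\<lambda>t. ?S (w t) $ i) has_real_derivative ?S ?g $ i) (at t)"
        using vder_mult[OF L w g D] D i
        unfolding vder_def shift_op_index[OF L w i] shift_op_index[OF L g i]
        by (intro DERIV_diff DERIV_cmult) auto
    qed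
    then show "vder n (\<lambda>t. ?S (w t)) (?S (F t) - L *\<^sub>v ?S (w (t - d))) t" unfolding lin .
  qed (use snoc.prems sqS sc in auto)
  then have sw: "sqint (\<lambda>t. ?S (w t) $ i)" if "i < n" for i using that by (simp add: vsq_def)
  show ?case
    unfolding vsq_def
  proof (intro allI impI)
    fix i assume i: "i < n"
    show "sqint (\<lambda>t. w t $ i)"
    proof (rule delay_equation_sqint[OF r(1) d r(2), of b _ "\<lambda>t. F t $ i + (-1) * ?S (w (t - d)) $ i"])
      show "continuous_on {b..} (\<lambda>t. w t $ i)" using snoc.prems(4) i by (simp add: vcont_def)
      show "sqint (\<lambda>t. F t $ i + (-1) * ?S (w (t - d)) $ i)"
        using snoc.prems(6) i
        by (intro sqint_add sqint_cmult sqint_shift[OF sw[OF i]]) (simp add: vsq_def)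
      fix t assume t: "b + d < t"
      have "((\<lambda>t. w t $ i) has_real_derivative (F t - L *\<^sub>v w (t - d)) $ i) (at t)"
        using snoc.prems(5)[OF t] i by (simp add: vder_def)
      moreover have "(F t - L *\<^sub>v w (t - d)) $ i = - r * w (t - d) $ i + (F t $ i + (-1) * ?S (w (t - d)) $ i)"
        using i L by (simp add: shift_op_index[OF L w i])
      ultimately show "((\<lambda>t. w t $ i) has_real_derivative
          - r * w (t - d) $ i + (F t $ i + (-1) * ?S (w (t - d)) $ i)) (at t)" by simp
    qed
  qed
qed

context hierarchy
begin

lemma Lm_eigenvalue_finite:
  assumes "1 \<le> l"
  shows "finite {\<mu>. eigenvalue (Lm l) \<mu>}"
proof -
  have L: "Lm l \<in> carrier_mat (N 1) (N 1)" by (rule Lm_carrier[OF assms])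
  have "char_poly (Lm l) \<noteq> 0" using degree_monic_char_poly[OF L] by auto
  then show ?thesis using poly_roots_finite[of "char_poly (Lm l)"]
    by (simp add: eigenvalue_root_char_poly[OF L])
qed

lemma Lm_real_eigenvalue_complex:
  assumes "1 \<le> l" "eigenvalue (Lm l) r"
  shows "eigenvalue (map_mat complex_of_real (Lm l)) (complex_of_real r)"
proof -
  have L: "Lm l \<in> carrier_mat (N 1) (N 1)" by (rule Lm_carrier[OF assms(1)])
  then have C: "map_mat complex_of_real (Lm l) \<in> carrier_mat (N 1) (N 1)" by simp
  have "poly (map_poly complex_of_real (char_poly (Lm l))) (complex_of_real r) = 0"
    using assms(2) by (simp add: eigenvalue_root_char_poly[OF L] of_real_hom.poly_map_poly)
  then show ?thesis
    by (simp add: eigenvalue_root_char_poly[OF C] of_real_hom.char_poly_hom[OF L])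
qed

lemma lam_max_ge:
  assumes "1 \<le> l" "eigenvalue (Lm l) r"
  shows "r \<le> lam_max (Lm l)"
  unfolding lam_max_def using assms Lm_eigenvalue_finite[OF assms(1)] by (intro Max_ge) auto

lemma Lm_shifts:
  assumes l: "1 \<le> l" "l \<le> M"
  shows "\<exists>rs. (\<forall>r\<in>set rs. 0 < r \<and> r \<le> lam_max (Lm l))
    \<and> (\<forall>y\<in>carrier_vec (N 1). foldr (shift_op (Lm l)) rs (Lm l *\<^sub>v y) = 0\<^sub>v (N 1))"
proof -
  obtain rs where rs: "\<forall>r\<in>set rs. r \<noteq> 0 \<and> eigenvalue (Lm l) r"
    "\<forall>y\<in>carrier_vec (N 1). foldr (shift_op (Lm l)) rs (Lm l *\<^sub>v y) = 0\<^sub>v (N 1)"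
    using annihilating_shifts[OF Lm_carrier[OF l(1)] Lm_eigenvalue(1)[OF l] Lm_square_kernel[OF l]] by blast
  have "0 < r \<and> r \<le> lam_max (Lm l)" if "r \<in> set rs" for r
  proof -
    have ev: "eigenvalue (Lm l) r" and "r \<noteq> 0" using rs(1) that by blast+
    then show ?thesis
      using Lm_eigenvalue(2)[OF l Lm_real_eigenvalue_complex[OF l(1) ev]] lam_max_ge[OF l(1) ev] by simp
  qed
  then show ?thesis using rs(2) by blast
qed

text \<open>Applying \<open>L\<^sup>(\<^sup>l\<^sup>)\<close> to the equation removes all layers above \<open>l\<close>, so the layers can be
  treated one after the other.\<close>
lemma layer_vsq:
  assumes x: "\<And>t. x t \<in> carrier_vec (N 1)" and cx: "vcont (N 1) x b"
    and T: "\<And>l. 1 \<le> l \<Longrightarrow> l \<le> M \<Longrightarrow> 0 \<le> T l \<and> lam_max (Lm l) * T l < pi / 2"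
    and dx: "\<And>t. t > b \<Longrightarrow>
      vder (N 1) x (Matrix.vec (N 1) (\<lambda>i. - (\<Sum>j=1..M. (Lm j *\<^sub>v x (t - T j)) $ i))) t"
  shows "1 \<le> l \<Longrightarrow> l \<le> M \<Longrightarrow> vsq (N 1) (\<lambda>t. Lm l *\<^sub>v x t) \<and>
    (\<forall>i<N 1. ((\<lambda>t. (Lm l *\<^sub>v x t) $ i) \<longlongrightarrow> 0) at_top)"
proof (induction l rule: less_induct)
  case (less l)
  note l = less.prems
  let ?n = "N 1" and ?L = "Lm l"
  let ?v = "\<lambda>j t. Lm j *\<^sub>v x t"
  have L: "?L \<in> carrier_mat ?n ?n" by (rule Lm_carrier[OF l(1)])
  have Lc: "?L *\<^sub>v y \<in> carrier_vec ?n" for y by (rule Lm_vec_carrier[OF l(1)])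
  \<comment> \<open>Feedback from the lower layers; square integrable by the induction
    hypothesis.\<close>
  define F where "F t = Matrix.vec ?n (\<lambda>i. - (\<Sum>j\<in>{1..<l}. (?L *\<^sub>v ?v j (t - T j)) $ i))" for t
  have Fc: "F t \<in> carrier_vec ?n" for t by (simp add: F_def)
  have sF: "vsq ?n F"
    unfolding vsq_def
  proof (intro allI impI)
    fix i assume i: "i < ?n"
    have "sqint (\<lambda>t. (?L *\<^sub>v ?v j (t - T j)) $ i)" if "j \<in> {1..<l}" for j
    proof -
      have "vsq ?n (?v j)" using less.IH[of j] that l by auto
      then have "vsq ?n (\<lambda>t. ?L *\<^sub>v ?v j t)"
        using that by (intro vsq_mult[OF L]) (auto intro: Lm_vec_carrier)
      then show ?thesis using i sqint_shift[of "\<lambda>t. (?L *\<^sub>v ?v j t) $ i" "T j"] by (simp add: vsq_def)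
    qed
    then have "sqint (\<lambda>t. (-1) * (\<Sum>j\<in>{1..<l}. (?L *\<^sub>v ?v j (t - T j)) $ i))"
      by (intro sqint_cmult sqint_sum)
    then show "sqint (\<lambda>t. F t $ i)" using i by (simp add: F_def)
  qed
  have dv: "vder ?n (?v l) (F t - ?L *\<^sub>v ?v l (t - T l)) t" if t: "t > b" for t
  proof -
    define G where "G = Matrix.vec ?n (\<lambda>i. - (\<Sum>j=1..M. (?v j (t - T j)) $ i))"
    have G: "G \<in> carrier_vec ?n" by (simp add: G_def)
    have "vder ?n (?v l) (?L *\<^sub>v G) t"
      using vder_mult[OF L x G] dx[OF t] by (simp add: G_def)
    moreover have "?L *\<^sub>v G = F t - ?L *\<^sub>v ?v l (t - T l)"
    proof
      fix i assume "i < dim_vec (F t - ?L *\<^sub>v ?v l (t - T l))"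
      then have i: "i < ?n" using L by simp
      have jc: "?v j s \<in> carrier_vec ?n" if "j \<in> {1..M}" for j s
        using that by (intro Lm_vec_carrier) auto
      have "(?L *\<^sub>v G) $ i = (\<Sum>q<?n. ?L $$ (i,q) * - (\<Sum>j=1..M. (?v j (t - T j)) $ q))"
        unfolding square_mult_index[OF L G i] by (simp add: G_def)
      also have "\<dots> = - (\<Sum>q<?n. \<Sum>j=1..M. ?L $$ (i,q) * (?v j (t - T j)) $ q)"
        by (simp add: sum_negf sum_distrib_left)
      also have "\<dots> = - (\<Sum>j=1..M. \<Sum>q<?n. ?L $$ (i,q) * (?v j (t - T j)) $ q)"
        by (subst sum.swap) simp
      also have "\<dots> = - (\<Sum>j=1..M. (?L *\<^sub>v ?v j (t - T j)) $ i)"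
        using square_mult_index[OF L jc i] by (metis (no_types, lifting) sum.cong)
      also have "(\<Sum>j=1..M. (?L *\<^sub>v ?v j (t - T j)) $ i) = (\<Sum>j\<in>{1..l}. (?L *\<^sub>v ?v j (t - T j)) $ i)"
        using Lm_Lm_vec[OF l(1) _ _ x] i l by (intro sum.mono_neutral_right) auto
      also have "{1..l} = insert l {1..<l}" using l by auto
      finally show "(?L *\<^sub>v G) $ i = (F t - ?L *\<^sub>v ?v l (t - T l)) $ i"
        using i L by (simp add: F_def)
    qed (use L in \<open>simp add: F_def\<close>)
    ultimately show ?thesis by simp
  qed
  obtain rs where rs: "\<And>r. r \<in> set rs \<Longrightarrow> 0 < r \<and> r \<le> lam_max ?L"
    "\<And>y. y \<in> carrier_vec ?n \<Longrightarrow> foldr (shift_op ?L) rs (?L *\<^sub>v y) = 0\<^sub>v ?n"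
    using Lm_shifts[OF l] by blast
  have cv: "vcont ?n (?v l) b" by (rule vcont_mult[OF L x cx])
  have sv: "vsq ?n (?v l)"
  proof (rule shifted_delay_system_vsq[OF L, of "T l" rs "?v l" F b])
    fix r assume "r \<in> set rs"
    then have "0 < r" "r * T l \<le> lam_max ?L * T l"
      using rs(1)[of r] T[OF l] by (auto intro: mult_right_mono)
    then show "0 < r \<and> r * T l < pi / 2" using T[OF l] by linarith
  next
    fix t assume "b + T l < t"
    then have "b < t" using T[OF l] by linarith
    then show "vder ?n (?v l) (F t - ?L *\<^sub>v ?v l (t - T l)) t" by (rule dv)
  qed (use T[OF l] Lc Fc cv sF rs(2) x in auto)
  \<comment> \<open>The derivative is square integrable as well, being composed of the forcing and a
    delayed image of the signal itself.\<close>
  have "((\<lambda>t. ?v l t $ i) \<longlongrightarrow> 0) at_top" if i: "i < ?n" for i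
  proof (rule sqint_deriv_tendsto_0)
    show "sqint (\<lambda>t. ?v l t $ i)" using sv i by (simp add: vsq_def)
    have "sqint (\<lambda>t. (?L *\<^sub>v ?v l t) $ i)"
      using vsq_mult[OF L Lc sv] i by (simp add: vsq_def)
    then have "sqint (\<lambda>t. F t $ i + (-1) * (?L *\<^sub>v ?v l (t - T l)) $ i)"
      using sF i by (intro sqint_add sqint_cmult sqint_shift[of "\<lambda>t. (?L *\<^sub>v ?v l t) $ i"]) (auto simp: vsq_def)
    then show "sqint (\<lambda>t. (F t - ?L *\<^sub>v ?v l (t - T l)) $ i)" using i L by simp
    show "((\<lambda>t. ?v l t $ i) has_real_derivative (F t - ?L *\<^sub>v ?v l (t - T l)) $ i) (at t)" if "t > b" for t
      using dv[OF that] i by (simp add: vder_def)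
  qed
  then show ?case using sv by blast
qed

text \<open>Applying \<open>Lm l\<close> to the vanishing sum removes the layers above by
  triangularity and those below by induction; what remains is \<open>Lm l\<close> applied twice, and
  semisimplicity at 0 finishes.\<close>

lemma Lm_sum_kernel:
  assumes x: "x \<in> carrier_vec (N 1)"
    and z: "\<And>i. i < N 1 \<Longrightarrow> (\<Sum>l=1..M. (Lm l *\<^sub>v x) $ i) = 0"
  shows "1 \<le> l \<Longrightarrow> l \<le> M \<Longrightarrow> Lm l *\<^sub>v x = 0\<^sub>v (N 1)"
proof (induction l rule: less_induct)
  case (less l)
  note l = less.prems
  let ?n = "N 1" and ?L = "Lm l"
  have L: "?L \<in> carrier_mat ?n ?n" by (rule Lm_carrier[OF l(1)])
  have "?L *\<^sub>v (?L *\<^sub>v x) = 0\<^sub>v ?n"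
  proof
    fix i assume "i < dim_vec (0\<^sub>v ?n :: real Matrix.vec)"
    then have i: "i < ?n" by simp
    have jc: "Lm j *\<^sub>v x \<in> carrier_vec ?n" if "j \<in> {1..M}" for j
      using that by (intro Lm_vec_carrier) auto
    have "(?L *\<^sub>v (?L *\<^sub>v x)) $ i = (\<Sum>j\<in>{l}. (?L *\<^sub>v (Lm j *\<^sub>v x)) $ i)" by simp
    also have "\<dots> = (\<Sum>j=1..M. (?L *\<^sub>v (Lm j *\<^sub>v x)) $ i)"
    proof (rule sum.mono_neutral_left)
      show "\<forall>j\<in>{1..M} - {l}. (?L *\<^sub>v (Lm j *\<^sub>v x)) $ i = 0"
      proof
        fix j assume j: "j \<in> {1..M} - {l}"
        show "(?L *\<^sub>v (Lm j *\<^sub>v x)) $ i = 0"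
        proof (cases "j < l")
          case True
          then have "Lm j *\<^sub>v x = 0\<^sub>v ?n" using less.IH[of j] j l by auto
          then show ?thesis using i by (simp add: square_mult_index[OF L _ i])
        next
          case False
          then show ?thesis using Lm_Lm_vec[OF l(1) _ _ x, of j] j i by auto
        qed
      qed
    qed (use l in auto)
    also have "\<dots> = (\<Sum>j=1..M. \<Sum>q<?n. ?L $$ (i,q) * (Lm j *\<^sub>v x) $ q)"
      using square_mult_index[OF L jc i] by (metis (no_types, lifting) sum.cong)
    also have "\<dots> = (\<Sum>q<?n. ?L $$ (i,q) * (\<Sum>j=1..M. (Lm j *\<^sub>v x) $ q))"
      by (subst sum.swap) (simp add: sum_distrib_left)
    also have "\<dots> = 0" using z by simp
    finally show "(?L *\<^sub>v (?L *\<^sub>v x)) $ i = 0\<^sub>v ?n $ i" using i by simp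
  qed (use L in simp)
  then show ?case using Lm_square_kernel[OF l x] by blast
qed

lemma a_sum_pos: "(\<Sum>j<N 1. a j) > 0"
proof -
  have "N 1 > 0" using N_pos[of 1] M_ge_2 by simp
  moreover have "\<forall>i<N 1. a i > 0" using hier by (simp add: hier_structure_def)
  ultimately show ?thesis by (intro sum_pos) auto
qed

text \<open>All quantities known to converge are collected in \<open>P x\<close>, where
  \<open>P\<close> is the sum of all \<open>Lm l\<close> plus the rank-one matrix with every row
  equal to \<open>a\<close>. Since \<open>P\<close> is invertible, \<open>x\<close> converges too,
  and the limit is read off from the action of \<open>P\<close> on the all-ones vector, which it
  multiplies by the sum of the \<open>a j\<close>.\<close>

lemma consensus_of_decay:
  assumes x: "\<And>t. x t \<in> carrier_vec (N 1)"
    and inv: "\<forall>\<^sub>F t in at_top. (\<Sum>j<N 1. a j * x t $ j) = m"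
    and dec: "\<And>l i. 1 \<le> l \<Longrightarrow> l \<le> M \<Longrightarrow> i < N 1 \<Longrightarrow> ((\<lambda>t. (Lm l *\<^sub>v x t) $ i) \<longlongrightarrow> 0) at_top"
    and i: "i < N 1"
  shows "((\<lambda>t. x t $ i) \<longlongrightarrow> m / (\<Sum>j<N 1. a j)) at_top"
proof -
  let ?n = "N 1"
  define P where "P = Matrix.mat ?n ?n (\<lambda>(i,j). (\<Sum>l=1..M. Lm l $$ (i,j)) + a j)"
  have P: "P \<in> carrier_mat ?n ?n" by (simp add: P_def)
  have Pv: "(P *\<^sub>v v) $ i = (\<Sum>l=1..M. (Lm l *\<^sub>v v) $ i) + (\<Sum>j<?n. a j * v $ j)"
    if v: "v \<in> carrier_vec ?n" and i: "i < ?n" for v i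
  proof -
    have "(P *\<^sub>v v) $ i = (\<Sum>j<?n. (\<Sum>l=1..M. Lm l $$ (i,j) * v $ j) + a j * v $ j)"
      unfolding square_mult_index[OF P v i] using i
      by (intro sum.cong) (auto simp: P_def sum_distrib_right distrib_right)
    also have "\<dots> = (\<Sum>l=1..M. \<Sum>j<?n. Lm l $$ (i,j) * v $ j) + (\<Sum>j<?n. a j * v $ j)"
      unfolding sum.distrib by (subst sum.swap) simp
    also have "(\<Sum>l=1..M. \<Sum>j<?n. Lm l $$ (i,j) * v $ j) = (\<Sum>l=1..M. (Lm l *\<^sub>v v) $ i)"
      by (intro sum.cong) (auto simp: square_mult_index[OF Lm_carrier v i])
    finally show ?thesis .
  qed
  have "det P \<noteq> 0"
  proof
    assume "det P = 0"
    then obtain v where v: "v \<in> carrier_vec ?n" "v \<noteq> 0\<^sub>v ?n" "P *\<^sub>v v = 0\<^sub>v ?n"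
      using det_0_iff_vec_prod_zero[OF P] by auto
    have e: "(\<Sum>l=1..M. (Lm l *\<^sub>v v) $ i) + (\<Sum>j<?n. a j * v $ j) = 0" if "i < ?n" for i
      using Pv[OF v(1) that] v(3) that by simp
    \<comment> \<open>Weighting with \<open>a\<close> removes the \<open>Lm l\<close> terms and
      isolates the weighted mean of \<open>v\<close>.\<close>
    have "0 = (\<Sum>i<?n. a i * ((\<Sum>l=1..M. (Lm l *\<^sub>v v) $ i) + (\<Sum>j<?n. a j * v $ j)))"
      using e by simp
    also have "\<dots> = (\<Sum>i<?n. \<Sum>l=1..M. a i * (Lm l *\<^sub>v v) $ i) + (\<Sum>i<?n. a i) * (\<Sum>j<?n. a j * v $ j)"
      unfolding distrib_left sum.distrib sum_distrib_right by (simp only: sum_distrib_left)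
    also have "(\<Sum>i<?n. \<Sum>l=1..M. a i * (Lm l *\<^sub>v v) $ i) = (\<Sum>l=1..M. \<Sum>i<?n. a i * (Lm l *\<^sub>v v) $ i)"
      by (rule sum.swap)
    also have "(\<Sum>l=1..M. \<Sum>i<?n. a i * (Lm l *\<^sub>v v) $ i) = 0"
      using a_Lm[OF _ _ v(1)] by (intro sum.neutral) auto
    finally have av: "(\<Sum>j<?n. a j * v $ j) = 0" using a_sum_pos by simp
    then have "\<And>i. i < ?n \<Longrightarrow> (\<Sum>l=1..M. (Lm l *\<^sub>v v) $ i) = 0" using e by simp
    then have "\<And>l. 1 \<le> l \<Longrightarrow> l \<le> M \<Longrightarrow> Lm l *\<^sub>v v = 0\<^sub>v ?n" by (rule Lm_sum_kernel[OF v(1)])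
    then obtain r where r: "v = Matrix.vec ?n (\<lambda>_. r)" using Lm_common_kernel[OF v(1)] by blast
    have "(\<Sum>j<?n. a j) * r = 0" using av unfolding r by (simp add: sum_distrib_right)
    then have "r = 0" using a_sum_pos by simp
    then show False using v(2) r by (simp add: zero_vec_def)
  qed
  then obtain R where R: "R \<in> carrier_mat ?n ?n" "R * P = 1\<^sub>m ?n"
    using det_non_zero_imp_unit[OF P, of "()"] by (auto simp: Units_def ring_mat_def)
  have RP: "v = R *\<^sub>v (P *\<^sub>v v)" if "v \<in> carrier_vec ?n" for v
    using assoc_mult_mat_vec[OF R(1) P that] R(2) that by simp
  let ?one = "Matrix.vec ?n (\<lambda>_. 1) :: real Matrix.vec"
  have Pc: "P *\<^sub>v v \<in> carrier_vec ?n" if "v \<in> carrier_vec ?n" for v using P that by simp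
  have R1: "1 = (\<Sum>j<?n. R $$ (i,j)) * (\<Sum>j<?n. a j)"
  proof -
    have P1: "(P *\<^sub>v ?one) $ j = (\<Sum>j<?n. a j)" if "j < ?n" for j
      using that Lm_const by (simp add: Pv)
    have "1 = (R *\<^sub>v (P *\<^sub>v ?one)) $ i" using RP[of ?one] i by simp
    also have "\<dots> = (\<Sum>j<?n. R $$ (i,j) * (\<Sum>j<?n. a j))"
      by (simp add: square_mult_index[OF R(1) Pc i] P1)
    finally show ?thesis by (simp add: sum_distrib_right)
  qed
  have "((\<lambda>t. \<Sum>j<?n. R $$ (i,j) * ((\<Sum>l=1..M. (Lm l *\<^sub>v x t) $ j) + (\<Sum>q<?n. a q * x t $ q)))
      \<longlongrightarrow> (\<Sum>j<?n. R $$ (i,j) * ((\<Sum>l=1..M. 0) + m))) at_top"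
    by (intro tendsto_sum tendsto_mult tendsto_const tendsto_add dec tendsto_eventually[OF inv]) auto
  moreover have "(\<Sum>j<?n. R $$ (i,j) * ((\<Sum>l=1..M. (Lm l *\<^sub>v x t) $ j) + (\<Sum>q<?n. a q * x t $ q))) = x t $ i" for t
  proof -
    have "x t $ i = (R *\<^sub>v (P *\<^sub>v x t)) $ i" using RP[OF x[of t]] by simp
    then show ?thesis by (simp add: square_mult_index[OF R(1) Pc[OF x] i] Pv[OF x])
  qed
  moreover have "(\<Sum>j<?n. R $$ (i,j) * ((\<Sum>l=1..M. 0) + m)) = m / (\<Sum>j<?n. a j)"
  proof -
    have "(\<Sum>j<?n. R $$ (i,j)) = 1 / (\<Sum>j<?n. a j)" using R1 a_sum_pos by (simp add: field_simps)
    moreover have "(\<Sum>j<?n. R $$ (i,j) * ((\<Sum>l=1..M. 0) + m)) = (\<Sum>j<?n. R $$ (i,j)) * m"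
      by (simp add: sum_distrib_right)
    ultimately show ?thesis by simp
  qed
  ultimately show ?thesis by simp
qed

end

section \<open>Elimination of the upper layers\<close>

lemma mult_mat_zero_vec:
  fixes P :: "real Matrix.mat"
  shows "P \<in> carrier_mat nr nc \<Longrightarrow> P *\<^sub>v 0\<^sub>v nc = 0\<^sub>v nr"
  by (auto intro!: eq_vecI)

locale delayed_hierarchy = hierarchy +
  fixes \<tau> :: "nat \<Rightarrow> real"
  assumes tau: "\<forall>l\<in>{2..M}. \<tau> l \<ge> 0"
begin

abbreviation Ds :: "nat \<Rightarrow> real" where "Ds \<equiv> Dsum \<tau>"

lemma Ds_1: "Ds 1 = 0"
  by (simp add: Dsum_def)

lemma Ds_Suc: "1 \<le> l \<Longrightarrow> Ds (Suc l) = Ds l + \<tau> (Suc l)"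
  by (simp add: Dsum_def)

lemma Ds_mono:
  assumes "l \<le> m" "m \<le> M"
  shows "Ds l \<le> Ds m"
  unfolding Dsum_def using assms tau by (intro sum_mono2) auto

lemma Ds_nonneg: "l \<le> M \<Longrightarrow> 0 \<le> Ds l"
  unfolding Dsum_def using tau by (intro sum_nonneg) auto

text \<open>The coupling from the layers above \<open>l = M - m\<close>, transported to layer 1.\<close>
primrec upper :: "(real \<Rightarrow> real Matrix.vec) \<Rightarrow> nat \<Rightarrow> real \<Rightarrow> real Matrix.vec" where
  "upper z 0 = (\<lambda>t. 0\<^sub>v (N 1))"
| "upper z (Suc m) = (\<lambda>t. upper z m (t - \<tau> (M - m))
     - Lm (M - m) *\<^sub>v z (t - \<tau> (M - m) - Ds (M - m)))"

lemma upper_carrier: "m < M \<Longrightarrow> upper z m t \<in> carrier_vec (N 1)"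
proof (induction m arbitrary: t)
  case 0
  then show ?case by simp
next
  case (Suc m)
  then show ?case using Lm_vec_carrier[of "M - m"] by simp
qed

text \<open>A state reaches layer \<open>j\<close> after \<open>Ds j\<close>, and its effect returns
  to layer \<open>l = M - m\<close> after a further \<open>Ds j - Ds l\<close>. For
  \<open>l = 1\<close> this is the full round trip \<open>2 * Ds j\<close>.\<close>

lemma upper_index:
  assumes i: "i < N 1"
  shows "m < M \<Longrightarrow> upper z m t $ i
    = - (\<Sum>j=Suc (M - m)..M. (Lm j *\<^sub>v z (t - (2 * Ds j - Ds (M - m)))) $ i)"
proof (induction m arbitrary: t)
  case 0
  then show ?case using i by simp
next
  case (Suc m)
  define l where "l = M - Suc m"
  have l: "M - m = Suc l" "1 \<le> l" "Suc l \<le> M" using Suc.prems by (auto simp: l_def)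
  have D: "Ds (Suc l) = Ds l + \<tau> (Suc l)" by (rule Ds_Suc[OF l(2)])
  have c: "Lm (Suc l) *\<^sub>v v \<in> carrier_vec (N 1)" for v by (rule Lm_vec_carrier) simp
  have "upper z (Suc m) t $ i = upper z m (t - \<tau> (Suc l)) $ i
      - (Lm (Suc l) *\<^sub>v z (t - \<tau> (Suc l) - Ds (Suc l))) $ i"
    using i carrier_vecD[OF c] by (simp add: l)
  also have "upper z m (t - \<tau> (Suc l)) $ i
      = - (\<Sum>j=Suc (Suc l)..M. (Lm j *\<^sub>v z (t - (2 * Ds j - Ds l))) $ i)"
    using Suc.IH[of "t - \<tau> (Suc l)"] Suc.prems by (simp add: l D algebra_simps)
  also have "t - \<tau> (Suc l) - Ds (Suc l) = t - (2 * Ds (Suc l) - Ds l)" by (simp add: D)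
  also have "- (\<Sum>j=Suc (Suc l)..M. (Lm j *\<^sub>v z (t - (2 * Ds j - Ds l))) $ i)
      - (Lm (Suc l) *\<^sub>v z (t - (2 * Ds (Suc l) - Ds l))) $ i
      = - (\<Sum>j=Suc l..M. (Lm j *\<^sub>v z (t - (2 * Ds j - Ds l))) $ i)"
    using sum.atLeast_Suc_atMost[OF l(3), of "\<lambda>j. (Lm j *\<^sub>v z (t - (2 * Ds j - Ds l))) $ i"] by simp
  finally show ?case by (simp add: l_def[symmetric])
qed

lemma Lm_vec_0: "1 \<le> l \<Longrightarrow> Lm l *\<^sub>v 0\<^sub>v (N 1) = 0\<^sub>v (N 1)"
  by (rule mult_mat_zero_vec[OF Lm_carrier])

lemma upper_neg:
  assumes m: "m < M" and z: "\<And>t. t < 0 \<Longrightarrow> z t = 0\<^sub>v (N 1)" and t: "t < 0"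
  shows "upper z m t = 0\<^sub>v (N 1)"
proof
  fix i assume "i < dim_vec (0\<^sub>v (N 1) :: real Matrix.vec)"
  then have i: "i < N 1" by simp
  have "(Lm j *\<^sub>v z (t - (2 * Ds j - Ds (M - m)))) $ i = 0" if j: "j \<in> {Suc (M - m)..M}" for j
  proof -
    have "Ds (M - m) \<le> Ds j" "0 \<le> Ds j" using j by (auto intro: Ds_mono Ds_nonneg)
    then have "z (t - (2 * Ds j - Ds (M - m))) = 0\<^sub>v (N 1)" using t by (intro z) linarith
    then show ?thesis using i j Lm_vec_0[of j] by simp
  qed
  then show "upper z m t $ i = 0\<^sub>v (N 1) $ i"
    using i by (simp add: upper_index[OF i m])
qed (use upper_carrier[OF m] in simp)

text \<open>Recovering a layer signal from its transported version by \<open>Cprod\<close> is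
  faithful only on the range of \<open>Bprod\<close>.\<close>

lemma upper_range:
  assumes z: "\<And>t. z t \<in> carrier_vec (N 1)"
  shows "m < M \<Longrightarrow> \<exists>w\<in>carrier_vec (N (M - m)). upper z m t = Bprod N k (M - m) *\<^sub>v w"
proof (induction m arbitrary: t)
  case 0
  have "0\<^sub>v (N 1) = Bprod N k M *\<^sub>v 0\<^sub>v (N M)"
    using 0 mult_mat_zero_vec[OF Bprod_carrier[of M]] by simp
  then show ?case unfolding upper.simps minus_nat.diff_0 by (metis zero_carrier_vec)
next
  case (Suc m)
  define l where "l = M - Suc m"
  have l: "M - m = Suc l" "1 \<le> l" "Suc l \<le> M" "M - Suc m = l" using Suc.prems by (auto simp: l_def)
  note B = Bprod_carrier[of "Suc l"]
  obtain w where w: "w \<in> carrier_vec (N (Suc l))" "upper z m (t - \<tau> (Suc l)) = Bprod N k (Suc l) *\<^sub>v w"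
    using Suc.IH[of "t - \<tau> (Suc l)"] Suc.prems unfolding l(1) by auto
  define u where "u = Smat (Suc l) *\<^sub>v (Cprod N k c (Suc l) *\<^sub>v z (t - \<tau> (Suc l) - Ds (Suc l)))"
  have u: "u \<in> carrier_vec (N (Suc l))" by (simp add: u_def)
  have "upper z (Suc m) t = Bprod N k (Suc l) *\<^sub>v w - Bprod N k (Suc l) *\<^sub>v u"
    using w Lm_vec[of "Suc l" "z (t - \<tau> (Suc l) - Ds (Suc l))"] z by (simp add: l u_def)
  also have "\<dots> = Bprod N k (Suc l) *\<^sub>v (w - u)"
    using mult_minus_distrib_mat_vec[OF B w(1) u] by simp
  finally have "upper z (Suc m) t = Bprod N k (Suc l) *\<^sub>v (w - u)" .
  moreover have "w - u \<in> carrier_vec (N (Suc l))" using w u by simp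
  ultimately show ?case
    using Bprod_factor[of l "Suc l" "w - u"] l(2) unfolding l(4) by auto
qed

section \<open>The full delayed system and the reduced equation\<close>

lemma solution_states:
  assumes sol: "delayed_sol M N k A a c \<tau> x0 x y"
  shows "1 \<le> l \<Longrightarrow> l \<le> M \<Longrightarrow> x l t = Cprod N k c l *\<^sub>v x 1 (t - Ds l)"
proof (induction l arbitrary: t rule: nat_induct_at_least)
  case base
  have "x 1 t \<in> carrier_vec (N 1)" using sol base by (auto simp: delayed_sol_def)
  then show ?case by (simp add: Ds_1 Cprod_1)
next
  case (Suc l)
  have c1: "x 1 s \<in> carrier_vec (N 1)" for s using sol M_ge_2 by (auto simp: delayed_sol_def)
  show ?case
  proof (cases "t \<ge> 0")
    case True
    have "x (Suc l) t = Cmat N k c l *\<^sub>v x l (t - \<tau> (Suc l))"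
      using sol True Suc by (fastforce simp: delayed_sol_def)
    also have "x l (t - \<tau> (Suc l)) = Cprod N k c l *\<^sub>v x 1 (t - Ds (Suc l))"
      using Suc.IH[of "t - \<tau> (Suc l)"] Suc by (simp add: Ds_Suc algebra_simps)
    finally show ?thesis using Cprod_Suc[OF Suc.hyps c1] by simp
  next
    \<comment> \<open>The recursion is imposed only for nonnegative times; at negative ones both
      sides are zero.\<close>
    case False
    then have "x 1 (t - Ds (Suc l)) = 0\<^sub>v (N 1)"
      using sol Ds_nonneg[OF Suc.prems] M_ge_2 by (auto simp: delayed_sol_def)
    moreover have "x (Suc l) t = 0\<^sub>v (N (Suc l))"
      using sol False Suc by (auto simp: delayed_sol_def)
    moreover have "Cprod N k c (Suc l) *\<^sub>v 0\<^sub>v (N 1) = 0\<^sub>v (N (Suc l))"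
      by (rule mult_mat_zero_vec[OF Cprod_carrier]) simp
    ultimately show ?thesis by simp
  qed
qed

lemma solution_inputs:
  assumes sol: "delayed_sol M N k A a c \<tau> x0 x y"
  shows "m < M \<Longrightarrow> Bprod N k (M - m) *\<^sub>v y (M - m) t = upper (x 1) m t"
proof (induction m arbitrary: t)
  case 0
  have "y M t = 0\<^sub>v (N M)" using sol by (auto simp: delayed_sol_def)
  then show ?case using mult_mat_zero_vec[OF Bprod_carrier[of M]] 0 by simp
next
  case (Suc m)
  define l where "l = M - Suc m"
  have l: "M - m = Suc l" "1 \<le> l" "Suc l \<le> M" using Suc.prems by (auto simp: l_def)
  have c1: "x 1 s \<in> carrier_vec (N 1)" for s using sol M_ge_2 by (auto simp: delayed_sol_def)
  have z1: "x 1 s = 0\<^sub>v (N 1)" if "s < 0" for s using sol that M_ge_2 by (auto simp: delayed_sol_def)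
  have yc: "y (Suc l) s \<in> carrier_vec (N (Suc l))" for s using sol l by (auto simp: delayed_sol_def)
  show ?case
  proof (cases "t \<ge> 0")
    case True
    let ?s = "t - \<tau> (Suc l)"
    note B = Bprod_carrier[of "Suc l"]
    let ?u = "Smat (Suc l) *\<^sub>v x (Suc l) ?s"
    have "\<forall>l\<in>{2..M}. \<forall>t\<ge>0. y (l-1) t = Bmat N k (l-1) *\<^sub>v
          (y l (t - \<tau> l) - (Kmat N k a l * LD N k A l) *\<^sub>v x l (t - \<tau> l))"
      using sol by (auto simp: delayed_sol_def)
    then have "y (Suc l - 1) t = Bmat N k (Suc l - 1) *\<^sub>v
          (y (Suc l) ?s - (Kmat N k a (Suc l) * LD N k A (Suc l)) *\<^sub>v x (Suc l) ?s)"
      using True l by (metis One_nat_def Suc_le_mono atLeastAtMost_iff numeral_2_eq_2)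
    then have "Bprod N k l *\<^sub>v y l t = Bprod N k l *\<^sub>v (Bmat N k l *\<^sub>v (y (Suc l) ?s - ?u))"
      by (simp add: Smat_def)
    also have "\<dots> = Bprod N k (Suc l) *\<^sub>v (y (Suc l) ?s - ?u)"
      using yc by (intro Bprod_Suc[symmetric, OF l(2)]) simp
    also have "\<dots> = Bprod N k (Suc l) *\<^sub>v y (Suc l) ?s - Bprod N k (Suc l) *\<^sub>v ?u"
      by (rule mult_minus_distrib_mat_vec[OF B yc]) simp_all
    also have "Bprod N k (Suc l) *\<^sub>v y (Suc l) ?s = upper (x 1) m ?s"
      using Suc.IH[of ?s] Suc.prems by (simp add: l)
    also have "Bprod N k (Suc l) *\<^sub>v ?u = Lm (Suc l) *\<^sub>v x 1 (?s - Ds (Suc l))"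
      using Lm_vec[of "Suc l" "x 1 (?s - Ds (Suc l))"] c1 solution_states[OF sol, of "Suc l" ?s] l by simp
    finally show ?thesis by (simp add: l l_def[symmetric])
  next
    case False
    then have "y l t = 0\<^sub>v (N l)" using sol l by (auto simp: delayed_sol_def)
    then have "Bprod N k l *\<^sub>v y l t = 0\<^sub>v (N 1)"
      using mult_mat_zero_vec[OF Bprod_carrier[OF l(2)]] by simp
    then show ?thesis using upper_neg[where z = "x 1" and t = t, OF Suc.prems z1] False by (simp add: l_def)
  qed
qed

definition reduced_rhs :: "(real \<Rightarrow> real Matrix.vec) \<Rightarrow> nat \<Rightarrow> real \<Rightarrow> real" where
  "reduced_rhs z i t = - (\<Sum>j=1..M. (Lm j *\<^sub>v z (t - 2 * Ds j)) $ i)"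

lemma upper_reduced:
  assumes i: "i < N 1" and z: "\<And>t. z t \<in> carrier_vec (N 1)"
  shows "(upper z (M - 1) t - (Kmat N k a 1 * LD N k A 1) *\<^sub>v z t) $ i = reduced_rhs z i t"
proof -
  have K: "Kmat N k a 1 * LD N k A 1 = Lm 1" by (simp add: Lmat_def)
  have M: "M - 1 < M" "M - (M - 1) = 1" using M_ge_2 by auto
  have "(upper z (M - 1) t - Lm 1 *\<^sub>v z t) $ i = upper z (M - 1) t $ i - (Lm 1 *\<^sub>v z t) $ i"
    using i carrier_vecD[OF Lm_vec_carrier[of 1]] by simp
  also have "\<dots> = - (\<Sum>j=Suc 1..M. (Lm j *\<^sub>v z (t - 2 * Ds j)) $ i) - (Lm 1 *\<^sub>v z t) $ i"
    unfolding upper_index[OF i M(1)] M(2) Ds_1 by simp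
  also have "\<dots> = reduced_rhs z i t"
    using sum.atLeast_Suc_atMost[of 1 M "\<lambda>j. (Lm j *\<^sub>v z (t - 2 * Ds j)) $ i"] M_ge_2
    by (simp add: reduced_rhs_def Ds_1)
  finally show ?thesis unfolding K .
qed

lemma solution_reduced:
  assumes sol: "delayed_sol M N k A a c \<tau> x0 x y"
  shows "\<And>t. x 1 t \<in> carrier_vec (N 1)" "\<And>t. t < 0 \<Longrightarrow> x 1 t = 0\<^sub>v (N 1)" "x 1 0 = x0"
    "\<And>t i. t \<ge> 0 \<Longrightarrow> i < N 1 \<Longrightarrow> (reduced_rhs (x 1) i has_integral (x 1 t $ i - x0 $ i)) {0..t}"
proof -
  show c1: "x 1 t \<in> carrier_vec (N 1)" for t using sol M_ge_2 by (auto simp: delayed_sol_def)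
  show "x 1 t = 0\<^sub>v (N 1)" if "t < 0" for t using sol that M_ge_2 by (auto simp: delayed_sol_def)
  show "x 1 0 = x0" using sol by (auto simp: delayed_sol_def)
  fix t :: real and i assume t: "t \<ge> 0" and i: "i < N 1"
  have yc: "y 1 s \<in> carrier_vec (N 1)" for s using sol M_ge_2 by (auto simp: delayed_sol_def)
  have M: "M - 1 < M" "M - (M - 1) = 1" using M_ge_2 by auto
  have "y 1 s = upper (x 1) (M - 1) s" for s
    using solution_inputs[OF sol M(1), of s] Bprod_1[OF yc] by (simp add: M(2))
  then have "(y 1 s - (Kmat N k a 1 * LD N k A 1) *\<^sub>v x 1 s) $ i = reduced_rhs (x 1) i s" for s
    using upper_reduced[OF i c1] by simp
  moreover have "((\<lambda>s. (y 1 s - (Kmat N k a 1 * LD N k A 1) *\<^sub>v x 1 s) $ i)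
      has_integral (x 1 t $ i - x0 $ i)) {0..t}"
    using sol t i by (auto simp: delayed_sol_def)
  ultimately show "(reduced_rhs (x 1) i has_integral (x 1 t $ i - x0 $ i)) {0..t}"
    by (simp add: fun_eq_iff)
qed

text \<open>Disproving convergence requires a solution of the full system, so a solution of the
  reduced equation has to be extended to all layers. The input \<open>y\<close> is the transported
  coupling pulled back by \<open>Cprod\<close>.\<close>

lemma reduced_solution:
  assumes z: "\<And>t. z t \<in> carrier_vec (N 1)" and zn: "\<And>t. t < 0 \<Longrightarrow> z t = 0\<^sub>v (N 1)"
    and int: "\<And>t i. t \<ge> 0 \<Longrightarrow> i < N 1 \<Longrightarrow> (reduced_rhs z i has_integral (z t $ i - z 0 $ i)) {0..t}"
  defines "x \<equiv> \<lambda>l t. Cprod N k c l *\<^sub>v z (t - Ds l)"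
    and "y \<equiv> \<lambda>l t. Cprod N k c l *\<^sub>v upper z (M - l) t"
  shows "delayed_sol M N k A a c \<tau> (z 0) x y"
proof -
  have C0: "Cprod N k c l *\<^sub>v 0\<^sub>v (N 1) = 0\<^sub>v (N l)" if "1 \<le> l" for l
    by (rule mult_mat_zero_vec[OF Cprod_carrier[OF that]])
  have x1: "x 1 t = z t" for t using z by (simp add: x_def Ds_1 Cprod_1)
  have M: "M - 1 < M" using M_ge_2 by auto
  have y1: "y 1 t = upper z (M - 1) t" for t
    unfolding y_def by (rule Cprod_1[OF upper_carrier[OF M]])
  have yM: "y M t = 0\<^sub>v (N M)" for t using C0[of M] M_ge_2 by (simp add: y_def)
  have yl: "y l t = Bmat N k l *\<^sub>v (y (Suc l) (t - \<tau> (Suc l)) - Smat (Suc l) *\<^sub>v x (Suc l) (t - \<tau> (Suc l)))"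
    if l: "1 \<le> l" "Suc l \<le> M" for l t
  proof -
    let ?s = "t - \<tau> (Suc l)"
    define m where "m = M - Suc l"
    have m: "m < M" "Suc m < M" "M - l = Suc m" "M - m = Suc l"
      using l by (auto simp: m_def)
    let ?L = "Lm (Suc l) *\<^sub>v z (?s - Ds (Suc l))"
    note C = Cprod_carrier[of "Suc l"]
    have Lc: "?L \<in> carrier_vec (N 1)" by (rule Lm_vec_carrier) simp
    have up: "upper z (M - l) t = upper z m ?s - ?L" by (simp add: m)
    \<comment> \<open>One layer more than \<open>upper_range\<close> gives at layer
      \<open>l\<close>: both parts of the coupling lie in the range of
      \<open>Bprod N k (Suc l)\<close>, so \<open>y l\<close> is in the range of
      \<open>Bmat N k l\<close>.\<close>
    obtain w where w: "w \<in> carrier_vec (N (Suc l))" "upper z (M - l) t = Bprod N k (Suc l) *\<^sub>v w"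
    proof -
      obtain w1 where w1: "w1 \<in> carrier_vec (N (Suc l))" "upper z m ?s = Bprod N k (Suc l) *\<^sub>v w1"
        using upper_range[where z = z and m = m and t = ?s, OF z m(1)] unfolding m(4) by blast
      define u where "u = Smat (Suc l) *\<^sub>v (Cprod N k c (Suc l) *\<^sub>v z (?s - Ds (Suc l)))"
      have u: "u \<in> carrier_vec (N (Suc l))" by (simp add: u_def)
      have "?L = Bprod N k (Suc l) *\<^sub>v u" unfolding u_def by (rule Lm_vec[OF _ z]) simp
      then have "upper z (M - l) t = Bprod N k (Suc l) *\<^sub>v (w1 - u)"
        using up w1(2) mult_minus_distrib_mat_vec[OF Bprod_carrier w1(1) u] by simp
      moreover have "w1 - u \<in> carrier_vec (N (Suc l))" using w1 u by simp
      ultimately show ?thesis using that by blast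
    qed
    have w2: "upper z (M - l) t = Bprod N k l *\<^sub>v (Bmat N k l *\<^sub>v w)"
      unfolding w(2) by (rule Bprod_Suc[OF l(1) w(1)])
    have "y l t = Bmat N k l *\<^sub>v w"
      unfolding y_def w2 using l by (intro Cprod_Bprod) auto
    also have "w = Cprod N k c (Suc l) *\<^sub>v upper z (M - l) t"
      unfolding w(2) using l w(1) by (intro Cprod_Bprod[symmetric]) auto
    also have "\<dots> = Cprod N k c (Suc l) *\<^sub>v upper z m ?s - Cprod N k c (Suc l) *\<^sub>v ?L"
      unfolding up by (rule mult_minus_distrib_mat_vec[OF C upper_carrier[OF m(1)] Lc]) simp
    also have "Cprod N k c (Suc l) *\<^sub>v ?L = Smat (Suc l) *\<^sub>v x (Suc l) ?s"
      unfolding x_def using l by (intro Cprod_Lm z) auto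
    also have "Cprod N k c (Suc l) *\<^sub>v upper z m ?s = y (Suc l) ?s"
      by (simp add: y_def m_def)
    finally show ?thesis .
  qed
  show ?thesis
    unfolding delayed_sol_def
  proof (intro conjI ballI allI impI)
    fix l t assume "l \<in> {1..M}"
    then have l: "1 \<le> l" "l \<le> M" by auto
    show "x l t \<in> carrier_vec (N l)" "y l t \<in> carrier_vec (N l)"
      unfolding x_def y_def using l by (auto intro: Cprod_vec_carrier)
    assume t: "t < (0::real)"
    show "x l t = 0\<^sub>v (N l)"
      unfolding x_def using zn[of "t - Ds l"] Ds_nonneg[OF l(2)] t C0[OF l(1)] by simp
    show "y l t = 0\<^sub>v (N l)"
      unfolding y_def using upper_neg[of "M - l" z t] zn t l C0[OF l(1)] by simp
  next
    show "x 1 0 = z 0" by (rule x1)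
    show "y M t = 0\<^sub>v (N M)" for t by (rule yM)
  next
    fix l t assume "l \<in> {2..M}"
    then obtain p where p: "l = Suc p" "1 \<le> p" "Suc p \<le> M" by (cases l) auto
    show "x l t = Cmat N k c (l - 1) *\<^sub>v x (l - 1) (t - \<tau> l)"
      unfolding x_def p(1) using Cprod_Suc[OF p(2) z, of "t - Ds (Suc p)"] p
      by (simp add: Ds_Suc algebra_simps)
    show "y (l - 1) t = Bmat N k (l - 1) *\<^sub>v
        (y l (t - \<tau> l) - (Kmat N k a l * LD N k A l) *\<^sub>v x l (t - \<tau> l))"
      using yl[OF p(2,3), of t] p by (simp add: Smat_def)
  next
    fix t :: real and i assume t: "0 \<le> t" and i: "i < N 1"
    show "((\<lambda>s. (y 1 s - (Kmat N k a 1 * LD N k A 1) *\<^sub>v x 1 s) $ i)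
        has_integral (x 1 t $ i - z 0 $ i)) {0..t}"
      using int[OF t i] upper_reduced[where z = z, OF i z] by (simp add: y1 x1)
  qed
qed

section \<open>The stability threshold\<close>

lemma consensus_if_small_delays:
  assumes sol: "delayed_sol M N k A a c \<tau> x0 x y"
    and small: "\<forall>l\<in>{2..M}. 4 * lam_max (Lm l) * Ds l < pi"
    and i: "i < N 1"
  shows "((\<lambda>t. x 1 t $ i) \<longlongrightarrow> (\<Sum>j<N 1. a j * x0 $ j) / (\<Sum>j<N 1. a j)) at_top"
proof -
  let ?n = "N 1"
  define z where "z = x 1"
  note red = solution_reduced[OF sol, folded z_def]
  have zc: "z t \<in> carrier_vec ?n" for t by (rule red(1))
  have L: "Lm j \<in> carrier_mat ?n ?n" if "j \<in> {1..M}" for j using that by (intro Lm_carrier) auto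
  have cz: "continuous_on {0..} (\<lambda>t. z t $ i)" if "i < ?n" for i
    by (rule continuous_of_integral_equation[OF red(4)[OF _ that]])
  \<comment> \<open>The longest round trip; after it every delayed argument is nonnegative, so the
    right-hand side is continuous.\<close>
  define b where "b = 2 * Ds M"
  have b0: "0 \<le> b" using Ds_nonneg[of M] by (simp add: b_def)
  have Db: "0 \<le> Ds j" "2 * Ds j \<le> b" if "j \<in> {1..M}" for j
    using that Ds_nonneg[of j] Ds_mono[of j M] by (auto simp: b_def)
  have ch: "continuous_on {b..} (reduced_rhs z i)" if i: "i < ?n" for i
  proof -
    have "continuous_on {b..} (\<lambda>t. (Lm j *\<^sub>v z (t - 2 * Ds j)) $ i)" if j: "j \<in> {1..M}" for j
      unfolding square_mult_index[OF L[OF j] zc i]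
      by (intro continuous_intros continuous_on_compose2[OF cz]) (use Db[OF j] in auto)
    then show ?thesis unfolding reduced_rhs_def[abs_def] by (intro continuous_intros)
  qed
  have dz: "vder ?n z (Matrix.vec ?n (\<lambda>i. - (\<Sum>j=1..M. (Lm j *\<^sub>v z (t - 2 * Ds j)) $ i))) t" if "t > b" for t
    unfolding vder_def
  proof (intro allI impI)
    fix i assume i: "i < ?n"
    have "((\<lambda>t. z t $ i) has_real_derivative reduced_rhs z i t) (at t)"
      by (rule deriv_of_integral_equation[OF red(4)[OF _ i] ch[OF i] b0 that])
    then show "((\<lambda>t. z t $ i) has_real_derivative
        Matrix.vec ?n (\<lambda>i. - (\<Sum>j=1..M. (Lm j *\<^sub>v z (t - 2 * Ds j)) $ i)) $ i) (at t)"
      using i by (simp add: reduced_rhs_def)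
  qed
  \<comment> \<open>The scalar condition for the round-trip delay \<open>2 * Ds l\<close>; layer 1
    acts without delay and meets it trivially.\<close>
  have T: "0 \<le> 2 * Ds l \<and> lam_max (Lm l) * (2 * Ds l) < pi / 2" if l: "1 \<le> l" "l \<le> M" for l
  proof (cases "l = 1")
    case True
    then show ?thesis by (simp add: Ds_1)
  next
    case False
    then have "4 * lam_max (Lm l) * Ds l < pi" using small l by auto
    then show ?thesis using Ds_nonneg[OF l(2)] by simp
  qed
  have cz': "vcont ?n z b"
    unfolding vcont_def using b0 by (auto intro!: continuous_on_subset[OF cz])
  have dec: "((\<lambda>t. (Lm l *\<^sub>v z t) $ i) \<longlongrightarrow> 0) at_top" if "1 \<le> l" "l \<le> M" "i < ?n" for l i
    using layer_vsq[where x = z and T = "\<lambda>l. 2 * Ds l", OF zc cz' T dz that(1,2)] that(3) by blast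
  have inv: "(\<Sum>j<?n. a j * z t $ j) = (\<Sum>j<?n. a j * x0 $ j)" if t: "t \<ge> 0" for t
  proof -
    have "((\<lambda>s. \<Sum>i<?n. a i * reduced_rhs z i s) has_integral (\<Sum>i<?n. a i * (z t $ i - x0 $ i))) {0..t}"
      by (intro has_integral_sum has_integral_mult_right red(4)[OF t]) auto
    moreover have "(\<Sum>i<?n. a i * reduced_rhs z i s) = 0" for s
    proof -
      have "(\<Sum>i<?n. a i * reduced_rhs z i s)
          = - (\<Sum>i<?n. \<Sum>j=1..M. a i * (Lm j *\<^sub>v z (s - 2 * Ds j)) $ i)"
        by (simp add: reduced_rhs_def sum_negf sum_distrib_left)
      also have "\<dots> = - (\<Sum>j=1..M. \<Sum>i<?n. a i * (Lm j *\<^sub>v z (s - 2 * Ds j)) $ i)"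
        by (subst sum.swap) simp
      also have "\<dots> = 0" using a_Lm[OF _ _ zc] by simp
      finally show ?thesis .
    qed
    ultimately have "(\<Sum>i<?n. a i * (z t $ i - x0 $ i)) = 0"
      by (simp add: has_integral_0_eq)
    then show ?thesis by (simp add: right_diff_distrib sum_subtractf)
  qed
  have "\<forall>\<^sub>F t in at_top. (\<Sum>j<?n. a j * z t $ j) = (\<Sum>j<?n. a j * x0 $ j)"
    using eventually_ge_at_top[of 0] by eventually_elim (rule inv)
  then show ?thesis unfolding z_def[symmetric] by (rule consensus_of_decay[OF zc _ dec i])
qed

section \<open>Failure of consensus at and beyond the threshold\<close>

lemma lam_max_eigenvalue:
  assumes l: "1 \<le> l" "l \<le> M"
  shows "eigenvalue (Lm l) (lam_max (Lm l))"
proof -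
  let ?one = "Matrix.vec (N 1) (\<lambda>_. 1) :: real Matrix.vec"
  have "?one \<noteq> 0\<^sub>v (N 1)"
  proof
    assume "?one = 0\<^sub>v (N 1)"
    then have "?one $ 0 = (0\<^sub>v (N 1) :: real Matrix.vec) $ 0" by simp
    then show False using N_pos[of 1] M_ge_2 by simp
  qed
  moreover have "Lm l *\<^sub>v ?one = 0 \<cdot>\<^sub>v ?one" unfolding Lm_const[OF l] by (intro eq_vecI) auto
  \<comment> \<open>Guarantees that the spectrum is nonempty, so that \<open>Max\<close> is
    attained.\<close>
  ultimately have "eigenvalue (Lm l) 0"
    unfolding eigenvalue_def eigenvector_def using carrier_matD[OF Lm_carrier[OF l(1)]]
    by (intro exI[of _ ?one]) simp
  then show ?thesis
    unfolding lam_max_def using Max_in[OF Lm_eigenvalue_finite[OF l(1)]] by blast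
qed

text \<open>The transpose has the same characteristic polynomial. A left eigenvector is used
  because, for \<open>r \<noteq> 0\<close>, it also annihilates the ranges of the layers above
  \<open>l\<close>, and so yields a closed scalar equation.\<close>

lemma left_eigenvector:
  assumes l: "1 \<le> l" and ev: "eigenvalue (Lm l) r"
  shows "\<exists>y i. i < N 1 \<and> y i \<noteq> 0 \<and>
    (\<forall>v\<in>carrier_vec (N 1). (\<Sum>i<N 1. y i * (Lm l *\<^sub>v v) $ i) = r * (\<Sum>i<N 1. y i * v $ i))"
proof -
  let ?n = "N 1" and ?L = "Lm l"
  have L: "?L \<in> carrier_mat ?n ?n" by (rule Lm_carrier[OF l])
  then have Lt: "transpose_mat ?L \<in> carrier_mat ?n ?n" by simp
  have "eigenvalue (transpose_mat ?L) r"
    using ev by (simp add: eigenvalue_root_char_poly[OF L] eigenvalue_root_char_poly[OF Lt]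
        char_poly_transpose_mat[OF L])
  then obtain v where v: "v \<in> carrier_vec ?n" "v \<noteq> 0\<^sub>v ?n" "transpose_mat ?L *\<^sub>v v = r \<cdot>\<^sub>v v"
    using Lt unfolding eigenvalue_def eigenvector_def by auto
  obtain i where i: "i < ?n" "v $ i \<noteq> 0"
  proof -
    have "v = 0\<^sub>v ?n" if "\<And>i. i < ?n \<Longrightarrow> v $ i = 0"
      using that carrier_vecD[OF v(1)] by (intro eq_vecI) simp_all
    then show ?thesis using v(2) that by blast
  qed
  have col: "(\<Sum>i<?n. v $ i * ?L $$ (i,j)) = r * v $ j" if j: "j < ?n" for j
  proof -
    have "r * v $ j = (transpose_mat ?L *\<^sub>v v) $ j" using v j by simp
    also have "\<dots> = (\<Sum>i<?n. v $ i * ?L $$ (i,j))"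
      unfolding square_mult_index[OF Lt v(1) j] using j carrier_matD[OF L]
      by (intro sum.cong) (auto simp: mult.commute)
    finally show ?thesis by simp
  qed
  have "(\<Sum>i<?n. v $ i * (?L *\<^sub>v x) $ i) = r * (\<Sum>i<?n. v $ i * x $ i)" if x: "x \<in> carrier_vec ?n" for x
  proof -
    have "(\<Sum>i<?n. v $ i * (?L *\<^sub>v x) $ i) = (\<Sum>i<?n. \<Sum>j<?n. v $ i * ?L $$ (i,j) * x $ j)"
      by (intro sum.cong) (auto simp: square_mult_index[OF L x] sum_distrib_left mult.assoc)
    also have "\<dots> = (\<Sum>j<?n. (\<Sum>i<?n. v $ i * ?L $$ (i,j)) * x $ j)"
      by (subst sum.swap) (simp add: sum_distrib_right)
    also have "\<dots> = (\<Sum>j<?n. r * (v $ j * x $ j))"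
      using col by (intro sum.cong) auto
    finally show ?thesis by (simp add: sum_distrib_left)
  qed
  then show ?thesis using i by (intro exI[of _ "\<lambda>i. v $ i"] exI[of _ i]) auto
qed

lemma no_consensus_if_large_delay:
  assumes l: "l \<in> {2..M}" and large: "4 * lam_max (Lm l) * Ds l \<ge> pi"
  shows "\<exists>x0\<in>carrier_vec (N 1). \<exists>x y. delayed_sol M N k A a c \<tau> x0 x y \<and>
    \<not> (\<forall>i<N 1. ((\<lambda>t. x 1 t $ i) \<longlongrightarrow> (\<Sum>j<N 1. a j * x0 $ j) / (\<Sum>j<N 1. a j)) at_top)"
proof -
  let ?n = "N 1" and ?L = "Lm l"
  have l1: "1 \<le> l" "l \<le> M" using l by auto
  define r where "r = lam_max ?L"
  have ev: "eigenvalue ?L r" unfolding r_def by (rule lam_max_eigenvalue[OF l1])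
  have rD: "4 * r * Ds l \<ge> pi" using large by (simp add: r_def)
  then have "r * Ds l > 0" using pi_gt_zero by linarith
  then have r: "r > 0" and D: "Ds l > 0" using Ds_nonneg[OF l1(2)] by (auto simp: zero_less_mult_iff)
  obtain y e where e: "e < ?n" "y e \<noteq> 0"
    and y: "\<And>v. v \<in> carrier_vec ?n \<Longrightarrow> (\<Sum>i<?n. y i * (?L *\<^sub>v v) $ i) = r * (\<Sum>i<?n. y i * v $ i)"
    using left_eigenvector[OF l1(1) ev] by blast
  \<comment> \<open>In the range of \<open>Lm l\<close>: lower layers annihilate it, its weighted
    mean is 0, and its pairing with \<open>y\<close> is \<open>r * y e\<close>, which is
    nonzero.\<close>
  define x0 where "x0 = ?L *\<^sub>v unit_vec ?n e"
  have x0: "x0 \<in> carrier_vec ?n" unfolding x0_def by (rule Lm_vec_carrier[OF l1(1)])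
  \<comment> \<open>Only the layers from \<open>l\<close> on are kept, because their delays are at
    least \<open>2 * Ds l > 0\<close>; layer 1 has none, and others below \<open>l\<close> may have
    none either.\<close>
  obtain w where wn: "\<And>t i. t < 0 \<Longrightarrow> w t i = 0"
    and wint: "\<And>t i. t \<ge> 0 \<Longrightarrow> ((\<lambda>s. - (\<Sum>j\<in>{l..M}. \<Sum>q<?n. Lm j $$ (i,q) * w (s - 2 * Ds j) q))
      has_integral w t i - x0 $ i) {0..t}"
  proof -
    have "\<exists>z. (\<forall>t<0. \<forall>i. z t i = 0) \<and> (\<forall>t\<ge>0. \<forall>i.
      ((\<lambda>s. - (\<Sum>j\<in>{l..M}. \<Sum>q<?n. Lm j $$ (i,q) * z (s - 2 * Ds j) q)) has_integral z t i - x0 $ i) {0..t})"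
      by (rule method_of_steps[of _ "2 * Ds l"]) (use D in \<open>auto intro: Ds_mono\<close>)
    then show ?thesis using that by blast
  qed
  define z where "z t = Matrix.vec ?n (w t)" for t
  have zc: "z t \<in> carrier_vec ?n" for t by (simp add: z_def)
  have zi: "z t $ i = w t i" if "i < ?n" for t i using that by (simp add: z_def)
  have zn: "z t = 0\<^sub>v ?n" if "t < 0" for t using that wn by (intro eq_vecI) (auto simp: z_def)
  have Lz: "(Lm j *\<^sub>v z t) $ i = (\<Sum>q<?n. Lm j $$ (i,q) * w t q)" if "1 \<le> j" "i < ?n" for i j t
    unfolding square_mult_index[OF Lm_carrier[OF that(1)] zc that(2)] by (simp add: zi)
  let ?g = "\<lambda>i s. - (\<Sum>j\<in>{l..M}. (Lm j *\<^sub>v z (s - 2 * Ds j)) $ i)"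
  have int: "(?g i has_integral z t $ i - x0 $ i) {0..t}" if "t \<ge> 0" "i < ?n" for t i
  proof -
    have "?g i s = - (\<Sum>j\<in>{l..M}. \<Sum>q<?n. Lm j $$ (i,q) * w (s - 2 * Ds j) q)" for s
      using that(2) l1(1) by (intro arg_cong[where f = uminus] sum.cong) (auto intro!: Lz)
    then show ?thesis using wint[OF that(1), of i] that(2) by (simp add: zi)
  qed
  have z0: "z 0 = x0"
  proof
    fix i assume "i < dim_vec x0"
    then have i: "i < ?n" using x0 by simp
    show "z 0 $ i = x0 $ i" using has_integral_unique[OF _ has_integral_refl(2)] int[of 0 i] i by fastforce
  qed (use x0 in \<open>simp add: z_def\<close>)
  have lin_int: "((\<lambda>s. - (\<Sum>j\<in>{l..M}. \<Sum>i<?n. h i * (Lm j *\<^sub>v z (s - 2 * Ds j)) $ i))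
      has_integral (\<Sum>i<?n. h i * z t $ i) - (\<Sum>i<?n. h i * x0 $ i)) {0..t}" if t: "t \<ge> 0" for h t
  proof -
    have "((\<lambda>s. \<Sum>i<?n. h i * ?g i s) has_integral (\<Sum>i<?n. h i * (z t $ i - x0 $ i))) {0..t}"
      by (intro has_integral_sum has_integral_mult_right int[OF t]) auto
    moreover have "(\<Sum>i<?n. h i * ?g i s) = - (\<Sum>j\<in>{l..M}. \<Sum>i<?n. h i * (Lm j *\<^sub>v z (s - 2 * Ds j)) $ i)" for s
    proof -
      have "(\<Sum>i<?n. h i * ?g i s) = - (\<Sum>i<?n. \<Sum>j\<in>{l..M}. h i * (Lm j *\<^sub>v z (s - 2 * Ds j)) $ i)"
        by (simp add: sum_negf sum_distrib_left)
      then show ?thesis by (subst (asm) sum.swap) simp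
    qed
    ultimately show ?thesis by (simp add: right_diff_distrib sum_subtractf)
  qed
  \<comment> \<open>The omitted layers contribute nothing along this solution, so it solves the full
    reduced equation.\<close>
  have low: "Lm p *\<^sub>v z t = 0\<^sub>v ?n" if p: "1 \<le> p" "p < l" for p t
  proof (cases "t < 0")
    case True
    then show ?thesis using zn Lm_vec_0[OF p(1)] by simp
  next
    case False
    note P = Lm_carrier[OF p(1)]
    show ?thesis
    proof
      fix i assume "i < dim_vec (0\<^sub>v ?n :: real Matrix.vec)"
      then have i: "i < ?n" by simp
      have row: "(\<Sum>q<?n. Lm p $$ (i,q) * (Lm j *\<^sub>v v) $ q) = 0" if "j \<in> {l..M}" "v \<in> carrier_vec ?n" for j v
      proof -
        have "Lm j *\<^sub>v v \<in> carrier_vec ?n" using that l1 by (intro Lm_vec_carrier) auto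
        then have "(\<Sum>q<?n. Lm p $$ (i,q) * (Lm j *\<^sub>v v) $ q) = (Lm p *\<^sub>v (Lm j *\<^sub>v v)) $ i"
          using square_mult_index[OF P _ i] by simp
        also have "\<dots> = 0" using Lm_Lm_vec[OF p(1) _ _ that(2), of j] that p i by auto
        finally show ?thesis .
      qed
      have "((\<lambda>s. 0) has_integral (\<Sum>q<?n. Lm p $$ (i,q) * z t $ q) - (\<Sum>q<?n. Lm p $$ (i,q) * x0 $ q)) {0..t}"
        using lin_int[of t "\<lambda>q. Lm p $$ (i,q)"] False row[OF _ zc] by simp
      then have "(\<Sum>q<?n. Lm p $$ (i,q) * z t $ q) = (\<Sum>q<?n. Lm p $$ (i,q) * x0 $ q)"
        by (simp add: has_integral_0_eq)
      also have "\<dots> = 0" unfolding x0_def using l1 by (intro row) auto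
      finally show "(Lm p *\<^sub>v z t) $ i = 0\<^sub>v ?n $ i" using i by (simp add: square_mult_index[OF P zc i])
    qed (use P in simp)
  qed
  have rr: "reduced_rhs z i s = ?g i s" if i: "i < ?n" for i s
  proof -
    have "(\<Sum>j=1..M. (Lm j *\<^sub>v z (s - 2 * Ds j)) $ i) = (\<Sum>j=l..M. (Lm j *\<^sub>v z (s - 2 * Ds j)) $ i)"
      using low i l1 by (intro sum.mono_neutral_right) auto
    then show ?thesis by (simp add: reduced_rhs_def)
  qed
  have int': "(reduced_rhs z i has_integral z t $ i - z 0 $ i) {0..t}" if "t \<ge> 0" "i < ?n" for t i
    unfolding z0 by (rule has_integral_eq[OF _ int[OF that]]) (simp add: rr[OF that(2)])
  note sol = reduced_solution[where z = z, OF zc zn int', unfolded z0]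
  let ?x = "\<lambda>l t. Cprod N k c l *\<^sub>v z (t - Ds l)"
  have x1: "?x 1 t = z t" for t using zc by (simp add: Ds_1 Cprod_1)
  have mean: "(\<Sum>j<?n. a j * x0 $ j) = 0" unfolding x0_def by (rule a_Lm[OF l1]) simp
  define s where "s t = (\<Sum>i<?n. y i * z t $ i)" for t
  define s0 where "s0 = (\<Sum>i<?n. y i * x0 $ i)"
  have "s0 = r * (\<Sum>i<?n. y i * (unit_vec ?n e :: real Matrix.vec) $ i)"
    unfolding s0_def x0_def by (rule y) simp
  also have "(\<Sum>i<?n. y i * (unit_vec ?n e :: real Matrix.vec) $ i) = (\<Sum>i<?n. if i = e then y i else 0)"
    by (intro sum.cong) (auto simp: unit_vec_def)
  finally have s0: "s0 \<noteq> 0" using r e by simp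
  \<comment> \<open>A nonzero eigenvalue lets \<open>y\<close> be written as \<open>y L / r\<close>,
    and \<open>L\<close> annihilates the ranges of the layers above.\<close>
  have yhigh: "(\<Sum>i<?n. y i * (Lm j *\<^sub>v v) $ i) = 0" if "j \<in> {l..M} - {l}" "v \<in> carrier_vec ?n" for j v
  proof -
    have c: "Lm j *\<^sub>v v \<in> carrier_vec ?n" using that l1 by (intro Lm_vec_carrier) auto
    have "r * (\<Sum>i<?n. y i * (Lm j *\<^sub>v v) $ i) = (\<Sum>i<?n. y i * (?L *\<^sub>v (Lm j *\<^sub>v v)) $ i)"
      using y[OF c] by simp
    also have "?L *\<^sub>v (Lm j *\<^sub>v v) = 0\<^sub>v ?n" using Lm_Lm_vec[OF l1(1) _ _ that(2), of j] that by auto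
    finally show ?thesis using r by simp
  qed
  have "\<not> (s \<longlongrightarrow> 0) at_top"
  proof (rule delay_equation_no_decay[OF r, of "2 * Ds l" s s0])
    show "s t = 0" if "t < 0" for t using zn[OF that] by (simp add: s_def)
    fix t :: real assume t: "0 \<le> t"
    have "(\<Sum>j\<in>{l..M}. \<Sum>i<?n. y i * (Lm j *\<^sub>v z (u - 2 * Ds j)) $ i) = r * s (u - 2 * Ds l)" for u
    proof -
      have "(\<Sum>j\<in>{l..M}. \<Sum>i<?n. y i * (Lm j *\<^sub>v z (u - 2 * Ds j)) $ i)
          = (\<Sum>j\<in>{l}. \<Sum>i<?n. y i * (Lm j *\<^sub>v z (u - 2 * Ds j)) $ i)"
        using yhigh[OF _ zc] l1 by (intro sum.mono_neutral_right) auto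
      then show ?thesis by (simp add: y[OF zc] s_def)
    qed
    then show "((\<lambda>u. - r * s (u - 2 * Ds l)) has_integral s t - s0) {0..t}"
      using lin_int[OF t, of y] by (simp add: s_def s0_def)
  qed (use D rD s0 in auto)
  moreover have "(s \<longlongrightarrow> 0) at_top"
    if "\<forall>i<?n. ((\<lambda>t. ?x 1 t $ i) \<longlongrightarrow> (\<Sum>j<?n. a j * x0 $ j) / (\<Sum>j<?n. a j)) at_top"
  proof -
    have "((\<lambda>t. z t $ i) \<longlongrightarrow> 0) at_top" if "i < ?n" for i
      using \<open>\<forall>i<?n. _\<close> that unfolding x1 mean by simp
    then have "((\<lambda>t. \<Sum>i<?n. y i * z t $ i) \<longlongrightarrow> (\<Sum>i<?n. y i * 0)) at_top"
      by (intro tendsto_intros) auto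
    then show ?thesis by (simp add: s_def[abs_def])
  qed
  ultimately show ?thesis using x0 sol by blast
qed

end

text \<open>The bound is multiplied out because the largest eigenvalue is 0 when all groups of a
  layer are single nodes; then no delay is excluded. Convergence is asserted for all solutions, so
  it is the converse that needs one to be constructed.\<close>

theorem theorem7:
  fixes M :: nat and N :: "nat \<Rightarrow> nat" and k :: "nat \<Rightarrow> nat \<Rightarrow> nat"
    and A :: "nat \<Rightarrow> nat \<Rightarrow> real Matrix.mat" and a :: "nat \<Rightarrow> real"
    and c :: "nat \<Rightarrow> nat \<Rightarrow> real" and \<tau> :: "nat \<Rightarrow> real"
  assumes hs: "hier_structure M N k A a c"
    and tau: "\<forall>l\<in>{2..M}. \<tau> l \<ge> 0"
  shows "{s. det (charmat M N k A a c \<tau> s) = 0}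
           = {0}
             \<union> {s. \<exists>mu. mu \<noteq> 0 \<and> eigenvalue (map_mat complex_of_real (Lmat N k A a c 1)) mu
                        \<and> s + mu = 0}
             \<union> (\<Union>l\<in>{2..M}. {s. \<exists>mu. mu \<noteq> 0
                        \<and> eigenvalue (map_mat complex_of_real (Lmat N k A a c l)) mu
                        \<and> s * exp (2 * s * complex_of_real (Dsum \<tau> l)) + mu = 0})
       \<and> ((\<forall>x0 \<in> carrier_vec (N 1). \<forall>x y. delayed_sol M N k A a c \<tau> x0 x y \<longrightarrow>
             (\<forall>i<N 1. ((\<lambda>t. x 1 t $ i) \<longlongrightarrow>
                 (\<Sum>j<N 1. a j * x0 $ j) / (\<Sum>j<N 1. a j)) at_top))
          \<longleftrightarrow> (\<forall>l\<in>{2..M}. 4 * lam_max (Lmat N k A a c l) * Dsum \<tau> l < pi))"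
    (is "_ \<and> (?conv \<longleftrightarrow> ?small)")
proof -
  interpret delayed_hierarchy M N k A a c \<tau>
    by unfold_locales (fact hs tau)+
  have "?conv" if ?small
    using consensus_if_small_delays[OF _ that] by blast
  moreover have "?small" if ?conv
    using no_consensus_if_large_delay that by (meson not_le)
  ultimately show ?thesis using characteristic_roots[of \<tau>] by blast
qed

end
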